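(* Let $k\ge 2$ be an integer and let $G_k$ be the graph with vertex set $\{x_1,\dots,x_{2k},y_1,\dots,y_{2k}\}$ and edge set $\{\{x_i,y_i\},\{x_i,x_{i+1}\} : 1\le i\le 2k\}$, where $x_{2k+1}:=x_1$. Then $G_k$ is a Cohen-Macaulay bipartite graph which is also a whiskered graph, and the ideal $\mathrm{HS}_k(J(G_k))$ does not have a linear resolution; hence $\mathrm{HS}_k(J(G_k))$ does not have linear quotients.
   Context: Let $\mathbb{K}$ be a field. For a finite simple graph $G$, identify the vertices of $G$ with the variables of a polynomial ring $R$ over $\mathbb{K}$. A vertex cover of $G$ is a set of vertices meeting every edge; it is minimal if it is minimal with respect to inclusion. For a set $A$ of vertices, $\mathbf{x}_A$ denotes the product of the variables in $A$. The vertex cover ideal is $J(G)=\langle \mathbf{x}_{\mathcal C} : \mathcal C \text{ a minimal vertex cover of } G\rangle\subseteq R$. The edge ideal is $I(G)=\langle ab : \{a,b\}\text{ an edge of }G\rangle$, and $G$ is called Cohen-Macaulay if $R/I(G)$ is Cohen-Macaulay. A graph is a whiskered graph if it is obtained from some finite simple graph $H$ by attaching to each vertex of $H$ exactly one new vertex of degree one (distinct new vertices for distinct vertices of $H$). For a monomial ideal $I$ in a polynomial ring in $n$ variables with $\mathbb{N}^n$-graded minimal free resolution $0\to F_r\to\cdots\to F_0\to I\to 0$, $F_k=\bigoplus_j R(-\mathbf a_{kj})$, the vectors $\mathbf a_{kj}$ are the $k$-th multigraded shifts of $I$, and the $k$-th homological shift ideal $\mathrm{HS}_k(I)$ is the monomial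 ideal generated by the monomials $\mathbf{x}^{\mathbf a_{kj}}$ over all $k$-th multigraded shifts of $I$ (so $\mathrm{HS}_0(I)=I$, and $\mathrm{HS}_k(I)=0$ if $k>\mathrm{pd}(I)$). An ideal generated in a single degree $d$ has a linear resolution if its Castelnuovo-Mumford regularity equals $d$. A monomial ideal $I$ with minimal monomial generating set $\mathcal G(I)$ has linear quotients if there is a total order $m_1>m_2>\dots>m_r$ on $\mathcal G(I)$ such that each colon ideal $\langle m_1,\dots,m_j\rangle : m_{j+1}$, $1\le j\le r-1$, is generated by variables. *)

theory Defs
  imports
    "HOL-Algebra.QuotRing"
    "HOL-Algebra.Ring_Divisibility"
    "HOL-Library.Poly_Mapping"
    "HOL-Library.Extended_Nat"
    "HOL-Library.Extended_Real"
    "Jordan_Normal_Form.Matrix_Kernel"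
begin

section \<open>Finite simple graphs\<close>

type_synonym 'v graph = "'v set \<times> 'v set set"

abbreviation vset :: "'v graph \<Rightarrow> 'v set" where "vset G \<equiv> fst G"
abbreviation eset :: "'v graph \<Rightarrow> 'v set set" where "eset G \<equiv> snd G"

definition simple_graph :: "'v graph \<Rightarrow> bool" where
  "simple_graph G \<longleftrightarrow> finite (vset G) \<and> (\<forall>e \<in> eset G. e \<subseteq> vset G \<and> card e = 2)"

definition bipartite_graph :: "'v graph \<Rightarrow> bool" where
  "bipartite_graph G \<longleftrightarrow> (\<exists>A B. A \<union> B = vset G \<and> A \<inter> B = {} \<and>
     (\<forall>e \<in> eset G. \<exists>a \<in> A. \<exists>b \<in> B. e = {a, b}))"

text \<open>The base graph \<open>H\<close> is an induced subgraph of the whiskered graph, so no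
  isomorphism has to be mentioned; \<open>w\<close> sends a vertex of \<open>H\<close> to its new neighbour.\<close>

definition whiskered_graph :: "'v graph \<Rightarrow> bool" where
  "whiskered_graph G \<longleftrightarrow> (\<exists>H w. simple_graph H \<and> inj_on w (vset H) \<and> w ` vset H \<inter> vset H = {} \<and>
     vset G = vset H \<union> w ` vset H \<and>
     eset G = eset H \<union> (\<lambda>v. {v, w v}) ` vset H)"

definition vertex_cover :: "'v graph \<Rightarrow> 'v set \<Rightarrow> bool" where
  "vertex_cover G C \<longleftrightarrow> C \<subseteq> vset G \<and> (\<forall>e \<in> eset G. e \<inter> C \<noteq> {})"

definition minimal_vertex_cover :: "'v graph \<Rightarrow> 'v set \<Rightarrow> bool" where
  "minimal_vertex_cover G C \<longleftrightarrow> vertex_cover G C \<and> (\<forall>D. D \<subset> C \<longrightarrow> \<not> vertex_cover G D)"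


section \<open>Polynomial rings and ideals of graphs\<close>

type_synonym ('v, 'k) mpoly = "('v \<Rightarrow>\<^sub>0 nat) \<Rightarrow>\<^sub>0 'k"

text \<open>The type \<open>('v, 'k) mpoly\<close> has a variable for every element of \<open>'v\<close>; the polynomial ring
  in the finite set of variables \<open>V\<close> is the following subring.\<close>

definition poly_ring :: "'v set \<Rightarrow> ('v, 'k::field) mpoly ring" where
  "poly_ring V = \<lparr>carrier = {p. \<forall>m \<in> Poly_Mapping.keys p. Poly_Mapping.keys m \<subseteq> V},
     mult = (*), one = 1, zero = 0, add = (+)\<rparr>"

definition xpow :: "('v \<Rightarrow>\<^sub>0 nat) \<Rightarrow> ('v, 'k::field) mpoly" where
  "xpow a = Poly_Mapping.single a 1"

definition pvar :: "'v \<Rightarrow> ('v, 'k::field) mpoly" where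
  "pvar v = xpow (Poly_Mapping.single v 1)"

definition monomials :: "'v set \<Rightarrow> ('v, 'k::field) mpoly set" where
  "monomials V = xpow ` {a. Poly_Mapping.keys a \<subseteq> V}"

definition total_deg :: "('v \<Rightarrow>\<^sub>0 nat) \<Rightarrow> nat" where
  "total_deg a = (\<Sum>v \<in> Poly_Mapping.keys a. Poly_Mapping.lookup a v)"

definition edge_ideal :: "'v graph \<Rightarrow> ('v, 'k::field) mpoly set" where
  "edge_ideal G = genideal (poly_ring (vset G)) {pvar a * pvar b | a b. {a, b} \<in> eset G}"

definition vertex_cover_ideal :: "'v graph \<Rightarrow> ('v, 'k::field) mpoly set" where
  "vertex_cover_ideal G =
     genideal (poly_ring (vset G)) {\<Prod>v \<in> C. pvar v | C. minimal_vertex_cover G C}"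


section \<open>Cohen-Macaulay rings\<close>

text \<open>A Noetherian commutative ring is Cohen-Macaulay if the grade of every maximal ideal
  (the maximal length of a regular sequence contained in it) equals its height; this is the
  definition in the books of Kaplansky and Eisenbud.\<close>

definition height :: "('a, 'b) ring_scheme \<Rightarrow> 'a set \<Rightarrow> enat" where
  "height R P = (SUP n \<in> {n. \<exists>p. (\<forall>i \<le> n. primeideal (p i) R) \<and>
     (\<forall>i < n. p i \<subset> p (Suc i)) \<and> p n = P}. enat n)"

text \<open>Multiplication by \<open>xs ! i\<close> is injective on \<open>R/(xs ! 0, \<dots>, xs ! (i - 1))\<close>,
  and \<open>R/(xs) \<noteq> 0\<close>.\<close>

definition regular_sequence :: "('a, 'b) ring_scheme \<Rightarrow> 'a list \<Rightarrow> bool" where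
  "regular_sequence R xs \<longleftrightarrow> set xs \<subseteq> carrier R \<and>
     (\<forall>i < length xs. \<forall>r \<in> carrier R.
        xs ! i \<otimes>\<^bsub>R\<^esub> r \<in> genideal R (set (take i xs)) \<longrightarrow> r \<in> genideal R (set (take i xs))) \<and>
     genideal R (set xs) \<noteq> carrier R"

definition grade :: "('a, 'b) ring_scheme \<Rightarrow> 'a set \<Rightarrow> enat" where
  "grade R I = (SUP xs \<in> {xs. regular_sequence R xs \<and> set xs \<subseteq> I}. enat (length xs))"

definition Cohen_Macaulay_ring :: "('a, 'b) ring_scheme \<Rightarrow> bool" where
  "Cohen_Macaulay_ring R \<longleftrightarrow> cring R \<and> noetherian_ring R \<and>
     (\<forall>M. maximalideal M R \<longrightarrow> grade R M = height R M)"

definition Cohen_Macaulay_graph :: "'k::field itself \<Rightarrow> 'v graph \<Rightarrow> bool" where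
  "Cohen_Macaulay_graph _ G \<longleftrightarrow>
     Cohen_Macaulay_ring (poly_ring (vset G) Quot (edge_ideal G :: ('v, 'k) mpoly set))"


section \<open>Graded minimal free resolutions\<close>

text \<open>The vectors of the free module \<open>R\<^sup>n\<close>, where \<open>R = poly_ring V\<close>.\<close>

definition free_vecs :: "'v set \<Rightarrow> nat \<Rightarrow> ('v, 'k::field) mpoly vec set" where
  "free_vecs V n = {u \<in> carrier_vec n. set\<^sub>v u \<subseteq> carrier (poly_ring V)}"

text \<open>Resolutions are taken with respect to a grading \<open>gr\<close> of the monomials: \<open>gr = id\<close> gives the
  \<open>\<nat>\<^sup>n\<close>-grading and \<open>gr = total_deg\<close> the standard grading. The list \<open>F k\<close> contains the
  shifts of the \<open>k\<close>-th free module (its length is the rank) and \<open>d k\<close> is the matrix of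
  \<open>F\<^sub>k \<rightarrow> F\<^sub>k\<^sub>-\<^sub>1\<close>. The augmentation \<open>F\<^sub>0 \<rightarrow> I\<close> is the \<open>1\<close>-row matrix \<open>d 0\<close> into \<open>R\<close>, which
  is generated in degree \<open>0\<close>; accordingly \<open>res_target F k\<close> lists the shifts of the codomain
  of \<open>d k\<close>.\<close>

definition res_target :: "(nat \<Rightarrow> 'g::comm_monoid_add list) \<Rightarrow> nat \<Rightarrow> 'g list" where
  "res_target F k = (case k of 0 \<Rightarrow> [0] | Suc l \<Rightarrow> F l)"

text \<open>The clauses: finite length; size and coefficients of the matrices; homogeneity of degree 0
  of all maps; minimality, i.e. \<open>d\<^sub>k(F\<^sub>k) \<subseteq> \<mm> F\<^sub>k\<^sub>-\<^sub>1\<close> for \<open>k \<ge> 1\<close>; exactness at \<open>I\<close> and at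
  every \<open>F\<^sub>k\<close>.\<close>

definition minimal_free_resolution ::
  "(('v \<Rightarrow>\<^sub>0 nat) \<Rightarrow> 'g::comm_monoid_add) \<Rightarrow> 'v set \<Rightarrow> ('v, 'k::field) mpoly set \<Rightarrow>
   (nat \<Rightarrow> 'g list) \<Rightarrow> (nat \<Rightarrow> ('v, 'k) mpoly mat) \<Rightarrow> bool" where
  "minimal_free_resolution gr V I F d \<longleftrightarrow>
     (\<exists>r. \<forall>k > r. F k = []) \<and>
     (\<forall>k. d k \<in> carrier_mat (length (res_target F k)) (length (F k)) \<and>
          elements_mat (d k) \<subseteq> carrier (poly_ring V)) \<and>
     (\<forall>k. \<forall>i < length (res_target F k). \<forall>j < length (F k).
        \<forall>m \<in> Poly_Mapping.keys (d k $$ (i, j)). gr m + res_target F k ! i = F k ! j) \<and>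
     (\<forall>k. \<forall>p \<in> elements_mat (d (Suc k)). Poly_Mapping.lookup p 0 = 0) \<and>
     {(d 0 *\<^sub>v u) $ 0 | u. u \<in> free_vecs V (length (F 0))} = I \<and>
     (\<forall>k. {d (Suc k) *\<^sub>v u | u. u \<in> free_vecs V (length (F (Suc k)))} =
          mat_kernel (d k) \<inter> free_vecs V (length (F k)))"

text \<open>A minimal graded free resolution of a homogeneous ideal exists and is unique up to
  isomorphism, so the set below is the set of \<open>k\<close>-th shifts of any one of them.\<close>

definition shifts ::
  "(('v \<Rightarrow>\<^sub>0 nat) \<Rightarrow> 'g::comm_monoid_add) \<Rightarrow> 'v set \<Rightarrow> ('v, 'k::field) mpoly set \<Rightarrow>
   nat \<Rightarrow> 'g set" where
  "shifts gr V I k = {a. \<exists>F d. minimal_free_resolution gr V I F d \<and> a \<in> set (F k)}"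

definition HS :: "'v set \<Rightarrow> nat \<Rightarrow> ('v, 'k::field) mpoly set \<Rightarrow> ('v, 'k) mpoly set" where
  "HS V k I = genideal (poly_ring V) (xpow ` shifts id V I k)"

text \<open>The regularity of the zero ideal is \<open>-\<infinity>\<close>.\<close>

definition regularity :: "'v set \<Rightarrow> ('v, 'k::field) mpoly set \<Rightarrow> ereal" where
  "regularity V I = (SUP (k, a) \<in> {(k, a). a \<in> shifts total_deg V I k}. ereal (real a - real k))"

definition generated_in_degree :: "'v set \<Rightarrow> nat \<Rightarrow> ('v, 'k::field) mpoly set \<Rightarrow> bool" where
  "generated_in_degree V d I \<longleftrightarrow> (\<exists>B \<subseteq> carrier (poly_ring V).
     (\<forall>p \<in> B. \<forall>m \<in> Poly_Mapping.keys p. total_deg m = d) \<and> I = genideal (poly_ring V) B)"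

definition has_linear_resolution :: "'v set \<Rightarrow> ('v, 'k::field) mpoly set \<Rightarrow> bool" where
  "has_linear_resolution V I \<longleftrightarrow>
     (\<exists>d. generated_in_degree V d I \<and> regularity V I = ereal (real d))"


section \<open>Linear quotients\<close>

definition minimal_monomial_generators ::
  "'v set \<Rightarrow> ('v, 'k::field) mpoly set \<Rightarrow> ('v, 'k) mpoly set \<Rightarrow> bool" where
  "minimal_monomial_generators V I B \<longleftrightarrow> B \<subseteq> monomials V \<and> genideal (poly_ring V) B = I \<and>
     (\<forall>B'. B' \<subset> B \<longrightarrow> genideal (poly_ring V) B' \<noteq> I)"

definition colon_ideal :: "('a, 'b) ring_scheme \<Rightarrow> 'a set \<Rightarrow> 'a \<Rightarrow> 'a set" where
  "colon_ideal R I x = {r \<in> carrier R. r \<otimes>\<^bsub>R\<^esub> x \<in> I}"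

definition has_linear_quotients :: "'v set \<Rightarrow> ('v, 'k::field) mpoly set \<Rightarrow> bool" where
  "has_linear_quotients V I \<longleftrightarrow>
     (\<exists>ms. distinct ms \<and> minimal_monomial_generators V I (set ms) \<and>
       (\<forall>j. 1 \<le> j \<and> j < length ms \<longrightarrow>
         (\<exists>W \<subseteq> V. colon_ideal (poly_ring V) (genideal (poly_ring V) (set (take j ms))) (ms ! j) =
            genideal (poly_ring V) (pvar ` W))))"


section \<open>The whiskered even cycles\<close>

datatype xy_vertex = xv nat | yv nat

definition whiskered_cycle :: "nat \<Rightarrow> xy_vertex graph" where
  "whiskered_cycle k =
     (xv ` {1..2*k} \<union> yv ` {1..2*k},
      {{xv i, yv i} | i. i \<in> {1..2*k}} \<union>
      {{xv i, xv (if i = 2*k then 1 else i + 1)} | i. i \<in> {1..2*k}})"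

end

theory Submission
  imports Defs
begin

text \<open>The minimal vertex covers of a whiskered graph correspond to the independent sets \<open>F\<close> of its base
  graph, and the cover ideal is resolved by the cubical complex with the cells \<open>(F, S)\<close>, \<open>S \<subseteq> F\<close>.
  The shifts of a minimal resolution are unique, so \<open>HS\<^sub>k\<close> is generated by the monomials of the cells
  with \<open>k\<close>-element \<open>S\<close>. An independent set of the \<open>2k\<close>-cycle has at most \<open>k\<close> elements, with equality
  only for the sets of odd and of even vertices. Hence \<open>HS\<^sub>k\<close> is generated by \<open>x\<^sub>1 \<cdots> x\<^sub>2\<^sub>k\<close> times the
  product of the odd, resp. even, \<open>y\<^sub>i\<close>, and the syzygy and the colon ideals of these two generators
  have degree \<open>k \<ge> 2\<close> instead of \<open>1\<close>.

  A whiskered graph on \<open>n\<close> base vertices is Cohen-Macaulay for the following reason. A prime containing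
  the edge ideal contains \<open>x\<^sub>u\<close> or \<open>y\<^sub>u\<close> for every \<open>u\<close>, so that \<open>n + 1\<close> polynomials are algebraically
  dependent modulo it and chains of primes have length at most \<open>n\<close>. Conversely, by Zariski's lemma a
  maximal ideal contains nonzero polynomials \<open>f\<^sub>u\<close> in \<open>x\<^sub>u\<close> alone and \<open>h\<^sub>u\<close> in \<open>y\<^sub>u\<close> alone, and the sums
  \<open>f\<^sub>u + h\<^sub>u\<close> form a regular sequence of length \<open>n\<close>, which in turn yields a chain of \<open>n + 1\<close> primes.\<close>

section \<open>Polynomials in the variables of a set\<close>

text \<open>Every maximal ideal has to be treated, not only the graded one, and the field need not
  be algebraically closed. A maximal ideal can therefore not be described by the coordinates of a
  point; the nonzero univariate polynomials in it take their place. Grade and height are never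
  computed separately: regular sequences bound the grade from below, chains of primes bound the
  height from above by the same number, and the general inequality between grade and height does the
  rest.

  \<open>HS\<close> collects the shifts of all minimal resolutions at once, so exhibiting the
  cubical resolution alone says nothing about the others; this is why a comparison theorem for
  resolutions is needed. For the homological shift ideal itself no resolution is constructed: a
  finite regularity already provides one, and any one leads to a contradiction.\<close>

abbreviation coef :: "('a \<Rightarrow>\<^sub>0 'b::zero) \<Rightarrow> 'a \<Rightarrow> 'b" where "coef \<equiv> Poly_Mapping.lookup"
abbreviation supp :: "('a \<Rightarrow>\<^sub>0 'b::zero) \<Rightarrow> 'a set" where "supp \<equiv> Poly_Mapping.keys"
abbreviation monom :: "'a \<Rightarrow> 'b::zero \<Rightarrow> 'a \<Rightarrow>\<^sub>0 'b" where "monom \<equiv> Poly_Mapping.single"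
abbreviation polys :: "'v set \<Rightarrow> ('v, 'k::field) mpoly set" where "polys V \<equiv> carrier (poly_ring V)"

lemma polys_iff: "p \<in> polys V \<longleftrightarrow> (\<forall>m \<in> supp p. supp m \<subseteq> V)"
  by (simp add: poly_ring_def)

lemma poly_ring_simps [simp]:
  "mult (poly_ring V) = (*)" "one (poly_ring V) = 1" "zero (poly_ring V) = 0" "add (poly_ring V) = (+)"
  by (simp_all add: poly_ring_def)

lemma polys_0 [simp]: "0 \<in> polys V" and polys_1 [simp]: "1 \<in> polys V"
  by (auto simp: polys_iff)

lemma polys_add [intro, simp]: "p \<in> polys V \<Longrightarrow> q \<in> polys V \<Longrightarrow> p + q \<in> polys V"
  unfolding polys_iff using Poly_Mapping.keys_add[of p q] by blast

lemma supp_uminus [simp]: "supp (- p :: 'a \<Rightarrow>\<^sub>0 'b::ab_group_add) = supp p"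
  by (auto simp: in_keys_iff)

lemma polys_uminus [intro, simp]: "p \<in> polys V \<Longrightarrow> - p \<in> polys V"
  unfolding polys_iff by simp

lemma polys_diff [intro, simp]: "p \<in> polys V \<Longrightarrow> q \<in> polys V \<Longrightarrow> p - q \<in> polys V"
  using polys_add[of p V "- q"] by simp

lemma supp_add_nat: "supp (a + b :: 'v \<Rightarrow>\<^sub>0 nat) = supp a \<union> supp b"
  by (auto simp: in_keys_iff lookup_add)

lemma polys_mult [intro, simp]: "p \<in> polys V \<Longrightarrow> q \<in> polys V \<Longrightarrow> p * q \<in> polys V"
  unfolding polys_iff using Poly_Mapping.keys_mult[of p q] by (fastforce simp: supp_add_nat)

lemma polys_monom [intro, simp]: "supp a \<subseteq> V \<Longrightarrow> monom a c \<in> polys V"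
  unfolding polys_iff by simp

lemma polys_xpow [simp]: "xpow a \<in> polys V \<longleftrightarrow> supp a \<subseteq> V"
  unfolding polys_iff xpow_def by simp

lemma polys_pvar [simp]: "pvar v \<in> polys V \<longleftrightarrow> v \<in> V"
  by (simp add: pvar_def)

lemma polys_sum [intro]: "(\<And>i. i \<in> A \<Longrightarrow> f i \<in> polys V) \<Longrightarrow> sum f A \<in> polys V"
  by (induction A rule: infinite_finite_induct) auto

lemma polys_prod [intro]: "(\<And>i. i \<in> A \<Longrightarrow> f i \<in> polys V) \<Longrightarrow> prod f A \<in> polys V"
  by (induction A rule: infinite_finite_induct) auto

lemma polys_power [intro, simp]: "p \<in> polys V \<Longrightarrow> p ^ n \<in> polys V"
  by (induction n) auto

lemma polys_mono: "p \<in> polys V \<Longrightarrow> V \<subseteq> W \<Longrightarrow> p \<in> polys W"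
  unfolding polys_iff by blast

lemma cring_poly_ring: "cring (poly_ring V)"
proof (rule cringI)
  show "abelian_group (poly_ring V)"
  proof (rule abelian_groupI)
    fix x assume "x \<in> polys V"
    then show "\<exists>y \<in> polys V. y \<oplus>\<^bsub>poly_ring V\<^esub> x = \<zero>\<^bsub>poly_ring V\<^esub>"
      by (intro bexI[of _ "- x"]) auto
  qed (auto simp: algebra_simps)
  show "comm_monoid (poly_ring V)"
    by (rule comm_monoidI) (auto simp: algebra_simps)
qed (auto simp: algebra_simps)

interpretation poly_ring: cring "poly_ring V" for V by (rule cring_poly_ring)

lemma a_inv_poly_ring [simp]: "p \<in> polys V \<Longrightarrow> a_inv (poly_ring V) p = - p"
  by (rule poly_ring.minus_equality) auto

lemma ideal_poly_ringI:
  fixes I :: "('v, 'k::field) mpoly set" and V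
  assumes "I \<subseteq> polys V" "0 \<in> I" "\<And>p q. p \<in> I \<Longrightarrow> q \<in> I \<Longrightarrow> p + q \<in> I"
    "\<And>p q. p \<in> polys V \<Longrightarrow> q \<in> I \<Longrightarrow> p * q \<in> I"
  shows "ideal I (poly_ring V)"
proof (rule idealI)
  show "ring (poly_ring V :: ('v, 'k) mpoly ring)" by (rule poly_ring.ring_axioms)
  show "subgroup I (add_monoid (poly_ring V))"
  proof (rule poly_ring.add.subgroupI)
    fix a assume "a \<in> I"
    then have "(- 1) * a \<in> I" using assms(4)[of "-1" a] by simp
    moreover have "a_inv (poly_ring V) a = - a"
      using \<open>a \<in> I\<close> assms(1) by auto
    ultimately show "a_inv (poly_ring V) a \<in> I" by simp
  qed (use assms in auto)
next
  fix a x :: "('v, 'k) mpoly" assume "a \<in> I" "x \<in> polys V"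
  then have "x * a \<in> I" by (intro assms)
  then show "x \<otimes>\<^bsub>poly_ring V\<^esub> a \<in> I" "a \<otimes>\<^bsub>poly_ring V\<^esub> x \<in> I"
    by (simp_all add: mult.commute)
qed

lemma ideal_polyD:
  assumes "ideal I (poly_ring V)"
  shows "I \<subseteq> polys V" "0 \<in> I" "p \<in> I \<Longrightarrow> q \<in> I \<Longrightarrow> p + q \<in> I" "p \<in> I \<Longrightarrow> - p \<in> I"
    "p \<in> I \<Longrightarrow> q \<in> I \<Longrightarrow> p - q \<in> I"
    "p \<in> polys V \<Longrightarrow> q \<in> I \<Longrightarrow> p * q \<in> I" "p \<in> polys V \<Longrightarrow> q \<in> I \<Longrightarrow> q * p \<in> I"
proof -
  interpret ideal I "poly_ring V" by fact
  show I: "I \<subseteq> polys V" by (rule a_subset)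
  show "0 \<in> I" using zero_closed by simp
  show add: "p \<in> I \<Longrightarrow> q \<in> I \<Longrightarrow> p + q \<in> I" for p q using a_closed by simp
  show um: "p \<in> I \<Longrightarrow> - p \<in> I" for p using a_inv_closed[of p] I by auto
  show "p \<in> I \<Longrightarrow> q \<in> I \<Longrightarrow> p - q \<in> I" using add[of p "- q"] um by simp
  show "p \<in> polys V \<Longrightarrow> q \<in> I \<Longrightarrow> p * q \<in> I" using I_l_closed by simp
  show "p \<in> polys V \<Longrightarrow> q \<in> I \<Longrightarrow> q * p \<in> I" using I_r_closed by simp
qed

lemma ideal_poly_sum: "ideal I (poly_ring V) \<Longrightarrow> (\<And>i. i \<in> A \<Longrightarrow> f i \<in> I) \<Longrightarrow> sum f A \<in> I"
  by (induction A rule: infinite_finite_induct) (auto intro: ideal_polyD)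

abbreviation polyideal :: "'v set \<Rightarrow> ('v, 'k::field) mpoly set \<Rightarrow> ('v, 'k) mpoly set" where
  "polyideal V B \<equiv> genideal (poly_ring V) B"

lemma polyideal_ideal: "B \<subseteq> polys V \<Longrightarrow> ideal (polyideal V B) (poly_ring V)"
  by (rule poly_ring.genideal_ideal)

lemma polyideal_mem: "B \<subseteq> polys V \<Longrightarrow> b \<in> B \<Longrightarrow> b \<in> polyideal V B"
  using poly_ring.genideal_self by blast

lemma polyideal_least: "ideal I (poly_ring V) \<Longrightarrow> B \<subseteq> I \<Longrightarrow> polyideal V B \<subseteq> I"
  by (rule poly_ring.genideal_minimal)

text \<open>\<open>genideal\<close> is an intersection of ideals, so membership gives no linear
  combination to induct on. Instead, the elements all of whose multiples satisfy \<open>Q\<close>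
  form an ideal containing \<open>B\<close>; \<open>Q\<close> allows an arbitrary further element of
  the ideal to be added, which makes it closed under sums.\<close>

lemma polyideal_induct [consumes 2, case_names zero step]:
  assumes "p \<in> polyideal V B" "B \<subseteq> polys V" "P 0"
    and "\<And>a b q. a \<in> polys V \<Longrightarrow> b \<in> B \<Longrightarrow> q \<in> polyideal V B \<Longrightarrow> P q \<Longrightarrow> P (a * b + q)"
  shows "P p"
proof -
  note id = ideal_polyD[OF polyideal_ideal[OF assms(2)]]
  let ?I = "polyideal V B"
  define Q where "Q p \<longleftrightarrow> p \<in> ?I \<and> (\<forall>q \<in> ?I. P q \<longrightarrow> P (p + q))" for p
  have "ideal {p. \<forall>a \<in> polys V. p \<in> polys V \<and> Q (a * p)} (poly_ring V)"
  proof (rule ideal_poly_ringI, goal_cases)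
    case 1 show ?case by (auto intro: ballE[of _ _ 1])
  next
    case 2 show ?case using id(2) by (simp add: Q_def)
  next
    case (3 p q)
    show ?case
    proof safe
      fix a :: "('a,'b) mpoly" assume a: "a \<in> polys V"
      show "p + q \<in> polys V" using 3 a by auto
      have "Q (a * p)" "Q (a * q)" using 3 a by auto
      then show "Q (a * (p + q))" using id(3)
        by (auto simp: Q_def algebra_simps)
    qed
  next
    case (4 c p)
    show ?case
    proof safe
      fix a :: "('a,'b) mpoly" assume a: "a \<in> polys V"
      show "c * p \<in> polys V" using 4 a by auto
      show "Q (a * (c * p))" using 4 a by (auto simp: mult.assoc[symmetric])
    qed
  qed
  moreover have "B \<subseteq> {p. \<forall>a \<in> polys V. p \<in> polys V \<and> Q (a * p)}"
  proof safe
    fix b a :: "('a,'b) mpoly" assume ab: "b \<in> B" "a \<in> polys V"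
    show "b \<in> polys V" using ab assms by auto
    have "a * b \<in> ?I" by (rule id(6)) (use ab polyideal_mem[OF assms(2)] in auto)
    then show "Q (a * b)" unfolding Q_def using ab assms(4) by auto
  qed
  ultimately have "polyideal V B \<subseteq> {p. \<forall>a \<in> polys V. p \<in> polys V \<and> Q (a * p)}"
    by (rule polyideal_least)
  then have "Q (1 * p)" using assms(1) polys_1[of V] by blast
  then show ?thesis using \<open>P 0\<close> id(2) unfolding Q_def by force
qed


section \<open>Monomials\<close>

lemma mpoly_expand: "p = (\<Sum>m \<in> supp p. monom m (coef p m))"
proof (rule poly_mapping_eqI)
  fix k
  have "coef (\<Sum>m \<in> supp p. monom m (coef p m)) k = (\<Sum>m\<in>supp p. if m = k then coef p m else 0)"
    by (simp add: lookup_sum lookup_single when_def)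
  also have "\<dots> = coef p k" by (auto simp: in_keys_iff)
  finally show "coef p k = coef (\<Sum>m \<in> supp p. monom m (coef p m)) k" by simp
qed

lemma mpoly_induct [case_names monom add]:
  fixes p :: "'a \<Rightarrow>\<^sub>0 'b::comm_monoid_add"
  assumes "\<And>m c. P (monom m c)" "\<And>p q. P p \<Longrightarrow> P q \<Longrightarrow> P (p + q)"
  shows "P p"
proof -
  have "P (\<Sum>m \<in> A. monom m (coef p m))" for A
    using assms(1)[of undefined 0] by (induction A rule: infinite_finite_induct) (auto intro: assms)
  then show ?thesis using mpoly_expand[of p] by metis
qed

definition mdvd :: "('v \<Rightarrow>\<^sub>0 nat) \<Rightarrow> ('v \<Rightarrow>\<^sub>0 nat) \<Rightarrow> bool" where
  "mdvd a b \<longleftrightarrow> (\<forall>v. coef a v \<le> coef b v)"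

lemma mdvd_add [simp]: "mdvd a (a + b)" "mdvd a (b + a)"
  by (simp_all add: mdvd_def lookup_add)

lemma mdvd_refl [simp]: "mdvd a a" by (simp add: mdvd_def)

lemma mdvd_trans: "mdvd a b \<Longrightarrow> mdvd b c \<Longrightarrow> mdvd a c"
  unfolding mdvd_def using order_trans by blast

lemma mdvd_antisym: "mdvd a b \<Longrightarrow> mdvd b a \<Longrightarrow> a = b"
  unfolding mdvd_def by (intro poly_mapping_eqI) (simp add: le_antisym)

lemma mdvd_diff: "mdvd a b \<Longrightarrow> a + (b - a) = b"
  by (rule poly_mapping_eqI) (simp add: mdvd_def lookup_add lookup_minus)

lemma mdvd_iff: "mdvd a b \<longleftrightarrow> (\<exists>c. b = a + c)"
  by (metis mdvd_diff mdvd_add(1))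

lemma mdvd_supp: "mdvd a b \<Longrightarrow> supp a \<subseteq> supp b"
  unfolding mdvd_def by (auto simp: in_keys_iff) (metis less_le_trans)

lemma coef_monom_mult:
  fixes p :: "('v \<Rightarrow>\<^sub>0 nat) \<Rightarrow>\<^sub>0 'k::comm_ring_1"
  shows "coef (monom a c * p) (a + m) = c * coef p m"
  by (induction p rule: mpoly_induct)
    (auto simp: mult_single lookup_single when_def lookup_add distrib_left)

lemma coef_monom_mult_0:
  fixes p :: "('v \<Rightarrow>\<^sub>0 nat) \<Rightarrow>\<^sub>0 'k::comm_ring_1"
  assumes "\<not> mdvd a m"
  shows "coef (monom a c * p) m = 0"
  using assms
  by (induction p rule: mpoly_induct)
    (auto simp: mult_single lookup_single when_def lookup_add distrib_left)

lemma supp_monom_mult: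
  fixes p :: "('v \<Rightarrow>\<^sub>0 nat) \<Rightarrow>\<^sub>0 'k::comm_ring_1"
  shows "m \<in> supp (monom a c * p) \<Longrightarrow> \<exists>m'. m = a + m' \<and> m' \<in> supp p"
proof -
  assume "m \<in> supp (monom a c * p)"
  then have "coef (monom a c * p) m \<noteq> 0" by (simp add: in_keys_iff)
  then obtain m' where "m = a + m'" using coef_monom_mult_0 mdvd_iff by metis
  with \<open>coef (monom a c * p) m \<noteq> 0\<close> show ?thesis by (auto simp: coef_monom_mult in_keys_iff)
qed

lemma xpow_0 [simp]: "xpow 0 = 1" by (simp add: xpow_def)

lemma xpow_add: "xpow (a + b) = xpow a * xpow b" by (simp add: xpow_def mult_single)

lemma coef_xpow: "coef (xpow a) m = (if m = a then 1 else 0)"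
  by (simp add: xpow_def lookup_single when_def)

lemma xpow_inj: "xpow a = (xpow b :: ('v,'k::field) mpoly) \<longleftrightarrow> a = b"
  unfolding xpow_def by (metis inj_single[THEN injD] coef_xpow xpow_def zero_neq_one)

lemma coef_xpow_mult: "coef (xpow a * p) (a + m) = coef p m"
  by (simp add: xpow_def coef_monom_mult)

lemma xpow_mult_cancel: "xpow a * p = xpow a * q \<longleftrightarrow> p = (q :: ('v,'k::field) mpoly)"
  by (metis coef_xpow_mult poly_mapping_eqI)

lemma supp_xpow_mult: "supp (xpow a * p) = (+) a ` supp p"
proof
  show "supp (xpow a * p) \<subseteq> (+) a ` supp p" using supp_monom_mult[of _ a 1 p] by (auto simp: xpow_def)
  show "(+) a ` supp p \<subseteq> supp (xpow a * p)" by (auto simp: in_keys_iff coef_xpow_mult)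
qed

lemma mem_ideal_monomials:
  assumes "ideal I (poly_ring V)" "p \<in> polys V" "\<And>m. m \<in> supp p \<Longrightarrow> monom m 1 \<in> I"
  shows "p \<in> I"
proof -
  have "monom m (coef p m) \<in> I" if "m \<in> supp p" for m
  proof -
    have "monom 0 (coef p m) * monom m 1 \<in> I" by (rule ideal_polyD[OF assms(1)]) (auto simp: assms that)
    then show ?thesis by (simp add: mult_single)
  qed
  then show ?thesis using mpoly_expand[of p] ideal_poly_sum[OF assms(1)] by metis
qed

lemma mem_monomial_ideal_iff:
  fixes A :: "('v \<Rightarrow>\<^sub>0 nat) set"
  assumes A: "\<And>a. a \<in> A \<Longrightarrow> supp a \<subseteq> V"
  shows "p \<in> polyideal V (xpow ` A) \<longleftrightarrow> p \<in> polys V \<and> (\<forall>m \<in> supp p. \<exists>a \<in> A. mdvd a m)"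
proof
  have AV: "xpow ` A \<subseteq> polys V" using A by auto
  assume p: "p \<in> polyideal V (xpow ` A)"
  from p AV have "\<forall>m \<in> supp p. \<exists>a \<in> A. mdvd a m"
  proof (induction rule: polyideal_induct)
    case (step c b q)
    then obtain a where a: "b = xpow a" "a \<in> A" by auto
    have "m \<in> (+) a ` supp c \<or> m \<in> supp q" if "m \<in> supp (c * b + q)" for m
      using that Poly_Mapping.keys_add[of "c * b" q] supp_xpow_mult[of a c] a(1) by (auto simp: mult.commute)
    then show ?case using a step.IH by (metis imageE mdvd_add(1))
  qed auto
  moreover have "p \<in> polys V" using p ideal_polyD(1)[OF polyideal_ideal[OF AV]] by auto
  ultimately show "p \<in> polys V \<and> (\<forall>m \<in> supp p. \<exists>a \<in> A. mdvd a m)" by simp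
next
  have AV: "xpow ` A \<subseteq> polys V" using A by auto
  assume p: "p \<in> polys V \<and> (\<forall>m \<in> supp p. \<exists>a \<in> A. mdvd a m)"
  show "p \<in> polyideal V (xpow ` A)"
  proof (rule mem_ideal_monomials[OF polyideal_ideal[OF AV]])
    fix m assume m: "m \<in> supp p"
    then obtain a where a: "a \<in> A" "mdvd a m" using p by auto
    have "monom (m - a) 1 * xpow a \<in> polyideal V (xpow ` A)"
    proof (rule ideal_polyD(6)[OF polyideal_ideal[OF AV]])
      have "supp (m - a) \<subseteq> supp m" by (auto simp: in_keys_iff lookup_minus)
      then show "monom (m - a) 1 \<in> polys V" using m p by (auto simp: polys_iff)
      show "xpow a \<in> polyideal V (xpow ` A)" using a polyideal_mem[OF AV] by auto
    qed
    then show "monom m 1 \<in> polyideal V (xpow ` A)"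
      using mdvd_diff[OF a(2)] by (simp add: xpow_def mult_single add.commute)
  qed (use p in auto)
qed


section \<open>Division by a variable\<close>

text \<open>Division with remainder by the variable \<open>v\<close>: \<open>vdiv\<close> drops the
  monomials without \<open>v\<close> and lowers the exponent of \<open>v\<close> in the others. The
  remainder \<open>vzero\<close> is the substitution of 0 for \<open>v\<close>, hence multiplicative
  (\<open>vzero_mult\<close>).\<close>

definition vdiv :: "'v \<Rightarrow> ('v, 'k::field) mpoly \<Rightarrow> ('v, 'k) mpoly" where
  "vdiv v p = Poly_Mapping.map_key (\<lambda>m. Poly_Mapping.single v 1 + m) p"

definition vzero :: "'v \<Rightarrow> ('v, 'k::field) mpoly \<Rightarrow> ('v, 'k) mpoly" where
  "vzero v p = p - pvar v * vdiv v p"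

definition free_of :: "'v \<Rightarrow> ('v, 'k::field) mpoly \<Rightarrow> bool" where
  "free_of v p \<longleftrightarrow> (\<forall>m \<in> supp p. coef m v = 0)"

lemma free_of_iff: "free_of v p \<longleftrightarrow> p \<in> polys (- {v})"
  by (auto simp: free_of_def polys_iff in_keys_iff subset_iff)

lemma free_of_polys: "p \<in> polys V \<Longrightarrow> v \<notin> V \<Longrightarrow> free_of v p"
  unfolding free_of_iff by (erule polys_mono) auto

lemma coef_vdiv: "coef (vdiv v p) m = coef p (Poly_Mapping.single v 1 + m)"
  unfolding vdiv_def by (subst map_key.rep_eq) (auto intro: injI)

lemma vdiv_add [simp]: "vdiv v (p + q) = vdiv v p + vdiv v q"
  by (rule poly_mapping_eqI) (simp add: coef_vdiv lookup_add)

lemma vdiv_uminus [simp]: "vdiv v (- p) = - vdiv v p"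
  by (rule poly_mapping_eqI) (simp add: coef_vdiv)

lemma vdiv_diff [simp]: "vdiv v (p - q) = vdiv v p - vdiv v q"
  by (rule poly_mapping_eqI) (simp add: coef_vdiv lookup_minus)

lemma vdiv_0 [simp]: "vdiv v 0 = 0"
  by (rule poly_mapping_eqI) (simp add: coef_vdiv)

lemma vdiv_decomp: "p = vzero v p + pvar v * vdiv v p"
  by (simp add: vzero_def)

lemma vdiv_pvar_mult [simp]: "vdiv v (pvar v * p) = p"
  by (rule poly_mapping_eqI) (simp add: coef_vdiv pvar_def coef_xpow_mult)

lemma vdiv_free: "free_of v p \<Longrightarrow> vdiv v p = 0"
proof (rule poly_mapping_eqI)
  fix m :: "'a \<Rightarrow>\<^sub>0 nat" assume "free_of v p"
  moreover have "coef (Poly_Mapping.single v 1 + m) v \<noteq> 0" by (simp add: lookup_add)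
  ultimately show "coef (vdiv v p) m = coef 0 m"
    unfolding free_of_def coef_vdiv lookup_zero by (metis in_keys_iff)
qed

lemma free_of_vzero [simp]: "free_of v (vzero v p)"
proof -
  have "vdiv v (vzero v p) = 0" by (simp add: vzero_def)
  then have z: "coef (vzero v p) (Poly_Mapping.single v 1 + m) = 0" for m
    by (metis coef_vdiv lookup_zero)
  show ?thesis unfolding free_of_def
  proof (intro ballI, rule ccontr)
    fix m assume m: "m \<in> supp (vzero v p)" "coef m v \<noteq> 0"
    then have "mdvd (Poly_Mapping.single v 1) m" by (auto simp: mdvd_def lookup_single when_def)
    then have "Poly_Mapping.single v 1 + (m - Poly_Mapping.single v 1) = m" by (rule mdvd_diff)
    then have "coef (vzero v p) m = 0" using z by metis
    then show False using m by (simp add: in_keys_iff)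
  qed
qed

lemma free_of_closed [simp]:
  "free_of v 0" "free_of v 1" "free_of v p \<Longrightarrow> free_of v q \<Longrightarrow> free_of v (p + q)"
  "free_of v p \<Longrightarrow> free_of v q \<Longrightarrow> free_of v (p - q)" "free_of v p \<Longrightarrow> free_of v q \<Longrightarrow> free_of v (p * q)"
  "free_of v p \<Longrightarrow> free_of v (- p)" "free_of v p \<Longrightarrow> free_of v (p ^ n)"
  unfolding free_of_iff by auto

lemma free_of_pvar [simp]: "free_of v (pvar w) \<longleftrightarrow> v \<noteq> w"
  unfolding free_of_iff by auto

lemma vdiv_unique:
  assumes "p = a + pvar v * b" "free_of v a"
  shows "vzero v p = a" "vdiv v p = b"
proof -
  show b: "vdiv v p = b" using assms by (simp add: vdiv_free)
  show "vzero v p = a" using assms b by (simp add: vzero_def)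
qed

lemma vzero_free: "free_of v p \<Longrightarrow> vzero v p = p"
  by (simp add: vzero_def vdiv_free)

lemma vzero_linear [simp]: "vzero v 0 = 0" "vzero v 1 = 1" "vzero v (p + q) = vzero v p + vzero v q"
  "vzero v (p - q) = vzero v p - vzero v q" "vzero v (- p) = - vzero v p"
  by (auto simp: vzero_free) (simp_all add: vzero_def algebra_simps)

lemma vzero_mult [simp]: "vzero v (p * q) = vzero v p * vzero v q"
proof -
  have "p * q = (vzero v p + pvar v * vdiv v p) * (vzero v q + pvar v * vdiv v q)"
    using vdiv_decomp[of p v] vdiv_decomp[of q v] by simp
  also have "\<dots> = vzero v p * vzero v q + pvar v *
      (vzero v p * vdiv v q + vdiv v p * vzero v q + pvar v * vdiv v p * vdiv v q)"
    by (simp add: algebra_simps)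
  finally show ?thesis by (rule vdiv_unique) simp
qed

lemma vzero_pvar [simp]: "vzero v (pvar v) = 0"
  using vdiv_unique(1)[of "pvar v" 0 v 1] by simp

lemma vdiv_mult_free: "free_of v a \<Longrightarrow> vdiv v (a * p) = a * vdiv v p"
proof (rule vdiv_unique)
  show "a * p = a * vzero v p + pvar v * (a * vdiv v p)"
    using vdiv_decomp[of p v] by (metis distrib_left mult.left_commute)
qed simp

lemma polys_vdiv [simp]:
  assumes "p \<in> polys V"
  shows "vdiv v p \<in> polys V"
  unfolding polys_iff
proof
  fix m assume "m \<in> supp (vdiv v p)"
  then have "Poly_Mapping.single v 1 + m \<in> supp p" by (simp add: in_keys_iff coef_vdiv)
  then have "supp (Poly_Mapping.single v 1 + m) \<subseteq> V" using assms unfolding polys_iff by blast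
  then show "supp m \<subseteq> V" by (simp add: supp_add_nat)
qed

lemma polys_vzero_Diff:
  assumes "p \<in> polys V"
  shows "vzero v p \<in> polys (V - {v})"
proof -
  have p: "p \<in> polys (insert v V)" by (rule polys_mono[OF assms]) auto
  then have "vdiv v p \<in> polys (insert v V)" by (rule polys_vdiv)
  then have "pvar v * vdiv v p \<in> polys (insert v V)" by (rule polys_mult[rotated]) simp
  with p have "vzero v p \<in> polys (insert v V)" unfolding vzero_def by (rule polys_diff)
  moreover have "vzero v p \<in> polys (- {v})" using free_of_vzero[of v p] unfolding free_of_iff .
  ultimately show ?thesis unfolding polys_iff by blast
qed

lemma polys_vzero [simp]: "p \<in> polys V \<Longrightarrow> vzero v p \<in> polys V"
  by (rule polys_mono[OF polys_vzero_Diff]) auto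

text \<open>Induction on a strict bound for the exponents of \<open>v\<close>, which every division
  by \<open>v\<close> lowers by one.\<close>

lemma vdiv_induct [case_names zero vdiv]:
  assumes "P 0" "\<And>p. P (vdiv v p) \<Longrightarrow> P p"
  shows "P p"
proof -
  obtain N where N: "\<And>m. m \<in> supp p \<Longrightarrow> coef m v < N"
    using finite_nat_set_iff_bounded[of "(\<lambda>m. coef m v) ` supp p"] by auto
  then show ?thesis
  proof (induction N arbitrary: p)
    case 0
    then have "supp p = {}" by blast
    then have "p = 0" by simp
    then show ?case using assms by simp
  next
    case (Suc N)
    show ?case
    proof (rule assms(2), rule Suc.IH)
      fix m assume "m \<in> supp (vdiv v p)"
      then show "coef m v < N" using Suc.prems[of "Poly_Mapping.single v 1 + m"]
        by (simp add: in_keys_iff coef_vdiv lookup_add)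
    qed
  qed
qed


section \<open>Regular sequences and chains of primes\<close>

text \<open>Krull's theorem: an ideal \<open>P\<close> maximal among those that avoid the
  multiplicative set \<open>T\<close> is prime. If a product a b lies in \<open>P\<close> but b does
  not, the colon ideal of a is larger than \<open>P\<close> and meets \<open>T\<close>; doing this
  for a, and then for the element of \<open>T\<close> found, puts a product of two elements of
  \<open>T\<close> into \<open>P\<close>.\<close>

lemma (in cring) ex_primeideal_disjoint:
  assumes I: "ideal I R" and T: "T \<subseteq> carrier R" "\<one> \<in> T" "\<And>a b. a \<in> T \<Longrightarrow> b \<in> T \<Longrightarrow> a \<otimes> b \<in> T"
    and disj: "I \<inter> T = {}"
  shows "\<exists>P. primeideal P R \<and> I \<subseteq> P \<and> P \<inter> T = {}"
proof -
  let ?A = "{J. ideal J R \<and> I \<subseteq> J \<and> J \<inter> T = {}}"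
  have "\<exists>P \<in> ?A. \<forall>J \<in> ?A. P \<subseteq> J \<longrightarrow> J = P"
  proof (rule subset_Zorn)
    fix C assume C: "subset.chain ?A C"
    show "\<exists>U \<in> ?A. \<forall>J \<in> C. J \<subseteq> U"
    proof (cases "C = {}")
      case True
      then show ?thesis using I disj by auto
    next
      case False
      have "subset.chain {J. ideal J R} C" using C unfolding pred_on.chain_def by auto
      then have "ideal (\<Union>C) R" using chain_Union_is_ideal[of C] False by simp
      moreover have "J \<in> ?A" if "J \<in> C" for J using C that unfolding pred_on.chain_def by blast
      then have "I \<subseteq> \<Union>C" "\<Union>C \<inter> T = {}" using False by blast+
      ultimately show ?thesis by (intro bexI[of _ "\<Union>C"]) auto
    qed
  qed
  then obtain P where P: "ideal P R" "I \<subseteq> P" "P \<inter> T = {}"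
    and max: "\<And>J. ideal J R \<Longrightarrow> P \<subseteq> J \<Longrightarrow> J \<inter> T = {} \<Longrightarrow> J = P" by force
  interpret P: ideal P R by fact
  have colon: "\<exists>t \<in> T. a \<otimes> t \<in> P"
    if "a \<in> carrier R" "b \<in> carrier R" "a \<otimes> b \<in> P" "b \<notin> P" for a b
  proof (rule ccontr)
    let ?J = "{x \<in> carrier R. a \<otimes> x \<in> P}"
    assume "\<not> ?thesis"
    then have "?J \<inter> T = {}" by auto
    moreover have "ideal ?J R" by (rule P.helper_max_prime) (use that cring_axioms in auto)
    moreover have "P \<subseteq> ?J" using P.I_l_closed P.Icarr that by auto
    ultimately have "?J = P" by (intro max)
    then show False using that by auto
  qed
  have "primeideal P R"
  proof (rule primeidealI[OF P.is_ideal cring_axioms])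
    show "carrier R \<noteq> P" using P T by auto
    fix a b assume ab: "a \<in> carrier R" "b \<in> carrier R" "a \<otimes> b \<in> P"
    show "a \<in> P \<or> b \<in> P"
    proof (rule ccontr)
      assume n: "\<not> (a \<in> P \<or> b \<in> P)"
      then obtain t where t: "t \<in> T" "a \<otimes> t \<in> P" using colon[of a b] ab by auto
      then have "t \<otimes> a \<in> P" using m_comm[of t a] T ab by auto
      then obtain t' where "t' \<in> T" "t \<otimes> t' \<in> P" using colon[of t a] ab T t n by auto
      then show False using T(3)[OF t(1)] P by auto
    qed
  qed
  then show ?thesis using P by auto
qed

text \<open>Peels off the last element: regularity of \<open>x\<close> modulo the others yields a
  prime \<open>Q\<close> strictly below \<open>P\<close> that still contains them, and the chain
  continues below \<open>Q\<close>.\<close>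

lemma (in cring) regular_sequence_chain:
  assumes "primeideal P R" "regular_sequence R xs" "set xs \<subseteq> P"
  shows "\<exists>p. (\<forall>i \<le> length xs. primeideal (p i) R) \<and>
    (\<forall>i < length xs. p i \<subset> p (Suc i)) \<and> p (length xs) = P"
  using assms
proof (induction xs arbitrary: P rule: rev_induct)
  case Nil
  then show ?case by auto
next
  case (snoc x xs)
  interpret P: primeideal P R by fact
  have xs: "set xs \<subseteq> P" "x \<in> P" and carr: "set xs \<subseteq> carrier R" "x \<in> carrier R"
    using snoc.prems P.Icarr by (auto simp: regular_sequence_def)
  have reg: "r \<in> Idl (set xs)" if "r \<in> carrier R" "x \<otimes> r \<in> Idl (set xs)" for r
    using snoc.prems(2) that unfolding regular_sequence_def by (auto dest!: spec[of _ "length xs"])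
  let ?I = "Idl (set xs)"
  have I: "ideal ?I R" using genideal_ideal carr by simp
  then interpret I: ideal ?I R .
  have IP: "?I \<subseteq> P" using genideal_minimal[OF P.is_ideal] xs by simp
  have one: "\<one> \<notin> P" using P.I_notcarr P.one_imp_carrier by auto
  \<comment> \<open>Avoiding \<open>T\<close> forces both \<open>Q \<subseteq> P\<close> (exponent
    0) and \<open>x \<notin> Q\<close> (factor 1). The ideal of \<open>xs\<close> avoids it: powers
    of \<open>x\<close> can be cancelled modulo that ideal, which would put an element outside
    \<open>P\<close> into an ideal inside \<open>P\<close>.\<close>
  define T where "T = {s \<otimes> x [^] n | s n. s \<in> carrier R - P \<and> (n::nat) \<ge> 0}"
  have reg': "s \<in> ?I" if "s \<in> carrier R" "s \<otimes> x [^] n \<in> ?I" for s and n :: nat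
    using that
  proof (induction n)
    case (Suc n)
    have "x \<otimes> (s \<otimes> x [^] n) = s \<otimes> x [^] Suc n"
      using carr Suc.prems by (simp add: m_assoc m_comm m_lcomm)
    then have "s \<otimes> x [^] n \<in> ?I" using reg[of "s \<otimes> x [^] n"] Suc.prems carr by simp
    then show ?case by (rule Suc.IH[OF Suc.prems(1)])
  qed simp
  have "\<exists>Q. primeideal Q R \<and> ?I \<subseteq> Q \<and> Q \<inter> T = {}"
  proof (rule ex_primeideal_disjoint[OF I])
    show "T \<subseteq> carrier R" using carr by (auto simp: T_def)
    show "\<one> \<in> T" unfolding T_def using one by (intro CollectI exI[of _ \<one>] exI[of _ "0::nat"]) auto
    show "?I \<inter> T = {}" using reg' IP by (auto simp: T_def)
    fix a b assume "a \<in> T" "b \<in> T"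
    then obtain s n t m where *: "a = s \<otimes> x [^] n" "b = t \<otimes> x [^] m" "s \<in> carrier R - P" "t \<in> carrier R - P"
      and "(n::nat) \<ge> 0" "(m::nat) \<ge> 0"
      by (auto simp: T_def)
    then have "s \<otimes> t \<notin> P" using P.I_prime by auto
    moreover have "a \<otimes> b = (s \<otimes> t) \<otimes> x [^] (n + m)"
      using * carr by (simp add: nat_pow_mult[symmetric] m_ac)
    ultimately show "a \<otimes> b \<in> T" unfolding T_def using * by blast
  qed
  then obtain Q where Q: "primeideal Q R" "?I \<subseteq> Q" "Q \<inter> T = {}" by auto
  interpret Q: primeideal Q R by fact
  have "Q \<subseteq> P"
  proof
    fix q assume q: "q \<in> Q"
    then have "q \<notin> T" using Q by auto
    then have "q \<notin> carrier R - P" unfolding T_def using q Q.Icarr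
      by (auto dest!: spec[of _ q] spec[of _ "0::nat"])
    then show "q \<in> P" using Q.Icarr[OF q] by auto
  qed
  moreover have "x \<in> T" unfolding T_def using one carr
    by (intro CollectI exI[of _ \<one>] exI[of _ "1::nat"]) auto
  then have "x \<notin> Q" using Q by auto
  ultimately have QP: "Q \<subset> P" using xs by auto
  have "regular_sequence R xs"
    unfolding regular_sequence_def
  proof (intro conjI allI impI ballI)
    show "set xs \<subseteq> carrier R" by fact
    show "?I \<noteq> carrier R" using Q Q.I_notcarr Q.Icarr by auto
    fix i r assume "i < length xs" "r \<in> carrier R" "xs ! i \<otimes> r \<in> Idl (set (take i xs))"
    then show "r \<in> Idl (set (take i xs))"
      using snoc.prems(2) unfolding regular_sequence_def by (auto dest!: spec[of _ i] simp: nth_append)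
  qed
  moreover have "set xs \<subseteq> Q" using Q genideal_self[OF carr(1)] by auto
  ultimately obtain p where p: "\<forall>i \<le> length xs. primeideal (p i) R"
    "\<forall>i < length xs. p i \<subset> p (Suc i)" "p (length xs) = Q"
    using snoc.IH[OF Q(1)] by blast
  let ?p = "p(Suc (length xs) := P)"
  have "(\<forall>i \<le> length (xs @ [x]). primeideal (?p i) R)" using p snoc.prems by auto
  moreover have "(\<forall>i < length (xs @ [x]). ?p i \<subset> ?p (Suc i))" using p QP by (auto simp: less_Suc_eq)
  ultimately show ?case by (intro exI[of _ ?p]) auto
qed

lemma (in cring) grade_le_height:
  assumes "primeideal P R"
  shows "grade R P \<le> height R P"
  unfolding grade_def height_def
proof (rule SUP_mono)
  fix xs assume "xs \<in> {xs. regular_sequence R xs \<and> set xs \<subseteq> P}"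
  then show "\<exists>n \<in> {n. \<exists>p. (\<forall>i\<le>n. primeideal (p i) R) \<and> (\<forall>i<n. p i \<subset> p (Suc i)) \<and> p n = P}.
      enat (length xs) \<le> enat n"
    using regular_sequence_chain[OF assms, of xs] by blast
qed


section \<open>Quotients\<close>

lemma carrier_quot: "carrier (R Quot I) = a_r_coset R I ` carrier R"
  unfolding FactRing_def by (simp add: A_RCOSETS_def') blast

lemma (in ring) rcos_eq_zero:
  assumes "ideal I R" "a \<in> I"
  shows "I +> a = \<zero>\<^bsub>R Quot I\<^esub>"
  using a_rcos_zero[OF assms] by (simp add: FactRing_def)

text \<open>Moves regularity from the quotient ring to \<open>R\<close>: ideals of the quotient
  become ideals of \<open>R\<close> containing \<open>I\<close>, and no calculation with cosets
  remains.\<close>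

lemma (in ring) quot_genideal_iff:
  assumes I: "ideal I R" and A: "A \<subseteq> carrier R" and r: "r \<in> carrier R"
  shows "I +> r \<in> genideal (R Quot I) (((+>) I) ` A) \<longleftrightarrow> r \<in> Idl (A \<union> I)"
proof -
  interpret I: ideal I R by fact
  interpret h: ring_hom_ring R "R Quot I" "(+>) I" by (rule I.rcos_ring_hom_ring)
  have AI: "A \<union> I \<subseteq> carrier R" using A I.Icarr by auto
  interpret J: ideal "Idl (A \<union> I)" R by (rule genideal_ideal[OF AI])
  let ?J = "genideal (R Quot I) (((+>) I) ` A)"
  have hA: "((+>) I) ` A \<subseteq> carrier (R Quot I)" using A by auto
  have Jid: "ideal ?J (R Quot I)" by (rule h.S.genideal_ideal[OF hA])
  show ?thesis
  proof
    assume "I +> r \<in> ?J"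
    moreover have "?J \<subseteq> ((+>) I) ` (Idl (A \<union> I))"
      by (rule h.S.genideal_minimal[OF ring_ideal_imp_quot_ideal[OF I J.is_ideal]])
        (use genideal_self[OF AI] in auto)
    ultimately obtain s where s: "s \<in> Idl (A \<union> I)" "I +> r = I +> s" by auto
    then have "r \<ominus> s \<in> I" using quotient_eq_iff_same_a_r_cos[OF I r, of s] J.Icarr by simp
    then have "r \<ominus> s \<in> Idl (A \<union> I)" using genideal_self[OF AI] by auto
    then have "(r \<ominus> s) \<oplus> s \<in> Idl (A \<union> I)" using s by auto
    moreover have "(r \<ominus> s) \<oplus> s = r" using r s J.Icarr
      by (simp add: a_minus_def a_assoc l_neg)
    ultimately show "r \<in> Idl (A \<union> I)" by simp
  next
    assume "r \<in> Idl (A \<union> I)"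
    moreover have "A \<union> I \<subseteq> {s \<in> carrier R. I +> s \<in> ?J}"
    proof safe
      fix a assume a: "a \<in> A"
      show "a \<in> carrier R" "I +> a \<in> ?J" using a A h.S.genideal_self[OF hA] by auto
    next
      fix a assume a: "a \<in> I"
      show "a \<in> carrier R" using a I.Icarr by auto
      have "I +> a = \<zero>\<^bsub>R Quot I\<^esub>" by (rule rcos_eq_zero[OF I a])
      then show "I +> a \<in> ?J"
        using additive_subgroup.zero_closed[OF ideal.axioms(1)[OF Jid]] by simp
    qed
    ultimately show "I +> r \<in> ?J" using genideal_minimal[OF h.ideal_vimage[OF Jid]] by blast
  qed
qed

lemma (in ring) noetherian_quot:
  assumes "noetherian_ring R" and I: "ideal I R"
  shows "noetherian_ring (R Quot I)"
proof (rule ring.noetherian_ringI)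
  interpret I: ideal I R by fact
  interpret h: ring_hom_ring R "R Quot I" "(+>) I" by (rule I.rcos_ring_hom_ring)
  show "ring (R Quot I)" by (rule h.S.ring_axioms)
  fix J assume J: "ideal J (R Quot I)"
  then interpret J: ideal J "R Quot I" .
  have "ideal {r \<in> carrier R. I +> r \<in> J} R" by (rule h.ideal_vimage[OF J])
  then obtain A where A: "A \<subseteq> carrier R" "finite A" "{r \<in> carrier R. I +> r \<in> J} = Idl A"
    using noetherian_ring.finetely_gen[OF assms(1)] by blast
  have "J = genideal (R Quot I) (((+>) I) ` A)"
  proof
    show "genideal (R Quot I) (((+>) I) ` A) \<subseteq> J"
      by (rule h.S.genideal_minimal[OF J]) (use A genideal_self[OF A(1)] in auto)
    show "J \<subseteq> genideal (R Quot I) (((+>) I) ` A)"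
    proof
      fix j assume "j \<in> J"
      moreover have "carrier (R Quot I) = (+>) I ` carrier R"
        by (rule carrier_quot)
      ultimately obtain r where r: "r \<in> carrier R" "j = I +> r" using J.Icarr[of j] by blast
      then have "r \<in> Idl A" using \<open>j \<in> J\<close> A by auto
      then have "r \<in> Idl (A \<union> I)"
        using subset_Idl_subset[of "A \<union> I" A] A I.a_subset by auto
      then show "j \<in> genideal (R Quot I) (((+>) I) ` A)"
        using quot_genideal_iff[OF I A(1) r(1)] r by simp
    qed
  qed
  then show "\<exists>A\<subseteq>carrier (R Quot I). finite A \<and> J = genideal (R Quot I) A"
    using A by (intro exI[of _ "(+>) I ` A"]) auto
qed

text \<open>The sandwich height \<le> n \<le> grade \<le> height. That the sequences generate proper
  ideals comes from their lying in a maximal ideal.\<close>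

lemma (in cring) Cohen_Macaulay_quotI:
  assumes noeth: "noetherian_ring R" and I: "ideal I R"
    and max: "\<And>M. maximalideal M R \<Longrightarrow> I \<subseteq> M \<Longrightarrow> \<exists>xs. set xs \<subseteq> M \<and> length xs = n \<and>
      (\<forall>i < n. \<forall>r \<in> carrier R.
        xs ! i \<otimes> r \<in> Idl (set (take i xs) \<union> I) \<longrightarrow> r \<in> Idl (set (take i xs) \<union> I))"
    and dim: "\<And>m p. \<forall>i \<le> m. primeideal (p i) R \<Longrightarrow> \<forall>i < m. p i \<subset> p (Suc i) \<Longrightarrow> I \<subseteq> p 0 \<Longrightarrow> m \<le> n"
  shows "Cohen_Macaulay_ring (R Quot I)"
proof -
  interpret I: ideal I R by fact
  interpret h: ring_hom_ring R "R Quot I" "(+>) I" by (rule I.rcos_ring_hom_ring)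
  have cring: "cring (R Quot I)" by (rule I.quotient_is_cring[OF cring_axioms])
  have surj: "carrier (R Quot I) = (+>) I ` carrier R"
    by (rule carrier_quot)
  define pre where "pre J = {r \<in> carrier R. I +> r \<in> J}" for J
  have Ipre: "I \<subseteq> pre J" if "ideal J (R Quot I)" for J
  proof
    fix a assume a: "a \<in> I"
    then have "I +> a = \<zero>\<^bsub>R Quot I\<^esub>" by (rule rcos_eq_zero[OF I])
    then show "a \<in> pre J" using additive_subgroup.zero_closed[OF ideal.axioms(1)[OF that]] a I.Icarr
      by (simp add: pre_def)
  qed
  have img_pre: "(+>) I ` pre J = J" if "J \<subseteq> carrier (R Quot I)" for J
    using that unfolding surj pre_def by blast
  have "grade (R Quot I) M = height (R Quot I) M" if M: "maximalideal M (R Quot I)" for M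
  proof (rule antisym)
    interpret M: maximalideal M "R Quot I" by fact
    have Mp: "primeideal M (R Quot I)" by (rule cring.maximalideal_prime[OF cring M])
    show "grade (R Quot I) M \<le> height (R Quot I) M" by (rule cring.grade_le_height[OF cring Mp])
    have "height (R Quot I) M \<le> enat n"
      unfolding height_def
    proof (rule SUP_least, clarify)
      fix m p assume p: "\<forall>i\<le>m. primeideal (p i) (R Quot I)" "\<forall>i<m. p i \<subset> p (Suc i)"
      have car: "p i \<subseteq> carrier (R Quot I)" if "i \<le> m" for i
      proof
        have "ideal (p i) (R Quot I)" using p(1) that by (simp add: primeideal.axioms(1))
        then show "x \<in> carrier (R Quot I)" if "x \<in> p i" for x using that by (rule ideal.Icarr)
      qed
      have "m \<le> n"
      proof (rule dim[of m "\<lambda>i. pre (p i)"])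
        show "\<forall>i\<le>m. primeideal (pre (p i)) R"
          unfolding pre_def using h.primeideal_vimage[OF cring_axioms] p(1) by blast
        show "I \<subseteq> pre (p 0)" by (rule Ipre, rule primeideal.axioms(1)) (use p(1) in simp)
        show "\<forall>i<m. pre (p i) \<subset> pre (p (Suc i))"
        proof (intro allI impI)
          fix i assume i: "i < m"
          then have *: "p i \<subset> p (Suc i)" "p i \<subseteq> carrier (R Quot I)" "p (Suc i) \<subseteq> carrier (R Quot I)"
            using p car by auto
          have "pre (p i) \<noteq> pre (p (Suc i))"
          proof
            assume eq: "pre (p i) = pre (p (Suc i))"
            have "p i = ((+>) I) ` pre (p i)" by (rule img_pre[symmetric]) (fact *)
            also have "\<dots> = p (Suc i)" unfolding eq by (rule img_pre) (fact *)
            finally show False using *(1) by blast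
          qed
          moreover have "pre (p i) \<subseteq> pre (p (Suc i))" using *(1) unfolding pre_def by blast
          ultimately show "pre (p i) \<subset> pre (p (Suc i))" by blast
        qed
      qed
      then show "enat m \<le> enat n" by simp
    qed
    also have "enat n \<le> grade (R Quot I) M"
    proof -
      have preM: "ideal (pre M) R" unfolding pre_def by (rule h.ideal_vimage[OF M.is_ideal])
      have "maximalideal (pre M) R"
      proof (rule maximalidealI[OF preM])
        have "(+>) I ` carrier R \<noteq> M" using M.I_notcarr surj by auto
        then show "carrier R \<noteq> pre M" using img_pre[OF M.a_subset] by metis
        fix J assume J: "ideal J R" "pre M \<subseteq> J" "J \<subseteq> carrier R"
        have "ideal ((+>) I ` J) (R Quot I)" by (rule ring_ideal_imp_quot_ideal[OF I J(1)])
        moreover have "M \<subseteq> (+>) I ` J" using J(2) img_pre[OF M.a_subset] by blast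
        moreover have "(+>) I ` J \<subseteq> carrier (R Quot I)" using J surj by auto
        ultimately have d: "(+>) I ` J = M \<or> (+>) I ` J = carrier (R Quot I)" by (rule M.I_maximal)
        have lift: "r \<in> J" if rc: "r \<in> carrier R" and rJ: "I +> r \<in> (+>) I ` J" for r
        proof -
          obtain s where s: "s \<in> J" "I +> r = I +> s" using rJ by blast
          then have sc: "s \<in> carrier R" using J by auto
          have "r \<ominus> s \<in> I" using quotient_eq_iff_same_a_r_cos[OF I rc sc] s by simp
          then have "r \<ominus> s \<in> J" using Ipre[OF M.is_ideal] J by auto
          then have "(r \<ominus> s) \<oplus> s \<in> J"
            using s additive_subgroup.a_closed[OF ideal.axioms(1)[OF J(1)]] by auto
          moreover have "(r \<ominus> s) \<oplus> s = r" using rc sc by (simp add: a_minus_def a_assoc l_neg)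
          ultimately show ?thesis by simp
        qed
        from d show "J = pre M \<or> J = carrier R"
        proof
          assume "(+>) I ` J = M"
          then have "J \<subseteq> pre M" unfolding pre_def using J(3) by blast
          then show ?thesis using J by auto
        next
          assume "(+>) I ` J = carrier (R Quot I)"
          then have eq: "(+>) I ` J = (+>) I ` carrier R" using surj by (rule trans)
          have "carrier R \<subseteq> J"
          proof
            fix r assume r: "r \<in> carrier R"
            then have "I +> r \<in> (+>) I ` J" unfolding eq by (rule imageI)
            with r show "r \<in> J" by (rule lift)
          qed
          then show ?thesis using J by auto
        qed
      qed
      then obtain xs where xs: "set xs \<subseteq> pre M" "length xs = n"
        and reg: "\<And>i r. i < n \<Longrightarrow> r \<in> carrier R \<Longrightarrow>
          xs ! i \<otimes> r \<in> Idl (set (take i xs) \<union> I) \<Longrightarrow> r \<in> Idl (set (take i xs) \<union> I)"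
        using max[of "pre M"] Ipre[OF M.is_ideal] by blast
      have xc: "set xs \<subseteq> carrier R" using xs(1) unfolding pre_def by blast
      let ?ys = "map ((+>) I) xs"
      have ysM: "set ?ys \<subseteq> M" using xs(1) unfolding pre_def set_map by blast
      have "regular_sequence (R Quot I) ?ys"
        unfolding regular_sequence_def
      proof (intro conjI allI impI ballI)
        show "set ?ys \<subseteq> carrier (R Quot I)" using xc unfolding set_map surj by blast
        have "genideal (R Quot I) (set ?ys) \<subseteq> M" by (rule h.S.genideal_minimal[OF M.is_ideal ysM])
        then show "genideal (R Quot I) (set ?ys) \<noteq> carrier (R Quot I)" using M.I_notcarr M.a_subset by blast
        fix i r assume i: "i < length ?ys" and r: "r \<in> carrier (R Quot I)"
          and *: "?ys ! i \<otimes>\<^bsub>R Quot I\<^esub> r \<in> genideal (R Quot I) (set (take i ?ys))"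
        obtain s where s: "s \<in> carrier R" "r = I +> s" using r unfolding surj by blast
        have tk: "set (take i ?ys) = (+>) I ` set (take i xs)" by (simp add: take_map)
        have tc: "set (take i xs) \<subseteq> carrier R" using xc set_take_subset[of i xs] by auto
        have xi: "xs ! i \<in> carrier R" using xc i nth_mem[of i xs] by auto
        have "?ys ! i \<otimes>\<^bsub>R Quot I\<^esub> r = I +> (xs ! i \<otimes> s)" using i s xi by simp
        then have "xs ! i \<otimes> s \<in> Idl (set (take i xs) \<union> I)"
          using quot_genideal_iff[OF I tc, of "xs ! i \<otimes> s"] * xi s tk by simp
        then have "s \<in> Idl (set (take i xs) \<union> I)" using reg[of i s] i xs s by simp
        then show "r \<in> genideal (R Quot I) (set (take i ?ys))"
          using quot_genideal_iff[OF I tc s(1)] s tk by simp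
      qed
      then have "?ys \<in> {xs. regular_sequence (R Quot I) xs \<and> set xs \<subseteq> M}" using ysM by simp
      then have "enat (length ?ys) \<le> grade (R Quot I) M" unfolding grade_def by (rule SUP_upper)
      then show ?thesis using xs by simp
    qed
    finally show "height (R Quot I) M \<le> grade (R Quot I) M" .
  qed
  then show ?thesis unfolding Cohen_Macaulay_ring_def using cring noetherian_quot[OF noeth I] by auto
qed


section \<open>Hilbert's basis theorem\<close>

lemma nat_mono_subseq:
  fixes g :: "nat \<Rightarrow> nat"
  shows "\<exists>s :: nat \<Rightarrow> nat. strict_mono s \<and> mono (g \<circ> s)"
proof -
  obtain s where s: "strict_mono s" "monoseq (\<lambda>n. g (s n))" using seq_monosub[of g] by blast
  consider "\<forall>m. \<forall>n\<ge>m. g (s m) \<le> g (s n)" | "\<forall>m. \<forall>n\<ge>m. g (s n) \<le> g (s m)"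
    using s(2) unfolding monoseq_def by blast
  then show ?thesis
  proof cases
    case 1
    then show ?thesis using s(1) by (intro exI[of _ s]) (auto intro: monoI)
  next
    case 2
    \<comment> \<open>A nonincreasing sequence of naturals is constant from the index of its least
      value on.\<close>
    obtain n0 where n0: "\<And>n. g (s n0) \<le> g (s n)"
      using ex_has_least_nat[of "\<lambda>_. True" 0 "\<lambda>n. g (s n)"] by blast
    have c: "g (s (i + n0)) = g (s n0)" for i
      by (rule antisym) (use 2 n0 in auto)
    have "strict_mono (\<lambda>i. s (i + n0))" using s(1) by (simp add: strict_mono_def)
    then show ?thesis using c by (intro exI[of _ "\<lambda>i. s (i + n0)"]) (simp add: mono_def)
  qed
qed

text \<open>A subsequence that is nondecreasing in every variable, not just one pair of indices, is
  the form that survives the induction over the variables.\<close>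

lemma Dickson_subseq:
  fixes f :: "nat \<Rightarrow> 'v \<Rightarrow>\<^sub>0 nat"
  assumes "finite V"
  shows "\<exists>r :: nat \<Rightarrow> nat. strict_mono r \<and> (\<forall>v \<in> V. mono (\<lambda>i. coef (f (r i)) v))"
  using assms
proof induction
  case empty
  then show ?case by (intro exI[of _ id]) (simp add: strict_mono_def)
next
  case (insert w V)
  then obtain r :: "nat \<Rightarrow> nat" where r: "strict_mono r" "\<And>v. v \<in> V \<Longrightarrow> mono (\<lambda>i. coef (f (r i)) v)" by auto
  obtain s :: "nat \<Rightarrow> nat" where s: "strict_mono s" "mono ((\<lambda>i. coef (f (r i)) w) \<circ> s)"
    using nat_mono_subseq by blast
  have "strict_mono (r \<circ> s)" using r(1) s(1) by (rule strict_mono_o)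
  moreover have "mono (\<lambda>i. coef (f ((r \<circ> s) i)) v)" if "v \<in> insert w V" for v
  proof (cases "v = w")
    case True
    then show ?thesis using s(2) by (simp add: o_def)
  next
    case False
    then have "mono (\<lambda>i. coef (f (r i)) v)" using that r by auto
    then show ?thesis using strict_mono_mono[OF s(1)] by (simp add: mono_def)
  qed
  ultimately show ?case by blast
qed

lemma Dickson:
  fixes f :: "nat \<Rightarrow> 'v \<Rightarrow>\<^sub>0 nat"
  assumes "finite V" "\<And>i. supp (f i) \<subseteq> V"
  shows "\<exists>i j. i < j \<and> mdvd (f i) (f j)"
proof -
  obtain r :: "nat \<Rightarrow> nat" where r: "strict_mono r" "\<And>v. v \<in> V \<Longrightarrow> mono (\<lambda>i. coef (f (r i)) v)"
    using Dickson_subseq[OF assms(1), of f] by blast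
  have "coef (f (r 0)) v \<le> coef (f (r 1)) v" for v
  proof (cases "v \<in> V")
    case True
    then show ?thesis using monoD[OF r(2), of v 0 1] by simp
  next
    case False
    then have "coef (f (r 0)) v = 0" using assms(2)[of "r 0"] by (auto simp: in_keys_iff)
    then show ?thesis by simp
  qed
  then have "mdvd (f (r 0)) (f (r 1))" by (simp add: mdvd_def)
  moreover have "r 0 < r 1" using r(1) by (simp add: strict_mono_def)
  ultimately show ?thesis by blast
qed

text \<open>Without a finite basis one could choose forever an exponent divisible by none of its
  predecessors, against \<open>Dickson\<close>.\<close>

lemma Dickson_basis:
  fixes E :: "('v \<Rightarrow>\<^sub>0 nat) set"
  assumes "finite V" "\<And>e. e \<in> E \<Longrightarrow> supp e \<subseteq> V"
  shows "\<exists>E0 \<subseteq> E. finite E0 \<and> (\<forall>e \<in> E. \<exists>e0 \<in> E0. mdvd e0 e)"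
proof (rule ccontr)
  assume neg: "\<not> ?thesis"
  let ?P = "\<lambda>(f :: nat \<Rightarrow> 'v \<Rightarrow>\<^sub>0 nat) n e. e \<in> E \<and> (\<forall>i < n. \<not> mdvd (f i) e)"
  have "\<exists>f. \<forall>n. ?P f n (f n)"
  proof (rule dependent_wellorder_choice)
    fix n and f :: "nat \<Rightarrow> 'v \<Rightarrow>\<^sub>0 nat" assume "\<And>i. i < n \<Longrightarrow> ?P f i (f i)"
    then have "f ` {..<n} \<subseteq> E" by auto
    moreover have "finite (f ` {..<n})" by simp
    ultimately have "\<not> (\<forall>e \<in> E. \<exists>e0 \<in> f ` {..<n}. mdvd e0 e)" using neg by blast
    then show "\<exists>e. ?P f n e" by auto
  qed auto
  then obtain f where f: "\<And>n. ?P f n (f n)" by blast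
  then have "supp (f n) \<subseteq> V" for n using assms(2) by blast
  then obtain i j where "i < j" "mdvd (f i) (f j)" using Dickson[OF assms(1), of f] by blast
  then show False using f[of j] by blast
qed

text \<open>The order on exponents is lexicographic: it is decided at the least variable where they
  differ. Addition is monotone for it, so with 0 as least element it is a monomial order.\<close>

lemma zero_le_exponent: "(0 :: 'v::linorder \<Rightarrow>\<^sub>0 nat) \<le> c"
proof (cases "c = 0")
  case False
  then have ne: "supp c \<noteq> {}" by simp
  have "(0 :: 'v \<Rightarrow>\<^sub>0 nat) < c"
    unfolding less_poly_mapping.rep_eq less_fun_def
  proof (intro exI conjI allI impI)
    let ?k = "Min (supp c)"
    show "coef 0 ?k < coef c ?k" using Min_in[OF finite_keys ne] by (simp add: in_keys_iff)
    fix k assume "k < ?k"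
    have "k \<notin> supp c"
    proof
      assume "k \<in> supp c"
      then have "?k \<le> k" by simp
      then show False using \<open>k < ?k\<close> by (meson leD)
    qed
    then show "coef 0 k = coef c k" by (simp add: in_keys_iff)
  qed
  then show ?thesis by simp
qed simp

lemma mdvd_imp_le: "mdvd a b \<Longrightarrow> a \<le> (b :: 'v::linorder \<Rightarrow>\<^sub>0 nat)"
  using add_left_mono[OF zero_le_exponent, of a "b - a"] mdvd_diff[of a b] by simp

text \<open>Over infinitely many variables the lexicographic order need not be well-founded. Over
  finitely many, Dickson's lemma finds in a descending sequence an exponent that divides, and so is
  at most, a later one.\<close>

lemma wf_exponents:
  assumes "finite V"
  shows "wf {(a, b). a < b \<and> supp a \<subseteq> V \<and> supp (b :: 'v::linorder \<Rightarrow>\<^sub>0 nat) \<subseteq> V}"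
  unfolding wf_iff_no_infinite_down_chain
proof
  assume "\<exists>f. \<forall>i. (f (Suc i), f i) \<in> {(a, b). a < b \<and> supp a \<subseteq> V \<and> supp (b :: 'v \<Rightarrow>\<^sub>0 nat) \<subseteq> V}"
  then obtain f :: "nat \<Rightarrow> 'v \<Rightarrow>\<^sub>0 nat" where f: "\<And>i. f (Suc i) < f i" "\<And>i. supp (f i) \<subseteq> V" by blast
  obtain i j where "i < j" "mdvd (f i) (f j)" using Dickson[OF assms, of f] f by blast
  moreover have "f j < f i" using \<open>i < j\<close>
    by (induction rule: strict_inc_induct) (use f(1) less_trans in blast)+
  ultimately show False using mdvd_imp_le by fastforce
qed

definition lm :: "('v::linorder, 'k::field) mpoly \<Rightarrow> ('v \<Rightarrow>\<^sub>0 nat)" where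
  "lm p = Max (supp p)"

lemma lm_in: "p \<noteq> 0 \<Longrightarrow> lm p \<in> supp p"
  unfolding lm_def by (rule Max_in) auto

lemma lm_ge: "m \<in> supp p \<Longrightarrow> m \<le> lm p"
  unfolding lm_def by simp

lemma coef_lm: "p \<noteq> 0 \<Longrightarrow> coef p (lm p) \<noteq> 0"
  using lm_in by (auto simp: in_keys_iff)

text \<open>Any other pair of exponents has a strictly smaller sum, so the leading coefficients
  cannot cancel; in particular products of nonzero polynomials are nonzero.\<close>

lemma coef_lm_mult:
  fixes p q :: "('v::linorder, 'k::field) mpoly"
  shows "coef (p * q) (lm p + lm q) = coef p (lm p) * coef q (lm q)"
proof -
  let ?m = "monom (lm p) (coef p (lm p))"
  have "coef ((p - ?m) * q) (lm p + lm q) = 0"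
  proof (rule ccontr)
    assume "\<not> ?thesis"
    then have "lm p + lm q \<in> supp ((p - ?m) * q)" by (simp add: in_keys_iff)
    then obtain a b where ab: "lm p + lm q = a + b" "a \<in> supp (p - ?m)" "b \<in> supp q"
      using Poly_Mapping.keys_mult[of "p - ?m" q] by blast
    then have "a \<noteq> lm p" "a \<in> supp p"
      by (auto simp: in_keys_iff lookup_minus lookup_single when_def split: if_splits)
    then have "a < lm p" using lm_ge[of a p] by simp
    moreover have "b \<le> lm q" using ab lm_ge by auto
    ultimately have "a + b < lm p + lm q" by (rule add_less_le_mono)
    then show False using ab by simp
  qed
  moreover have "p * q = ?m * q + (p - ?m) * q" by (simp add: algebra_simps)
  ultimately show ?thesis by (simp add: lookup_add coef_monom_mult)
qed

text \<open>Groebner basis argument: every leading exponent in \<open>J\<close> is divisible by that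
  of some element of \<open>B\<close>. Subtracting a suitable multiple of this element lowers the
  leading exponent, and the descent stops by \<open>wf_exponents\<close>.\<close>

theorem noetherian_poly_ring:
  fixes V :: "'v::linorder set"
  assumes V: "finite V"
  shows "noetherian_ring (poly_ring V :: ('v, 'k::field) mpoly ring)"
proof (rule poly_ring.noetherian_ringI)
  fix J :: "('v, 'k) mpoly set" assume J: "ideal J (poly_ring V)"
  note id = ideal_polyD[OF J]
  let ?E = "lm ` (J - {0})"
  have suppV: "supp m \<subseteq> V" if "p \<in> J" "m \<in> supp p" for p m
    using that id(1) polys_iff[of p V] by blast
  have "\<And>e. e \<in> ?E \<Longrightarrow> supp e \<subseteq> V" using suppV lm_in by blast
  then obtain E0 where E0: "E0 \<subseteq> ?E" "finite E0" "\<And>e. e \<in> ?E \<Longrightarrow> \<exists>e0 \<in> E0. mdvd e0 e"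
    using Dickson_basis[OF V, of ?E] by blast
  then obtain B where B: "B \<subseteq> J - {0}" "finite B" "E0 = lm ` B"
    using finite_subset_image[of E0 lm "J - {0}"] by blast
  have BV: "B \<subseteq> polys V" using B id(1) by blast
  note idB = ideal_polyD[OF polyideal_ideal[OF BV]]
  have "p \<in> polyideal V B" if "e = lm p" "p \<in> J" for p e
    using wf_exponents[OF V] that
  proof (induction e arbitrary: p rule: wf_induct_rule)
    case (less e)
    show ?case
    proof (cases "p = 0")
      case True
      then show ?thesis using idB(2) by simp
    next
      case False
      then obtain b where b: "b \<in> B" "mdvd (lm b) (lm p)" using E0(3)[of "lm p"] less.prems B(3) by blast
      have b0: "b \<noteq> 0" "b \<in> J" using b B by auto
      let ?d = "lm p - lm b"
      have d: "?d + lm b = lm p" using mdvd_diff[OF b(2)] by (simp add: add.commute)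
      let ?t = "monom ?d (coef p (lm p) / coef b (lm b)) :: ('v, 'k) mpoly"
      have "supp (?d + lm b) \<subseteq> V" unfolding d using suppV[OF less.prems(2) lm_in[OF False]] .
      then have t: "?t \<in> polys V" by (intro polys_monom) (simp add: supp_add_nat)
      let ?q = "p - ?t * b"
      have qJ: "?q \<in> J" using less.prems b0 t by (intro id(5) id(6))
      have "?q \<in> polyideal V B"
      proof (cases "?q = 0")
        case True
        then show ?thesis using idB(2) by simp
      next
        case q0: False
        have "coef (?t * b) (lm p) = coef p (lm p)"
          using coef_monom_mult[of ?d "coef p (lm p) / coef b (lm b)" b "lm b"] coef_lm[OF b0(1)]
          unfolding d by simp
        then have "coef ?q (lm p) = 0" by (simp add: lookup_minus)
        then have "lm ?q \<noteq> lm p" using coef_lm[OF q0] by metis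
        moreover have "lm ?q \<le> lm p"
        proof -
          have "lm ?q \<in> supp p \<or> lm ?q \<in> supp (?t * b)"
            using lm_in[OF q0] by (auto simp: in_keys_iff lookup_minus)
          then show ?thesis
          proof
            assume "lm ?q \<in> supp (?t * b)"
            then obtain m' where "lm ?q = ?d + m'" "m' \<in> supp b" using supp_monom_mult by blast
            then show ?thesis using add_left_mono[OF lm_ge[of m' b], of ?d] d by simp
          qed (rule lm_ge)
        qed
        ultimately have "lm ?q < lm p" by simp
        moreover have "supp (lm ?q) \<subseteq> V" "supp (lm p) \<subseteq> V"
          using suppV[OF qJ lm_in[OF q0]] suppV[OF less.prems(2) lm_in[OF False]] .
        ultimately have "(lm ?q, e) \<in> {(a, b). a < b \<and> supp a \<subseteq> V \<and> supp b \<subseteq> V}"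
          using less.prems by simp
        then show ?thesis by (rule less.IH[OF _ refl qJ])
      qed
      moreover have "?t * b \<in> polyideal V B" using t polyideal_mem[OF BV b(1)] by (rule idB(6))
      ultimately have "?q + ?t * b \<in> polyideal V B" by (rule idB(3))
      then show ?thesis by simp
    qed
  qed
  then have "J \<subseteq> polyideal V B" by blast
  moreover have "polyideal V B \<subseteq> J" by (rule polyideal_least[OF J]) (use B in auto)
  ultimately show "\<exists>A\<subseteq>polys V. finite A \<and> J = polyideal V A" using B BV by blast
qed


section \<open>The dimension of a polynomial ring\<close>

text \<open>Gaussian elimination: equation \<open>q\<close> is solved for the unknown at
  \<open>e0\<close>, which is then eliminated from the other equations.\<close>

lemma ex_linear_relation:
  fixes a :: "'q \<Rightarrow> 'e \<Rightarrow> 'k::field"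
  assumes "finite Q" "finite E" "card Q < card E"
  shows "\<exists>c. (\<exists>e \<in> E. c e \<noteq> 0) \<and> (\<forall>q \<in> Q. (\<Sum>e \<in> E. c e * a q e) = 0)"
  using assms
proof (induction Q arbitrary: E a rule: finite_induct)
  case empty
  then have "E \<noteq> {}" by auto
  then show ?case by (intro exI[of _ "\<lambda>_. 1"]) auto
next
  case (insert q Q)
  show ?case
  proof (cases "\<forall>e \<in> E. a q e = 0")
    case True
    obtain c where "\<exists>e \<in> E. c e \<noteq> 0" "\<forall>q \<in> Q. (\<Sum>e \<in> E. c e * a q e) = 0"
      using insert.IH[of E a] insert.prems insert.hyps by auto
    then show ?thesis using True by (intro exI[of _ c]) auto
  next
    case False
    then obtain e0 where e0: "e0 \<in> E" "a q e0 \<noteq> 0" by blast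
    let ?E = "E - {e0}"
    let ?a = "\<lambda>q' e. a q' e - a q' e0 * a q e / a q e0"
    obtain c where c: "\<exists>e \<in> ?E. c e \<noteq> 0" "\<And>q'. q' \<in> Q \<Longrightarrow> (\<Sum>e \<in> ?E. c e * ?a q' e) = 0"
    proof -
      have "card Q < card ?E" using insert.prems insert.hyps e0 by simp
      then show ?thesis using insert.IH[of ?E ?a] insert.prems that by auto
    qed
    let ?S = "\<Sum>e \<in> ?E. c e * a q e"
    let ?c = "c(e0 := - ?S / a q e0)"
    have split: "(\<Sum>e \<in> E. ?c e * a q' e) = - ?S / a q e0 * a q' e0 + (\<Sum>e \<in> ?E. c e * a q' e)" for q'
    proof -
      have "(\<Sum>e \<in> E. ?c e * a q' e) = ?c e0 * a q' e0 + (\<Sum>e \<in> ?E. ?c e * a q' e)"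
        using e0 insert.prems by (simp add: sum.remove)
      also have "(\<Sum>e \<in> ?E. ?c e * a q' e) = (\<Sum>e \<in> ?E. c e * a q' e)" by (rule sum.cong) auto
      finally show ?thesis by simp
    qed
    have "(\<Sum>e \<in> E. ?c e * a q' e) = 0" if "q' \<in> insert q Q" for q'
    proof (cases "q' = q")
      case True
      then show ?thesis unfolding split using e0 by simp
    next
      case False
      then have "0 = (\<Sum>e \<in> ?E. c e * ?a q' e)" using that c by simp
      also have "\<dots> = (\<Sum>e \<in> ?E. c e * a q' e - a q' e0 / a q e0 * (c e * a q e))"
        by (rule sum.cong) (auto simp: algebra_simps)
      also have "\<dots> = (\<Sum>e \<in> ?E. c e * a q' e) - a q' e0 / a q e0 * ?S"
        by (simp add: sum_subtractf sum_distrib_left)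
      finally show ?thesis unfolding split by (simp add: algebra_simps)
    qed
    moreover have "\<exists>e \<in> E. ?c e \<noteq> 0" using c(1) by auto
    ultimately show ?thesis by blast
  qed
qed

text \<open>Each exponent is bounded separately, not the total degree: the admissible monomials then
  form a box and are counted by a plain power in \<open>bounded_exponents\<close>.\<close>

definition exponents_le :: "nat \<Rightarrow> ('v, 'k::field) mpoly \<Rightarrow> bool" where
  "exponents_le c p \<longleftrightarrow> (\<forall>m \<in> supp p. \<forall>v. coef m v \<le> c)"

lemma exponents_le_mono: "exponents_le c p \<Longrightarrow> c \<le> d \<Longrightarrow> exponents_le d p"
  unfolding exponents_le_def using order_trans by blast

lemma exponents_le_mult:
  assumes "exponents_le c p" "exponents_le d q"
  shows "exponents_le (c + d) (p * q)"
  unfolding exponents_le_def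
proof (intro ballI allI)
  fix m v assume "m \<in> supp (p * q)"
  then obtain a b where "m = a + b" "a \<in> supp p" "b \<in> supp q"
    using Poly_Mapping.keys_mult[of p q] by blast
  then show "coef m v \<le> c + d" using assms by (simp add: exponents_le_def lookup_add add_mono)
qed

lemma exponents_le_0_1: "exponents_le 0 1"
  by (simp add: exponents_le_def)

lemma exponents_le_power: "exponents_le c p \<Longrightarrow> exponents_le (n * c) (p ^ n)"
  by (induction n) (auto intro: exponents_le_0_1 exponents_le_mult)

lemma exponents_le_prod:
  "(\<And>i. i \<in> A \<Longrightarrow> exponents_le (c i) (p i)) \<Longrightarrow> exponents_le (sum c A) (prod p A)"
  by (induction A rule: infinite_finite_induct) (auto intro: exponents_le_0_1 exponents_le_mult)

lemma exponents_le_sum: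
  assumes "\<And>i. i \<in> A \<Longrightarrow> exponents_le c (p i)"
  shows "exponents_le c (sum p A)"
  using assms
proof (induction A rule: infinite_finite_induct)
  case (insert x F)
  then show ?case using Poly_Mapping.keys_add[of "p x" "sum p F"] unfolding exponents_le_def by fastforce
qed (auto simp: exponents_le_def)

lemma ex_exponents_le: "\<exists>c. exponents_le c p"
proof -
  let ?S = "\<Union>m \<in> supp p. coef m ` supp m"
  have fin: "finite ?S" by auto
  have "coef m v \<le> Max (insert 0 ?S)" if "m \<in> supp p" for m v
  proof (cases "v \<in> supp m")
    case True
    then have "coef m v \<in> ?S" using that by auto
    then show ?thesis using fin by (intro Max_ge) auto
  qed (auto simp: in_keys_iff)
  then show ?thesis unfolding exponents_le_def by blast
qed

lemma bounded_exponents: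
  assumes "finite Z"
  shows "finite {a :: 'v \<Rightarrow>\<^sub>0 nat. supp a \<subseteq> Z \<and> (\<forall>v. coef a v \<le> M)}" (is "finite ?Q")
    and "card {a :: 'v \<Rightarrow>\<^sub>0 nat. supp a \<subseteq> Z \<and> (\<forall>v. coef a v \<le> M)} \<le> (M + 1) ^ card Z"
proof -
  let ?f = "\<lambda>a :: 'v \<Rightarrow>\<^sub>0 nat. restrict (coef a) Z"
  have inj: "inj_on ?f ?Q"
  proof (rule inj_onI, rule poly_mapping_eqI)
    fix a b v assume *: "a \<in> ?Q" "b \<in> ?Q" "?f a = ?f b"
    show "coef a v = coef b v"
    proof (cases "v \<in> Z")
      case True
      then show ?thesis using fun_cong[OF *(3), of v] by simp
    next
      case False
      then have "v \<notin> supp a" "v \<notin> supp b" using * by auto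
      then show ?thesis by (simp add: in_keys_iff)
    qed
  qed
  have sub: "?f ` ?Q \<subseteq> Z \<rightarrow>\<^sub>E {..M}" by auto
  have fin: "finite (Z \<rightarrow>\<^sub>E {..M})" using assms by (simp add: finite_PiE)
  show "finite ?Q" using inj sub fin by (rule inj_on_finite)
  have "card ?Q \<le> card (Z \<rightarrow>\<^sub>E {..M})" using inj sub fin by (rule card_inj_on_le)
  then show "card ?Q \<le> (M + 1) ^ card Z" using assms by (simp add: card_PiE)
qed

lemma primeideal_polyD:
  assumes "primeideal P (poly_ring V)"
  shows "ideal P (poly_ring V)" "1 \<notin> P"
    "p \<in> polys V \<Longrightarrow> q \<in> polys V \<Longrightarrow> p * q \<in> P \<Longrightarrow> p \<in> P \<or> q \<in> P"
    "p \<in> polys V \<Longrightarrow> p ^ n \<in> P \<Longrightarrow> p \<in> P"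
    "c \<noteq> 0 \<Longrightarrow> monom 0 c \<notin> P"
proof -
  interpret primeideal P "poly_ring V" by fact
  show i: "ideal P (poly_ring V)" by (rule is_ideal)
  show one: "1 \<notin> P" using one_imp_carrier I_notcarr by auto
  show pr: "p \<in> polys V \<Longrightarrow> q \<in> polys V \<Longrightarrow> p * q \<in> P \<Longrightarrow> p \<in> P \<or> q \<in> P" for p q
    using I_prime by simp
  show "p \<in> polys V \<Longrightarrow> p ^ n \<in> P \<Longrightarrow> p \<in> P"
  proof (induction n)
    case (Suc n)
    then show ?case using pr[of p "p ^ n"] by auto
  qed (use one in simp)
  show "monom 0 c \<notin> P" if "c \<noteq> 0"
  proof
    assume "monom 0 c \<in> P"
    then have "monom 0 (inverse c) * monom 0 c \<in> P" by (intro ideal_polyD(6)[OF i]) auto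
    then show False using one that by (simp add: mult_single)
  qed
qed

text \<open>Pick \<open>f i\<close> in \<open>p (Suc i)\<close> outside \<open>p i\<close>. If the
  chain were longer than \<open>card Z\<close>, counting monomials would give a polynomial relation
  modulo \<open>p 0\<close> among \<open>card Z + 1\<close> of the \<open>f i\<close>; on the way up
  the chain it loses terms until a nonzero constant lies in a prime.\<close>

theorem prime_chain_length:
  fixes p :: "nat \<Rightarrow> ('v, 'k::field) mpoly set"
  assumes prime: "\<And>i. i \<le> m \<Longrightarrow> primeideal (p i) (poly_ring V)"
    and strict: "\<And>i. i < m \<Longrightarrow> p i \<subset> p (Suc i)"
    and Z: "finite Z" "Z \<subseteq> V" "\<And>v. v \<in> V - Z \<Longrightarrow> pvar v \<in> p 0"
  shows "m \<le> card Z"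
proof (rule ccontr)
  define n where "n = card Z"
  assume "\<not> m \<le> card Z"
  then have nm: "n < m" by (simp add: n_def)
  have "\<forall>i. \<exists>q. i < m \<longrightarrow> q \<in> p (Suc i) \<and> q \<notin> p i" using strict by blast
  then obtain f where f: "\<And>i. i < m \<Longrightarrow> f i \<in> p (Suc i)" "\<And>i. i < m \<Longrightarrow> f i \<notin> p i" by metis
  note id = ideal_polyD[OF primeideal_polyD(1)[OF prime]]
  have fV: "f i \<in> polys V" if "i < m" for i using f(1)[OF that] id(1)[of "Suc i"] that by auto
  obtain d where d: "\<And>i. exponents_le (d i) (f i)"
    using choice[of "\<lambda>i c. exponents_le c (f i)"] ex_exponents_le by blast
  define D where "D = Suc (\<Sum>i \<le> n. d i)"
  have D: "exponents_le D (f i)" if "i \<le> n" for i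
  proof (rule exponents_le_mono[OF d])
    have "d i \<le> (\<Sum>i \<le> n. d i)" using that by (intro member_le_sum) auto
    then show "d i \<le> D" by (simp add: D_def)
  qed
  \<comment> \<open>A product of powers \<open>f i ^ e i\<close> with \<open>e i \<le> N\<close> for
    the n + 1 indices has exponents at most \<open>C * N = M\<close>. The choice
    \<open>N = C ^ n\<close> gives (M + 1)^n \<le> N (N + 1)^n, which is less than the number (N +
    1)^(n + 1) of such products.\<close>
  define C where "C = Suc n * D"
  define N where "N = C ^ n"
  define M where "M = C * N"
  define E where "E = {..n} \<rightarrow>\<^sub>E {..N}"
  define Q where "Q = {a :: 'v \<Rightarrow>\<^sub>0 nat. supp a \<subseteq> Z \<and> (\<forall>v. coef a v \<le> M)}"
  define F where "F j e = (\<Prod>i \<in> {j..n}. f i ^ e i)" for j and e :: "nat \<Rightarrow> nat"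
  have C1: "1 \<le> C" by (simp add: C_def D_def)
  have finE: "finite E" unfolding E_def by (simp add: finite_PiE)
  have "card E = (N + 1) ^ (n + 1)" unfolding E_def by (simp add: card_PiE)
  moreover have "card Q \<le> (M + 1) ^ n" unfolding Q_def n_def by (rule bounded_exponents(2)[OF Z(1)])
  moreover have "(M + 1) ^ n < (N + 1) ^ (n + 1)"
  proof -
    have "M + 1 \<le> C * (N + 1)" using C1 by (simp add: M_def)
    then have "(M + 1) ^ n \<le> (C * (N + 1)) ^ n" by (rule power_mono) simp
    also have "\<dots> = N * (N + 1) ^ n" by (simp only: power_mult_distrib N_def)
    also have "\<dots> < (N + 1) ^ (n + 1)" by simp
    finally show ?thesis .
  qed
  ultimately have "card Q < card E" by linarith
  moreover have "finite Q" unfolding Q_def by (rule bounded_exponents(1)[OF Z(1)])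
  ultimately have "\<exists>c. (\<exists>e \<in> E. c e \<noteq> 0) \<and> (\<forall>q \<in> Q. (\<Sum>e \<in> E. c e * coef (F 0 e) q) = 0)"
    using finE by (intro ex_linear_relation)
  then obtain c where c0: "(\<exists>e \<in> E. c e \<noteq> 0) \<and> (\<forall>q \<in> Q. (\<Sum>e \<in> E. c e * coef (F 0 e) q) = 0)"
    by (rule exE)
  have c: "\<exists>e \<in> E. c e \<noteq> 0" "\<And>q. q \<in> Q \<Longrightarrow> (\<Sum>e \<in> E. c e * coef (F 0 e) q) = 0"
    using c0 by simp_all
  have FV: "F j e \<in> polys V" for j e
    unfolding F_def
  proof (intro polys_prod polys_power)
    fix i assume "i \<in> {j..n}"
    then show "f i \<in> polys V" using nm by (intro fV) simp
  qed
  have Fexp: "exponents_le M (F 0 e)" if "e \<in> E" for e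
  proof (rule exponents_le_mono)
    show "exponents_le (\<Sum>i \<in> {0..n}. e i * D) (F 0 e)"
      unfolding F_def by (intro exponents_le_prod exponents_le_power D) auto
    have "(\<Sum>i \<in> {0..n}. e i * D) \<le> (\<Sum>i \<in> {0..n}. N * D)"
      using that PiE_mem[of e "{..n}" "\<lambda>_. {..N}"] by (intro sum_mono mult_right_mono) (simp_all add: E_def)
    also have "\<dots> = M" by (simp add: M_def C_def algebra_simps)
    finally show "(\<Sum>i \<in> {0..n}. e i * D) \<le> M" .
  qed
  define r where "r A j = (\<Sum>e \<in> A. monom 0 (c e) * F j e)" for A j
  have rV: "r A j \<in> polys V" for A j unfolding r_def by (intro polys_sum polys_mult FV) auto
  have coef_r: "coef (r A 0) q = (\<Sum>e \<in> A. c e * coef (F 0 e) q)" for q A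
    unfolding r_def lookup_sum using coef_monom_mult[of 0] by (intro sum.cong) auto
  \<comment> \<open>The coefficients at exponents in \<open>Q\<close> vanish by the choice of
    \<open>c\<close>. All exponents are bounded by \<open>M\<close>, so the remaining monomials
    contain a variable outside \<open>Z\<close>, which lies in \<open>p 0\<close>.\<close>
  have "r E 0 \<in> p 0"
  proof (rule mem_ideal_monomials[OF _ rV])
    show "ideal (p 0) (poly_ring V)" using primeideal_polyD(1)[OF prime] by simp
    fix q assume q: "q \<in> supp (r E 0)"
    have "exponents_le M (r E 0)" unfolding r_def
    proof (rule exponents_le_sum)
      fix e assume "e \<in> E"
      then have "exponents_le (0 + M) (monom 0 (c e) * F 0 e)"
        by (intro exponents_le_mult Fexp) (auto simp: exponents_le_def)
      then show "exponents_le M (monom 0 (c e) * F 0 e)" by simp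
    qed
    then have "\<forall>v. coef q v \<le> M" using q by (auto simp: exponents_le_def)
    moreover have "q \<notin> Q" using c(2)[of q] q by (auto simp: coef_r in_keys_iff)
    ultimately have "\<not> supp q \<subseteq> Z" by (auto simp: Q_def)
    then obtain v where v: "v \<in> supp q" "v \<notin> Z" by blast
    have qV: "supp q \<subseteq> V" using q rV[of E 0] by (auto simp: polys_iff)
    then have pv: "pvar v \<in> p 0" using Z(3) v by auto
    have "mdvd (Poly_Mapping.single v 1) q" using v by (auto simp: mdvd_def lookup_single when_def in_keys_iff)
    then have eq: "Poly_Mapping.single v 1 + (q - Poly_Mapping.single v 1) = q" by (rule mdvd_diff)
    then have "supp (q - Poly_Mapping.single v 1) \<subseteq> V" using qV supp_add_nat by (metis Un_subset_iff)
    then have "monom (q - Poly_Mapping.single v 1) 1 * pvar v \<in> p 0"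
      by (intro id(6)[of 0] pv) auto
    then show "monom q 1 \<in> p 0" using eq by (simp add: pvar_def xpow_def mult_single add.commute)
  qed
  text \<open>Cancelling the least power of \<open>f\<^sub>j\<close> and passing from \<open>p\<^sub>j\<close> to \<open>p\<^sub>j\<^sub>+\<^sub>1\<close> keeps only the terms
    in which \<open>f\<^sub>j\<close> has the least exponent.\<close>
  have chain: "\<exists>A. A \<subseteq> E \<and> A \<noteq> {} \<and> (\<forall>e \<in> A. c e \<noteq> 0) \<and>
      (\<forall>e \<in> A. \<forall>e' \<in> A. \<forall>i < j. e i = e' i) \<and> r A j \<in> p j" if "j \<le> Suc n" for j
    using that
  proof (induction j)
    case 0
    let ?A = "{e \<in> E. c e \<noteq> 0}"
    have "r ?A 0 = r E 0"
      unfolding r_def using finE by (intro sum.mono_neutral_left) auto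
    then show ?case using \<open>r E 0 \<in> p 0\<close> c(1) by (intro exI[of _ ?A]) auto
  next
    case (Suc j)
    then obtain A where A: "A \<subseteq> E" "A \<noteq> {}" "\<forall>e \<in> A. c e \<noteq> 0"
      "\<forall>e \<in> A. \<forall>e' \<in> A. \<forall>i < j. e i = e' i" "r A j \<in> p j" by auto
    have jn: "j \<le> n" "j < m" using Suc.prems nm by auto
    have finA: "finite A" using A finE finite_subset by blast
    define m0 where "m0 = Min ((\<lambda>e. e j) ` A)"
    have m0: "m0 \<le> e j" if "e \<in> A" for e unfolding m0_def using that finA by simp
    have "m0 \<in> (\<lambda>e. e j) ` A" unfolding m0_def using A finA by (intro Min_in) auto
    then have ex: "\<exists>e \<in> A. e j = m0" by auto
    let ?A = "{e \<in> A. e j = m0}"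
    have Fj: "F j e = f j ^ e j * F (Suc j) e" for e
      unfolding F_def using jn by (simp add: prod.atLeast_Suc_atMost)
    let ?s = "\<Sum>e \<in> A. monom 0 (c e) * (f j ^ (e j - m0) * F (Suc j) e)"
    have "r A j = f j ^ m0 * ?s"
      unfolding r_def sum_distrib_left
    proof (rule sum.cong)
      fix e assume "e \<in> A"
      then have "f j ^ e j = f j ^ m0 * f j ^ (e j - m0)" using m0 by (simp add: power_add[symmetric])
      then show "monom 0 (c e) * F j e = f j ^ m0 * (monom 0 (c e) * (f j ^ (e j - m0) * F (Suc j) e))"
        unfolding Fj by (simp add: mult_ac)
    qed simp
    moreover have sV: "?s \<in> polys V" by (intro polys_sum polys_mult FV polys_power fV jn) auto
    ultimately have "f j ^ m0 \<in> p j \<or> ?s \<in> p j"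
      using A(5) primeideal_polyD(3)[OF prime, of j "f j ^ m0" ?s] fV jn by auto
    then have "?s \<in> p j" using primeideal_polyD(4)[OF prime, of j "f j" m0] f(2)[of j] fV jn by auto
    then have s: "?s \<in> p (Suc j)" using strict[of j] jn by auto
    have idS: "ideal (p (Suc j)) (poly_ring V)" using primeideal_polyD(1)[OF prime] jn by simp
    have "?s = (\<Sum>e \<in> ?A. monom 0 (c e) * (f j ^ (e j - m0) * F (Suc j) e)) +
        (\<Sum>e \<in> A - ?A. monom 0 (c e) * (f j ^ (e j - m0) * F (Suc j) e))"
      using finA by (subst add.commute, intro sum.subset_diff) auto
    also have "(\<Sum>e \<in> ?A. monom 0 (c e) * (f j ^ (e j - m0) * F (Suc j) e)) = r ?A (Suc j)"
      unfolding r_def by (intro sum.cong) auto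
    finally have "r ?A (Suc j) = ?s - (\<Sum>e \<in> A - ?A. monom 0 (c e) * (f j ^ (e j - m0) * F (Suc j) e))"
      by simp
    moreover have "(\<Sum>e \<in> A - ?A. monom 0 (c e) * (f j ^ (e j - m0) * F (Suc j) e)) \<in> p (Suc j)"
    proof (rule ideal_poly_sum[OF idS])
      fix e assume e: "e \<in> A - ?A"
      then have "m0 < e j" using m0[of e] by auto
      then obtain l where l: "e j - m0 = Suc l" by (metis Suc_diff_Suc)
      have "(monom 0 (c e) * (f j ^ l * F (Suc j) e)) * f j \<in> p (Suc j)"
        by (rule ideal_polyD(6)[OF idS]) (use f(1) fV FV jn in auto)
      then show "monom 0 (c e) * (f j ^ (e j - m0) * F (Suc j) e) \<in> p (Suc j)"
        unfolding l by (simp add: mult_ac)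
    qed
    ultimately have "r ?A (Suc j) \<in> p (Suc j)" using ideal_polyD(5)[OF idS] s by simp
    then show ?case using A ex by (intro exI[of _ ?A]) (auto simp: less_Suc_eq)
  qed
  obtain A where A: "A \<subseteq> E" "A \<noteq> {}" "\<forall>e \<in> A. c e \<noteq> 0"
    "\<forall>e \<in> A. \<forall>e' \<in> A. \<forall>i < Suc n. e i = e' i" "r A (Suc n) \<in> p (Suc n)"
    using chain[of "Suc n"] by blast
  then obtain e where e: "e \<in> A" by auto
  \<comment> \<open>All exponents at indices up to n agree on \<open>A\<close>, so a single term is
    left; its product \<open>F (Suc n) e\<close> is empty, and only the nonzero constant
    \<open>c e\<close> remains.\<close>
  have "A = {e}"
  proof -
    have "e' = e" if e': "e' \<in> A" for e'
    proof (rule PiE_ext)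
      show "e' \<in> {..n} \<rightarrow>\<^sub>E {..N}" "e \<in> {..n} \<rightarrow>\<^sub>E {..N}"
        using subsetD[OF A(1) e'] subsetD[OF A(1) e] unfolding E_def .
      show "e' i = e i" if "i \<in> {..n}" for i
        using A(4)[rule_format, OF e' e, of i] that by (simp add: less_Suc_eq_le)
    qed
    then show ?thesis using e by blast
  qed
  then have "monom 0 (c e) \<in> p (Suc n)" using A(5) by (simp add: r_def F_def)
  then show False using primeideal_polyD(5)[OF prime, of "Suc n" "c e"] A(3) e nm by auto
qed


section \<open>Zariski's lemma\<close>

lemma maximalideal_poly_inverse:
  assumes M: "maximalideal M (poly_ring V)" and f: "f \<in> polys V" "f \<notin> M"
  shows "\<exists>h \<in> polys V. f * h - 1 \<in> M"
proof -
  interpret maximalideal M "poly_ring V" by fact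
  note id = ideal_polyD[OF is_ideal]
  define J where "J = {p + f * h | p h. p \<in> M \<and> h \<in> polys V}"
  have "ideal J (poly_ring V)"
  proof (rule ideal_poly_ringI)
    show "J \<subseteq> polys V" unfolding J_def using id(1) f by auto
    show "0 \<in> J" unfolding J_def using id(2) by (intro CollectI exI[of _ 0]) auto
    show "p + q \<in> J" if p: "p \<in> J" and q: "q \<in> J" for p q
    proof -
      obtain a b where *: "p = a + f * b" "a \<in> M" "b \<in> polys V" using p unfolding J_def by blast
      obtain c d where **: "q = c + f * d" "c \<in> M" "d \<in> polys V" using q unfolding J_def by blast
      have "p + q = (a + c) + f * (b + d)" unfolding * ** by (simp add: algebra_simps)
      moreover have "a + c \<in> M" "b + d \<in> polys V" using * ** id(3) by auto
      ultimately show ?thesis unfolding J_def by blast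
    qed
    show "p * q \<in> J" if p: "p \<in> polys V" and q: "q \<in> J" for p q
    proof -
      obtain a b where *: "q = a + f * b" "a \<in> M" "b \<in> polys V" using q unfolding J_def by blast
      have "p * q = (p * a) + f * (p * b)" unfolding * by (simp add: algebra_simps)
      moreover have "p * a \<in> M" "p * b \<in> polys V" using * id(6) p by auto
      ultimately show ?thesis unfolding J_def by blast
    qed
  qed
  moreover have "M \<subseteq> J"
  proof
    fix p assume "p \<in> M"
    then show "p \<in> J" unfolding J_def by (intro CollectI exI[of _ p] exI[of _ 0]) auto
  qed
  moreover have "J \<subseteq> polys V" unfolding J_def using id(1) f by auto
  ultimately have J: "J = M \<or> J = polys V" by (rule I_maximal)
  have "f \<in> J" unfolding J_def using id(2) by (intro CollectI exI[of _ 0] exI[of _ 1]) auto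
  with J f have "J = polys V" by metis
  then have "1 \<in> J" by simp
  then obtain p h where *: "1 = p + f * h" "p \<in> M" "h \<in> polys V" unfolding J_def by blast
  then have "f * h - 1 = - p" by (metis add_diff_cancel_right' diff_add_eq_diff_diff_swap diff_self minus_diff_eq diff_0 add.commute)
  then show ?thesis using id(4)[OF *(2)] *(3) by (intro bexI[of _ h]) simp_all
qed

lemma var_expand:
  assumes "w \<notin> T" "f \<in> polys (insert w T)" "f \<noteq> 0"
  shows "\<exists>c m g. c \<in> polys T \<and> c \<noteq> 0 \<and> (\<forall>e < m. g e \<in> polys T) \<and>
    f = c * pvar w ^ m + (\<Sum>e < m. g e * pvar w ^ e)"
  using assms(2,3)
proof (induction f rule: vdiv_induct[where v = w])
  case zero
  then show ?case by simp
next
  case (vdiv f)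
  have z: "vzero w f \<in> polys T" using polys_vzero_Diff[OF vdiv.prems(1), of w] assms(1) by simp
  show ?case
  proof (cases "vdiv w f = 0")
    case True
    then have "f = vzero w f" using vdiv_decomp[of f w] by simp
    then show ?thesis using z vdiv.prems
      by (intro exI[of _ f] exI[of _ "0::nat"] exI[of _ "\<lambda>_. 0"]) auto
  next
    case False
    then obtain c m g where *: "c \<in> polys T" "c \<noteq> 0" "\<forall>e < m. g e \<in> polys T"
      "vdiv w f = c * pvar w ^ m + (\<Sum>e < m. g e * pvar w ^ e)"
      using vdiv.IH polys_vdiv[OF vdiv.prems(1)] by blast
    let ?g = "\<lambda>e. case e of 0 \<Rightarrow> vzero w f | Suc e \<Rightarrow> g e"
    have "f = vzero w f + pvar w * vdiv w f" by (rule vdiv_decomp)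
    also have "\<dots> = c * pvar w ^ Suc m + (vzero w f + (\<Sum>e < m. g e * pvar w ^ Suc e))"
      unfolding *(4) by (simp add: distrib_left sum_distrib_left mult_ac)
    also have "vzero w f + (\<Sum>e < m. g e * pvar w ^ Suc e) = (\<Sum>e < Suc m. ?g e * pvar w ^ e)"
      unfolding sum.lessThan_Suc_shift by simp
    finally have "f = c * pvar w ^ Suc m + (\<Sum>e < Suc m. ?g e * pvar w ^ e)" .
    moreover have "\<forall>e < Suc m. ?g e \<in> polys T" using z * by (auto split: nat.split)
    ultimately show ?thesis using * by blast
  qed
qed

lemma polys_induct [consumes 1, case_names const var add mult]:
  assumes "p \<in> polys V" "\<And>c. P (monom 0 c)" "\<And>v. v \<in> V \<Longrightarrow> P (pvar v)"
    and add: "\<And>p q. p \<in> polys V \<Longrightarrow> q \<in> polys V \<Longrightarrow> P p \<Longrightarrow> P q \<Longrightarrow> P (p + q)"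
    and mult: "\<And>p q. p \<in> polys V \<Longrightarrow> q \<in> polys V \<Longrightarrow> P p \<Longrightarrow> P q \<Longrightarrow> P (p * q)"
  shows "P p"
proof -
  have one: "P 1" using assms(2)[of 1] by simp
  have pow: "P (pvar v ^ n)" if "v \<in> V" for v n
    by (induction n) (use one assms(3) mult that in auto)
  have prod: "P (\<Prod>v \<in> A. pvar v ^ n v)" if "A \<subseteq> V" for A n
    using that
    by (induction A rule: infinite_finite_induct) (auto intro!: one mult pow polys_prod)
  have xp: "xpow m = (\<Prod>v \<in> supp m. pvar v ^ coef m v :: ('a, 'b) mpoly)" for m :: "'a \<Rightarrow>\<^sub>0 nat"
  proof -
    have pw: "pvar v ^ n = (xpow (Poly_Mapping.single v n) :: ('a, 'b) mpoly)" for v and n :: nat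
      by (induction n) (auto simp: pvar_def xpow_add[symmetric] single_add[symmetric])
    have xs: "xpow (sum f A) = (\<Prod>v \<in> A. xpow (f v) :: ('a, 'b) mpoly)" for f and A :: "'a set"
      by (induction A rule: infinite_finite_induct) (auto simp: xpow_add)
    have "(xpow m :: ('a, 'b) mpoly) = xpow (\<Sum>v \<in> supp m. Poly_Mapping.single v (coef m v))"
      using mpoly_expand[of m] by (rule arg_cong)
    also have "\<dots> = (\<Prod>v \<in> supp m. pvar v ^ coef m v)" by (simp add: xs pw)
    finally show ?thesis .
  qed
  have mon: "P (monom m c)" if "supp m \<subseteq> V" for m c
  proof -
    have "P (xpow m)" unfolding xp by (rule prod[OF that])
    then have "P (monom 0 c * xpow m)" using that assms(2)[of c] by (intro mult) simp_all
    then show ?thesis by (simp add: xpow_def mult_single)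
  qed
  have "P (\<Sum>m \<in> A. monom m (coef p m))" if "A \<subseteq> supp p" for A
    using that
  proof (induction A rule: infinite_finite_induct)
    case (insert x F)
    then have "\<And>m. m \<in> insert x F \<Longrightarrow> supp m \<subseteq> V" using assms(1) by (auto simp: polys_iff)
    then show ?case using insert by (auto intro!: add mon polys_sum)
  qed (use assms(2)[of 0] in auto)
  then show ?thesis using mpoly_expand[of p] by (metis order_refl)
qed

text \<open>Nakayama's lemma for the module spanned by \<open>W\<close> modulo \<open>M\<close>, with \<open>U\<close> in place of the elements
  \<open>1 + g b\<close>. Eliminating one generator at a time avoids determinants.\<close>

lemma Nakayama_elimination:
  assumes M: "ideal M (poly_ring V)" and TV: "T \<subseteq> V" and W: "finite W" "W \<subseteq> polys V"
    and g: "g \<in> polys T"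
    and U: "U \<subseteq> polys T" "1 \<in> U" "\<And>u u'. u \<in> U \<Longrightarrow> u' \<in> U \<Longrightarrow> u * u' \<in> U"
      "\<And>u b. u \<in> U \<Longrightarrow> b \<in> polys T \<Longrightarrow> u - g * b \<in> U"
    and rel: "\<And>x. x \<in> W \<Longrightarrow> \<exists>u \<in> U. \<exists>b. (\<forall>y \<in> W. b y \<in> polys T) \<and> u * x - g * (\<Sum>y \<in> W. b y * y) \<in> M"
  shows "\<exists>u \<in> U. \<forall>x \<in> W. u * x \<in> M"
  using W rel
proof (induction W rule: finite_induct)
  case empty
  then show ?case using U(2) by auto
next
  case (insert x W)
  note id = ideal_polyD[OF M]
  have TV': "p \<in> polys T \<Longrightarrow> p \<in> polys V" for p :: "('a, 'b) mpoly" using polys_mono TV by blast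
  obtain u b where u: "u \<in> U" "\<forall>y \<in> insert x W. b y \<in> polys T"
    "u * x - g * (\<Sum>y \<in> insert x W. b y * y) \<in> M"
    using insert.prems(2)[of x] by blast
  \<comment> \<open>Collects the multiples of \<open>x\<close> on the left: modulo \<open>M\<close>,
    \<open>u1 * x\<close> is a combination of the remaining generators.\<close>
  define u1 where "u1 = u - g * b x"
  have u1: "u1 \<in> U" unfolding u1_def using u by (intro U(4)) auto
  have u1x: "u1 * x - g * (\<Sum>y \<in> W. b y * y) \<in> M"
    using u(3) insert.hyps by (simp add: u1_def algebra_simps)
  have "\<exists>u \<in> U. \<forall>z \<in> W. u * z \<in> M"
  proof (rule insert.IH)
    show "W \<subseteq> polys V" using insert.prems by auto
    fix z assume z: "z \<in> W"
    then obtain v c where v: "v \<in> U" "\<forall>y \<in> insert x W. c y \<in> polys T"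
      "v * z - g * (\<Sum>y \<in> insert x W. c y * y) \<in> M"
      using insert.prems(2)[of z] by blast
    \<comment> \<open>The relation for \<open>z\<close> is multiplied by \<open>u1\<close>, so that
      its \<open>x\<close>-term can be replaced by means of \<open>u1x\<close>.\<close>
    let ?d = "\<lambda>y. g * c x * b y + u1 * c y"
    have "u1 * v * z - g * (\<Sum>y \<in> W. ?d y * y) =
        u1 * (v * z - g * (\<Sum>y \<in> insert x W. c y * y)) + g * c x * (u1 * x - g * (\<Sum>y \<in> W. b y * y))"
      using insert.hyps
      by (simp add: algebra_simps sum.distrib sum_distrib_left)
    moreover have "\<dots> \<in> M"
      using v(3) u1x u1 U(1) g v(2) by (intro id(3) id(6)) (auto intro!: TV')
    ultimately have "u1 * v * z - g * (\<Sum>y \<in> W. ?d y * y) \<in> M" by simp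
    moreover have "\<forall>y \<in> W. ?d y \<in> polys T" using u1 U(1) g v(2) u(2) by (auto intro!: polys_add polys_mult)
    moreover have "u1 * v \<in> U" using U(3) u1 v(1) .
    ultimately show "\<exists>u \<in> U. \<exists>b. (\<forall>y \<in> W. b y \<in> polys T) \<and> u * z - g * (\<Sum>y \<in> W. b y * y) \<in> M"
      by (intro bexI[of _ "u1 * v"] exI[of _ ?d] conjI)
  qed
  then obtain v where v: "v \<in> U" "\<And>z. z \<in> W \<Longrightarrow> v * z \<in> M" by blast
  have vV: "v \<in> polys V" "u1 \<in> polys V" "g \<in> polys V" using v(1) u1 U(1) g TV' by blast+
  have bV: "\<And>y. y \<in> W \<Longrightarrow> b y \<in> polys V" using u(2) TV' by blast
  have "v * u1 * z \<in> M" if "z \<in> insert x W" for z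
  proof (cases "z = x")
    case True
    \<comment> \<open>\<open>v\<close> annihilates \<open>W\<close> modulo \<open>M\<close>, hence
      also the combination to which \<open>u1 * x\<close> is congruent.\<close>
    have "v * u1 * x = v * (u1 * x - g * (\<Sum>y \<in> W. b y * y)) + (\<Sum>y \<in> W. (g * b y) * (v * y))"
      by (simp add: algebra_simps sum_distrib_left)
    moreover have "\<dots> \<in> M"
      by (intro id(3) id(6)[OF vV(1) u1x] ideal_poly_sum[OF M] id(6) polys_mult vV bV v(2))
    ultimately show ?thesis using True by simp
  next
    case False
    then have "u1 * (v * z) \<in> M" using that by (intro id(6) vV v(2)) auto
    then show ?thesis by (simp add: mult_ac)
  qed
  moreover have "v * u1 \<in> U" using U(3) v(1) u1 .
  ultimately show ?case by blast
qed

text \<open>If the product were 1, both leading exponents would be 0, but the first factor contains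
  the monomial of \<open>t\<close> times the leading monomial of \<open>s\<close>.\<close>

lemma not_unit_one_plus:
  fixes s b :: "('v::linorder, 'k::field) mpoly"
  assumes "s \<noteq> 0"
  shows "(1 + pvar t * s) * b \<noteq> 1"
proof
  let ?g = "1 + pvar t * s"
  assume eq: "?g * b = 1"
  then have "b \<noteq> 0" "?g \<noteq> 0" by auto
  then have "coef (?g * b) (lm ?g + lm b) \<noteq> 0" unfolding coef_lm_mult using coef_lm by auto
  then have "lm ?g + lm b = 0" unfolding eq by (simp add: lookup_one when_def split: if_splits)
  then have g0: "lm ?g = 0"
    by (metis (no_types) zero_le_exponent add_increasing2 antisym order_refl)
  let ?m = "Poly_Mapping.single t 1 + lm s"
  have m0: "?m \<noteq> 0" by (metis add_eq_0_iff_both_eq_0 lookup_add lookup_single_eq lookup_zero zero_neq_one)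
  have "coef ?g ?m = coef s (lm s)"
    using m0 by (simp add: lookup_add lookup_one pvar_def coef_xpow_mult when_def)
  then have "?m \<in> supp ?g" using coef_lm[OF assms] by (simp add: in_keys_iff)
  then have "?m \<le> 0" using lm_ge[of ?m ?g] g0 by simp
  then show False using zero_le_exponent[of ?m] m0 by simp
qed

text \<open>The \<open>B\<close>-module spanned by \<open>W\<close> in the quotient by
  \<open>M\<close>, kept as a set of representatives so that no quotient module is formed.\<close>

definition span_mod :: "('v, 'k::field) mpoly set \<Rightarrow> ('v, 'k) mpoly set \<Rightarrow> ('v, 'k) mpoly set \<Rightarrow> ('v, 'k) mpoly set" where
  "span_mod B W M = {p. \<exists>b. (\<forall>y \<in> W. b y \<in> B) \<and> p - (\<Sum>y \<in> W. b y * y) \<in> M}"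

lemma span_mod_closed:
  assumes M: "ideal M (poly_ring V)" and TV: "T \<subseteq> V" and W: "finite W"
  defines "S \<equiv> span_mod (polys T) W M"
  shows "p \<in> M \<Longrightarrow> p \<in> S" "p \<in> W \<Longrightarrow> p \<in> S" "p \<in> S \<Longrightarrow> q \<in> S \<Longrightarrow> p + q \<in> S"
    "a \<in> polys T \<Longrightarrow> p \<in> S \<Longrightarrow> a * p \<in> S"
proof -
  note id = ideal_polyD[OF M]
  show "p \<in> M \<Longrightarrow> p \<in> S" unfolding S_def span_mod_def by (intro CollectI exI[of _ "\<lambda>_. 0"]) auto
  show "p \<in> W \<Longrightarrow> p \<in> S"
  proof -
    assume "p \<in> W"
    moreover have "(\<Sum>y \<in> W. (if y = p then 1 else 0) * y) = (if p \<in> W then p else 0)"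
      using W by (simp add: if_distrib[of "\<lambda>a. a * _"] sum.delta' cong: if_cong)
    ultimately show "p \<in> S" unfolding S_def span_mod_def
      by (intro CollectI exI[of _ "\<lambda>y. if y = p then 1 else 0"]) (auto simp: id(2))
  qed
  show "p + q \<in> S" if p: "p \<in> S" and q: "q \<in> S"
  proof -
    obtain b where b: "\<forall>y \<in> W. b y \<in> polys T" "p - (\<Sum>y \<in> W. b y * y) \<in> M"
      using p unfolding S_def span_mod_def by blast
    obtain c where c: "\<forall>y \<in> W. c y \<in> polys T" "q - (\<Sum>y \<in> W. c y * y) \<in> M"
      using q unfolding S_def span_mod_def by blast
    have "p + q - (\<Sum>y \<in> W. (b y + c y) * y) = (p - (\<Sum>y \<in> W. b y * y)) + (q - (\<Sum>y \<in> W. c y * y))"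
      unfolding distrib_right sum.distrib by simp
    then have "p + q - (\<Sum>y \<in> W. (b y + c y) * y) \<in> M" using id(3)[OF b(2) c(2)] by (rule ssubst)
    then show ?thesis unfolding S_def span_mod_def using b(1) c(1)
      by (intro CollectI exI[of _ "\<lambda>y. b y + c y"]) auto
  qed
  show "a * p \<in> S" if a: "a \<in> polys T" and p: "p \<in> S"
  proof -
    obtain b where b: "\<forall>y \<in> W. b y \<in> polys T" "p - (\<Sum>y \<in> W. b y * y) \<in> M"
      using p unfolding S_def span_mod_def by blast
    have "a * p - (\<Sum>y \<in> W. (a * b y) * y) = a * (p - (\<Sum>y \<in> W. b y * y))"
      by (simp add: algebra_simps sum_distrib_left)
    then have "a * p - (\<Sum>y \<in> W. (a * b y) * y) \<in> M"
      using id(6)[OF polys_mono[OF a TV] b(2)] by simp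
    then show ?thesis unfolding S_def span_mod_def using b(1) a
      by (intro CollectI exI[of _ "\<lambda>y. a * b y"]) auto
  qed
qed

lemma span_mod_sum:
  assumes M: "ideal M (poly_ring V)" and TV: "T \<subseteq> V" and W: "finite W"
  shows "(\<And>i. i \<in> A \<Longrightarrow> f i \<in> span_mod (polys T) W M) \<Longrightarrow> sum f A \<in> span_mod (polys T) W M"
  using span_mod_closed(1)[OF M TV W, of 0] ideal_polyD(2)[OF M]
  by (induction A rule: infinite_finite_induct) (auto intro: span_mod_closed[OF M TV W])


lemma prod_notin_primeideal:
  assumes "primeideal P (poly_ring V)" "\<And>i. i \<in> A \<Longrightarrow> f i \<in> polys V \<and> f i \<notin> P"
  shows "prod f A \<notin> P"
  using assms(2)
proof (induction A rule: infinite_finite_induct)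
  case (insert x F)
  show ?case
  proof
    assume "prod f (insert x F) \<in> P"
    then have "f x * prod f F \<in> P" using insert.hyps by simp
    then have "f x \<in> P \<or> prod f F \<in> P"
      by (rule primeideal_polyD(3)[OF assms(1), rotated 2]) (use insert.prems in \<open>auto intro!: polys_prod\<close>)
    then show False using insert by auto
  qed
qed (use primeideal_polyD(2)[OF assms(1)] in simp_all)

text \<open>Let \<open>T\<close> be a maximal set of variables which contains \<open>v\<close> and is independent modulo \<open>M\<close>, and \<open>s\<close> a
  common multiple of the leading coefficients of equations for the other variables. Modulo \<open>M\<close> and up to
  powers of \<open>s\<close>, the ring is a finitely generated module over the polynomials in \<open>T\<close>, on which \<open>1 + v s\<close>
  is invertible. By Nakayama's lemma \<open>1 + v s\<close> divides a power of \<open>s\<close>, so it is a unit.\<close>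

theorem maximalideal_algebraic:
  fixes V :: "'v::linorder set" and M :: "('v, 'k::field) mpoly set"
  assumes V: "finite V" and max: "maximalideal M (poly_ring V)" and v: "v \<in> V"
  shows "\<exists>f \<in> polys {v}. f \<noteq> 0 \<and> f \<in> M"
proof (rule ccontr)
  assume neg: "\<not> ?thesis"
  have prime: "primeideal M (poly_ring V)" by (rule poly_ring.maximalideal_prime[OF max])
  note M = primeideal_polyD(1)[OF prime]
  note id = ideal_polyD[OF M]
  let ?T = "{T. T \<subseteq> V \<and> v \<in> T \<and> polys T \<inter> M \<subseteq> {0}}"
  have fin: "finite ?T" using V by (intro finite_subset[of ?T "Pow V"]) auto
  have "{v} \<in> ?T" using v neg by blast
  then have "\<exists>T \<in> ?T. {v} \<subseteq> T \<and> (\<forall>T' \<in> ?T. T \<subseteq> T' \<longrightarrow> T = T')"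
    by (rule finite_has_maximal2[OF fin])
  then obtain T where T: "T \<in> ?T" and Tm: "\<forall>T' \<in> ?T. T \<subseteq> T' \<longrightarrow> T = T'" by (elim bexE conjE)
  have Tmax: "T = T'" if "T' \<in> ?T" "T \<subseteq> T'" for T' using bspec[OF Tm that(1)] that(2) by (rule mp)
  have TV: "T \<subseteq> V" and vT: "v \<in> T" using T by auto
  have TM: "p = 0" if "p \<in> polys T" "p \<in> M" for p using T that by blast
  have TVp: "p \<in> polys V" if "p \<in> polys T" for p :: "('v, 'k) mpoly" using polys_mono[OF that TV] .
  define U where "U = V - T"
  have finU: "finite U" using V by (simp add: U_def)
  have "\<exists>c m g. c \<in> polys T \<and> c \<noteq> 0 \<and> (\<forall>e < m. g e \<in> polys T) \<and> m \<ge> 1 \<and>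
      c * pvar w ^ m + (\<Sum>e < m. g e * pvar w ^ e) \<in> M" if w: "w \<in> U" for w
  proof -
    have "insert w T \<notin> ?T" using Tmax[of "insert w T"] w unfolding U_def by blast
    moreover have "insert w T \<subseteq> V" using w TV by (auto simp: U_def)
    ultimately obtain f where f: "f \<in> polys (insert w T)" "f \<in> M" "f \<noteq> 0" using vT by blast
    obtain c m g where *: "c \<in> polys T" "c \<noteq> 0" "\<forall>e < m. g e \<in> polys T"
      "f = c * pvar w ^ m + (\<Sum>e < m. g e * pvar w ^ e)"
      using var_expand[OF _ f(1,3)] w unfolding U_def by blast
    have "m \<ge> 1"
    proof (rule ccontr)
      assume "\<not> m \<ge> 1"
      then have "m = 0" by simp
      then have "f = c" using *(4) by simp
      then show False using TM[of c] * f by simp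
    qed
    then show ?thesis using * f by blast
  qed
  then have "\<forall>w \<in> U. \<exists>c m g. c \<in> polys T \<and> c \<noteq> 0 \<and> (\<forall>e < m. g e \<in> polys T) \<and> m \<ge> 1 \<and>
      c * pvar w ^ m + (\<Sum>e < m. g e * pvar w ^ e) \<in> M" by (rule ballI)
  then obtain c mm g where cmg: "\<forall>w \<in> U. c w \<in> polys T \<and> c w \<noteq> 0 \<and> (\<forall>e < mm w. g w e \<in> polys T) \<and>
      mm w \<ge> 1 \<and> c w * pvar w ^ mm w + (\<Sum>e < mm w. g w e * pvar w ^ e) \<in> M"
    unfolding bchoice_iff by (elim exE)
  have c: "c w \<in> polys T" "c w \<notin> M" and g: "\<And>e. e < mm w \<Longrightarrow> g w e \<in> polys T" and mm: "0 < mm w"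
    and R: "c w * pvar w ^ mm w + (\<Sum>e < mm w. g w e * pvar w ^ e) \<in> M" if w: "w \<in> U" for w
    using bspec[OF cmg w] TM[of "c w"] by (auto simp: Suc_le_eq)
  define s where "s = (\<Prod>w \<in> U. c w)"
  have sT: "s \<in> polys T" unfolding s_def by (intro polys_prod c)
  have sM: "s \<notin> M" unfolding s_def
    by (rule prod_notin_primeideal[OF prime]) (use c TVp in blast)
  then have s0: "s \<noteq> 0" using id(2) by auto
  \<comment> \<open>Modulo \<open>M\<close> and up to powers of \<open>s\<close>, the equations for
    the variables of \<open>U\<close> reduce every monomial to one whose exponents are below the
    degrees \<open>mm w\<close>.\<close>
  define X where "X = {a :: 'v \<Rightarrow>\<^sub>0 nat. supp a \<subseteq> U \<and> (\<forall>w \<in> U. coef a w < mm w)}"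
  define W where "W = (xpow ` X :: ('v, 'k) mpoly set)"
  have "X \<subseteq> {a. supp a \<subseteq> U \<and> (\<forall>w. coef a w \<le> sum mm U)}"
  proof
    fix a assume a: "a \<in> X"
    have "coef a w \<le> sum mm U" for w
    proof (cases "w \<in> U")
      case True
      then have "coef a w < mm w" "mm w \<le> sum mm U" using a finU by (auto simp: X_def intro: member_le_sum)
      then show ?thesis by simp
    next
      case False
      then have "w \<notin> supp a" using a by (auto simp: X_def)
      then show ?thesis by (simp add: in_keys_iff)
    qed
    then show "a \<in> {a. supp a \<subseteq> U \<and> (\<forall>w. coef a w \<le> sum mm U)}" using a by (simp add: X_def)
  qed
  then have "finite X" using bounded_exponents(1)[OF finU] finite_subset by blast
  then have finW: "finite W" by (simp add: W_def)
  have WV: "W \<subseteq> polys V" unfolding W_def X_def U_def by auto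
  have oneW: "1 \<in> W" unfolding W_def X_def using mm by (intro image_eqI[of _ _ 0]) simp_all
  define S where "S = span_mod (polys T) W M"
  note Scl = span_mod_closed[OF M TV finW, folded S_def]
  note Ssum = span_mod_sum[OF M TV finW, folded S_def]
  have Sdiff: "p - q \<in> S" if "p \<in> S" "q \<in> S" for p q
  proof -
    have "p + (-1) * q \<in> S" by (intro Scl(3) Scl(4) that) simp
    then show ?thesis by simp
  qed
  have lift: "q * p \<in> S" if q: "q \<in> polys V" "\<And>y. y \<in> W \<Longrightarrow> q * y \<in> S" and p: "p \<in> S" for q p
  proof -
    obtain b where b: "\<forall>y \<in> W. b y \<in> polys T" "p - (\<Sum>y \<in> W. b y * y) \<in> M"
      using p unfolding S_def span_mod_def by blast
    have "q * p = q * (p - (\<Sum>y \<in> W. b y * y)) + (\<Sum>y \<in> W. b y * (q * y))"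
      by (simp add: algebra_simps sum_distrib_left)
    moreover have "\<dots> \<in> S"
      by (rule Scl(3)[OF Scl(1)[OF id(6)[OF q(1) b(2)]] Ssum[OF Scl(4)]]) (use q b in auto)
    ultimately show ?thesis by simp
  qed
  \<comment> \<open>A variable of \<open>T\<close> is a scalar, and one of \<open>U\<close> raises
    an exponent. When the exponent reaches the degree \<open>mm w\<close>, the equation
    \<open>R\<close>, multiplied by the other factors of \<open>s\<close>, reduces it again.\<close>
  have var: "s * pvar w * p \<in> S" if w: "w \<in> V" and p: "p \<in> S" for w p
  proof (rule lift[OF _ _ p])
    show "s * pvar w \<in> polys V" using sT TVp w by auto
    fix y assume y: "y \<in> W"
    show "s * pvar w * y \<in> S"
    proof (cases "w \<in> T")
      case True
      then show ?thesis using sT y by (intro Scl(4) Scl(2)) auto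
    next
      case False
      then have wU: "w \<in> U" using w by (simp add: U_def)
      obtain a where a: "y = xpow a" "a \<in> X" using y by (auto simp: W_def)
      have pw: "pvar w ^ n = (xpow (Poly_Mapping.single w n) :: ('v, 'k) mpoly)" for n :: nat
        by (induction n) (auto simp: pvar_def xpow_add[symmetric] single_add[symmetric])
      show ?thesis
      proof (cases "Suc (coef a w) < mm w")
        case True
        have "Poly_Mapping.single w 1 + a \<in> X"
          using a(2) wU True by (auto simp: X_def lookup_add lookup_single when_def supp_add_nat)
        then have "xpow (Poly_Mapping.single w 1 + a) \<in> W" by (auto simp: W_def)
        then have "s * xpow (Poly_Mapping.single w 1 + a) \<in> S" by (intro Scl(4) Scl(2) sT)
        then show ?thesis by (simp add: a xpow_add pvar_def mult_ac)
      next
        case False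
        then have k: "Suc (coef a w) = mm w" using a(2) wU by (auto simp: X_def)
        define a0 where "a0 = a - Poly_Mapping.single w (coef a w)"
        have "mdvd (Poly_Mapping.single w (coef a w)) a" by (auto simp: mdvd_def lookup_single when_def)
        then have a0: "Poly_Mapping.single w (coef a w) + a0 = a" unfolding a0_def by (rule mdvd_diff)
        have inW: "xpow a0 * pvar w ^ e \<in> W" if "e < mm w" for e
        proof -
          have "a0 + Poly_Mapping.single w e \<in> X"
            using a(2) wU that unfolding X_def a0_def
            by (auto simp: lookup_add lookup_minus lookup_single when_def supp_add_nat in_keys_iff)
          then show ?thesis unfolding W_def pw xpow_add[symmetric] by auto
        qed
        define s' where "s' = (\<Prod>w \<in> U - {w}. c w)"
        have s': "s = s' * c w" "s' \<in> polys T"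
          unfolding s_def s'_def using wU finU by (auto simp: prod.remove mult.commute intro!: polys_prod c)
        have "pvar w * y = xpow a0 * pvar w ^ mm w"
          unfolding a(1) k[symmetric] by (subst a0[symmetric]) (simp add: xpow_add pw[symmetric] mult_ac)
        then have "s * pvar w * y = s' * xpow a0 * (c w * pvar w ^ mm w + (\<Sum>e < mm w. g w e * pvar w ^ e))
            - (\<Sum>e < mm w. (s' * g w e) * (xpow a0 * pvar w ^ e))"
          by (simp add: s'(1) algebra_simps sum_distrib_left)
        moreover have "\<dots> \<in> S"
        proof (rule Sdiff[OF Scl(1)[OF id(6)[OF _ R[OF wU]]] Ssum[OF Scl(4)[OF _ Scl(2)[OF inW]]]])
          have "supp a0 \<subseteq> supp a" unfolding a0_def by (auto simp: in_keys_iff lookup_minus)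
          also have "supp a \<subseteq> V" using a(2) by (auto simp: X_def U_def)
          finally show "s' * xpow a0 \<in> polys V" using s'(2) TVp by auto
          fix e assume "e \<in> {..<mm w}"
          then show "s' * g w e \<in> polys T" "e < mm w" using s'(2) g[OF wU] by auto
        qed
        ultimately show ?thesis by simp
      qed
    qed
  qed
  \<comment> \<open>The power of \<open>s\<close> depends on the polynomial only, not on the element
    of \<open>S\<close> it acts on; for sums and products the powers just add up.\<close>
  have pow: "\<exists>N. \<forall>p \<in> S. s ^ N * f * p \<in> S" if "f \<in> polys V" for f
    using that
  proof (induction f rule: polys_induct)
    case (const c)
    show ?case by (intro exI[of _ 0] ballI) (auto intro!: Scl(4))
  next
    case (var w)
    then show ?case using \<open>\<And>w p. w \<in> V \<Longrightarrow> p \<in> S \<Longrightarrow> s * pvar w * p \<in> S\<close> by (intro exI[of _ 1]) auto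
  next
    case (add f h)
    then obtain N N' where N: "\<And>p. p \<in> S \<Longrightarrow> s ^ N * f * p \<in> S" "\<And>p. p \<in> S \<Longrightarrow> s ^ N' * h * p \<in> S"
      by blast
    have "s ^ (N + N') * (f + h) * p \<in> S" if p: "p \<in> S" for p
    proof -
      have "s ^ N' * (s ^ N * f * p) + s ^ N * (s ^ N' * h * p) \<in> S"
        by (rule Scl(3)[OF Scl(4)[OF polys_power[OF sT] N(1)[OF p]] Scl(4)[OF polys_power[OF sT] N(2)[OF p]]])
      then show ?thesis by (simp add: power_add algebra_simps)
    qed
    then show ?case by blast
  next
    case (mult f h)
    then obtain N N' where N: "\<And>p. p \<in> S \<Longrightarrow> s ^ N * f * p \<in> S" "\<And>p. p \<in> S \<Longrightarrow> s ^ N' * h * p \<in> S"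
      by blast
    have "s ^ (N + N') * (f * h) * p \<in> S" if p: "p \<in> S" for p
    proof -
      have "s ^ N * f * (s ^ N' * h * p) \<in> S" by (intro N p)
      then show ?thesis by (simp add: power_add algebra_simps)
    qed
    then show ?case by blast
  qed
  \<comment> \<open>\<open>q\<close> has constant coefficient 1 and lies in \<open>polys T\<close>,
    so it is outside \<open>M\<close> and has an inverse \<open>h\<close> modulo
    \<open>M\<close>.\<close>
  define q where "q = 1 + pvar v * s"
  have qT: "q \<in> polys T" unfolding q_def using vT sT by auto
  have "coef (pvar v * s) 0 = 0"
    unfolding pvar_def xpow_def
    by (rule coef_monom_mult_0) (use mdvd_supp[of "Poly_Mapping.single v (1::nat)" 0] in auto)
  then have "coef q 0 = 1" by (simp add: q_def lookup_add)
  then have "q \<noteq> 0" by auto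
  then have "q \<notin> M" using TM qT by blast
  then obtain h where h: "h \<in> polys V" "q * h - 1 \<in> M"
    using maximalideal_poly_inverse[OF max TVp[OF qT]] by blast
  obtain N where N: "\<And>p. p \<in> S \<Longrightarrow> s ^ N * h * p \<in> S" using pow[OF h(1)] by blast
  let ?U = "{u. \<exists>N b. b \<in> polys T \<and> u = s ^ N + q * b}"
  have "\<exists>u \<in> ?U. \<forall>x \<in> W. u * x \<in> M"
  proof (rule Nakayama_elimination[OF M TV finW WV qT])
    show "?U \<subseteq> polys T" using sT qT by auto
    show "1 \<in> ?U" by (intro CollectI exI[of _ "0::nat"] exI[of _ 0]) auto
    show "u * u' \<in> ?U" if u: "u \<in> ?U" and u': "u' \<in> ?U" for u u'
    proof -
      obtain n b where *: "b \<in> polys T" "u = s ^ n + q * b" using u by blast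
      obtain n' b' where **: "b' \<in> polys T" "u' = s ^ n' + q * b'" using u' by blast
      have "u * u' = s ^ (n + n') + q * (b * s ^ n' + s ^ n * b' + q * b * b')"
        unfolding * ** by (simp add: algebra_simps power_add)
      moreover have "b * s ^ n' + s ^ n * b' + q * b * b' \<in> polys T" using * ** sT qT by auto
      ultimately show ?thesis by blast
    qed
    show "u - q * b \<in> ?U" if u: "u \<in> ?U" and b: "b \<in> polys T" for u b
    proof -
      obtain n b' where *: "b' \<in> polys T" "u = s ^ n + q * b'" using u by blast
      have "u - q * b = s ^ n + q * (b' - b)" unfolding * by (simp add: algebra_simps)
      moreover have "b' - b \<in> polys T" using * b by auto
      ultimately show ?thesis by blast
    qed
    fix x assume x: "x \<in> W"
    then have "s ^ N * h * x \<in> S" by (intro N Scl(2))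
    then obtain b where b: "\<forall>y \<in> W. b y \<in> polys T" "s ^ N * h * x - (\<Sum>y \<in> W. b y * y) \<in> M"
      unfolding S_def span_mod_def by blast
    have "s ^ N * x - q * (\<Sum>y \<in> W. b y * y) =
        q * (s ^ N * h * x - (\<Sum>y \<in> W. b y * y)) - (s ^ N * x) * (q * h - 1)"
      by (simp add: algebra_simps)
    moreover have "\<dots> \<in> M"
      by (rule id(5)[OF id(6)[OF _ b(2)] id(6)[OF _ h(2)]]) (use qT sT TVp WV x in auto)
    moreover have "s ^ N \<in> ?U" by (intro CollectI exI[of _ N] exI[of _ 0]) auto
    ultimately show "\<exists>u \<in> ?U. \<exists>b. (\<forall>y \<in> W. b y \<in> polys T) \<and> u * x - q * (\<Sum>y \<in> W. b y * y) \<in> M"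
      using b(1) by (intro bexI[of _ "s ^ N"] exI[of _ b] conjI) simp_all
  qed
  \<comment> \<open>Since 1 is in \<open>W\<close>, an element of \<open>?U\<close> itself lies in
    \<open>M\<close>, and it is 0 because \<open>M\<close> contains no other element of
    \<open>polys T\<close>.\<close>
  then obtain n b where b: "b \<in> polys T" "(s ^ n + q * b) * 1 \<in> M" using oneW by blast
  then have "s ^ n + q * b = 0" using sT qT by (intro TM) auto
  \<comment> \<open>Multiplying by the power of \<open>v\<close> turns \<open>s\<close> into
    \<open>pvar v * s = q - 1\<close>, whose powers are congruent to powers of -1 modulo
    \<open>q\<close>; so \<open>q\<close> divides a unit, against
    \<open>not_unit_one_plus\<close>.\<close>
  then have *: "(pvar v * s) ^ n + q * (b * pvar v ^ n) = 0"
  proof -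
    have "(pvar v * s) ^ n + q * (b * pvar v ^ n) = pvar v ^ n * (s ^ n + q * b)"
      by (simp add: power_mult_distrib algebra_simps)
    then show ?thesis using \<open>s ^ n + q * b = 0\<close> by simp
  qed
  have "\<exists>e. (pvar v * s) ^ n = (- 1) ^ n + q * e"
  proof (induction n)
    case 0
    show ?case by (intro exI[of _ 0]) simp
  next
    case (Suc n)
    then obtain e where e: "(pvar v * s) ^ n = (- 1) ^ n + q * e" by blast
    have "(pvar v * s) ^ Suc n = (q - 1) * ((- 1) ^ n + q * e)" by (simp add: e q_def)
    also have "\<dots> = (- 1) ^ Suc n + q * ((- 1) ^ n + (q - 1) * e)" by (simp add: algebra_simps)
    finally show ?case by blast
  qed
  then obtain e where e: "(pvar v * s) ^ n = (- 1) ^ n + q * e" by blast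
  have "q * (- ((- 1) ^ n) * (e + b * pvar v ^ n)) =
      (- 1) ^ n * (- 1) ^ n - (- 1) ^ n * ((pvar v * s) ^ n + q * (b * pvar v ^ n))"
    unfolding e by (simp add: algebra_simps)
  also have "\<dots> = 1" unfolding * by (simp add: power_mult_distrib[symmetric])
  finally show False using not_unit_one_plus[OF s0] unfolding q_def by blast
qed


section \<open>Whiskered graphs are Cohen-Macaulay\<close>

lemma polyideal_closed:
  assumes "B \<subseteq> polys V"
  shows "polyideal V B \<subseteq> polys V" "0 \<in> polyideal V B" "b \<in> B \<Longrightarrow> b \<in> polyideal V B"
    "p \<in> polyideal V B \<Longrightarrow> q \<in> polyideal V B \<Longrightarrow> p + q \<in> polyideal V B"
    "p \<in> polyideal V B \<Longrightarrow> q \<in> polyideal V B \<Longrightarrow> p - q \<in> polyideal V B"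
    "a \<in> polys V \<Longrightarrow> p \<in> polyideal V B \<Longrightarrow> a * p \<in> polyideal V B"
  by (fact ideal_polyD[OF polyideal_ideal[OF assms]] polyideal_mem[OF assms])+

lemma polyideal_mono: "B \<subseteq> C \<Longrightarrow> C \<subseteq> polys V \<Longrightarrow> polyideal V B \<subseteq> polyideal V C"
  by (rule polyideal_least[OF polyideal_ideal]) (auto intro: polyideal_closed)

lemma polyideal_Un:
  assumes "S \<subseteq> polys V" "E \<subseteq> polys V"
  shows "polyideal V (S \<union> polyideal V E) = polyideal V (S \<union> E)"
proof
  have SE: "S \<union> E \<subseteq> polys V" "S \<union> polyideal V E \<subseteq> polys V"
    using assms polyideal_closed(1)[OF assms(2)] by simp_all
  have "polyideal V E \<subseteq> polyideal V (S \<union> E)" by (rule polyideal_mono) (use SE in auto)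
  then show "polyideal V (S \<union> polyideal V E) \<subseteq> polyideal V (S \<union> E)"
    using polyideal_closed(3)[OF SE(1)] by (intro polyideal_least polyideal_ideal SE(1)) auto
  show "polyideal V (S \<union> E) \<subseteq> polyideal V (S \<union> polyideal V E)"
    using polyideal_closed(3)[OF assms(2)] by (intro polyideal_mono SE(2)) auto
qed

text \<open>\<open>\<phi>\<close> is only additive, as \<open>vdiv\<close> is not multiplicative;
  therefore the multiples of the generators, not just the generators, have to be checked.\<close>

lemma polyideal_transfer:
  assumes "f \<in> polyideal V B" "B \<subseteq> polys V" "ideal J (poly_ring V)"
    and "\<phi> 0 = 0" "\<And>p q. \<phi> (p + q) = \<phi> p + \<phi> q"
    and "\<And>a b. a \<in> polys V \<Longrightarrow> b \<in> B \<Longrightarrow> \<phi> (a * b) \<in> J"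
  shows "\<phi> f \<in> J"
  using assms(1,2)
proof (induction rule: polyideal_induct)
  case zero
  then show ?case using assms(4) ideal_polyD(2)[OF assms(3)] by simp
next
  case (step a b q)
  then show ?case unfolding assms(5) by (intro ideal_polyD(3)[OF assms(3)] assms(6))
qed

lemma vzero_polyideal:
  assumes "B \<subseteq> polys V" "\<And>b. b \<in> B \<Longrightarrow> free_of v b" "f \<in> polyideal V B"
  shows "vzero v f \<in> polyideal V B"
  using assms(3,1) polyideal_ideal[OF assms(1)]
proof (rule polyideal_transfer)
  show "vzero v (a * b) \<in> polyideal V B" if "a \<in> polys V" "b \<in> B" for a b
    using that assms(2) by (simp add: vzero_free polyideal_closed[OF assms(1)])
qed auto

lemma vdiv_polyideal:
  assumes "B \<subseteq> polys V" "\<And>b. b \<in> B \<Longrightarrow> free_of v b" "f \<in> polyideal V B"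
  shows "vdiv v f \<in> polyideal V B"
  using assms(3,1) polyideal_ideal[OF assms(1)]
proof (rule polyideal_transfer)
  show "vdiv v (a * b) \<in> polyideal V B" if "a \<in> polys V" "b \<in> B" for a b
    using that assms(2) vdiv_mult_free[of v b a] polyideal_closed(6)[OF assms(1), of "vdiv v a" b]
      polyideal_closed(3)[OF assms(1)] by (simp add: mult.commute)
qed auto

lemma polys_empty: "p \<in> polys {} \<Longrightarrow> p = monom 0 (coef p 0)"
  by (rule poly_mapping_eqI) (auto simp: polys_iff lookup_single when_def in_keys_iff dest: bspec)

text \<open>For \<open>v\<close> in \<open>V\<close> the quotient is a polynomial ring in
  \<open>v\<close>, because the generators do not involve \<open>v\<close>, and a nonzero
  \<open>p\<close> over the field is not a zero divisor in it. Factors \<open>v\<close> of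
  \<open>p\<close> are removed until the constant coefficient is a unit; then the coefficients of
  \<open>r\<close> come off from the lowest one.\<close>

lemma univariate_regular:
  fixes p :: "('v, 'k::field) mpoly"
  assumes B: "B \<subseteq> polys V" "\<And>b. b \<in> B \<Longrightarrow> free_of v b"
    and p: "p \<in> polys {v}" "p \<noteq> 0" and r: "r \<in> polys V" "p * r \<in> polyideal V B"
  shows "r \<in> polyideal V B"
  using p r(2)
proof (induction p rule: vdiv_induct[where v = v])
  case zero
  then show ?case by simp
next
  case (vdiv p)
  note cl = polyideal_closed[OF B(1)]
  have "vzero v p \<in> polys {}" using polys_vzero_Diff[OF vdiv.prems(1), of v] by simp
  then have z: "vzero v p = monom 0 (coef (vzero v p) 0)" by (rule polys_empty)
  let ?c = "coef (vzero v p) 0"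
  show ?case
  proof (cases "?c = 0")
    case True
    then have "vzero v p = 0" using z by simp
    then have eq: "p = pvar v * vdiv v p" using vdiv_decomp[of p v] by simp
    then have "vdiv v p \<noteq> 0" using vdiv.prems(2) by auto
    moreover have "p * r = pvar v * (vdiv v p * r)" by (subst eq) (simp add: mult.assoc)
    then have "vdiv v p * r \<in> polyideal V B" using vdiv_polyideal[OF B vdiv.prems(3)] by simp
    ultimately show ?thesis using vdiv.IH vdiv.prems(1) by simp
  next
    case c: False
    show ?thesis using r(1) vdiv.prems(3)
    proof (induction r rule: vdiv_induct[where v = v])
      case zero
      then show ?case using cl(2) by simp
    next
      case (vdiv r)
      have "vzero v (p * r) \<in> polyideal V B" by (rule vzero_polyideal[OF B vdiv.prems(2)])
      then have "monom 0 ?c * vzero v r \<in> polyideal V B" using z by simp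
      then have "monom 0 (inverse ?c) * (monom 0 ?c * vzero v r) \<in> polyideal V B"
        by (rule cl(6)[rotated]) simp
      then have r0: "vzero v r \<in> polyideal V B"
        using c by (simp add: mult.assoc[symmetric] mult_single)
      \<comment> \<open>\<open>p\<close> may involve variables outside \<open>V\<close> only if \<open>v \<notin> V\<close>, when division by \<open>v\<close> gives zero.\<close>
      show ?case
      proof (cases "v \<in> V")
        case True
        then have pV: "p \<in> polys V" using polys_mono[OF \<open>p \<in> polys {v}\<close>] by simp
        have "p * r - p * vzero v r \<in> polyideal V B" by (intro cl(5) vdiv.prems(2) cl(6) pV r0)
        moreover have "p * r - p * vzero v r = pvar v * (p * vdiv v r)"
          by (simp add: vzero_def algebra_simps)
        ultimately have "vdiv v (pvar v * (p * vdiv v r)) \<in> polyideal V B"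
          using vdiv_polyideal[OF B] by metis
        then have "vdiv v r \<in> polyideal V B" using vdiv.IH polys_vdiv[OF vdiv.prems(1)] by simp
        then have "vzero v r + pvar v * vdiv v r \<in> polyideal V B" using True by (intro cl(4) cl(6) r0) auto
        then show ?thesis using vdiv_decomp[of r v] by simp
      next
        case False
        then have "vzero v r = r" using vzero_free[OF free_of_polys[OF vdiv.prems(1)]] by simp
        then show ?thesis using r0 by simp
      qed
    qed
  qed
qed

text \<open>With \<open>J\<close> the ideal below, \<open>J + (x\<^sub>v)\<close> and \<open>J : x\<^sub>v\<close> are, up to \<open>x\<^sub>v\<close> resp. \<open>x\<^sub>w\<close>, generated by
  polynomials in the other variables, so \<open>q\<close> is regular modulo both and hence modulo \<open>J\<close>.\<close>

lemma whisker_regular: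
  fixes q :: "('v, 'k::field) mpoly"
  assumes vw: "v \<in> V" "w \<in> V" "v \<noteq> w" and B: "B \<subseteq> polys V" and N: "N \<subseteq> polys V"
    and free: "\<And>b. b \<in> B \<union> N \<Longrightarrow> free_of v b \<and> free_of w b"
    and q: "q \<in> polys {v, w}" "vzero v q \<noteq> 0" "vzero w q \<noteq> 0"
    and r: "r \<in> polys V" "q * r \<in> polyideal V (B \<union> insert (pvar v * pvar w) ((*) (pvar v) ` N))"
  shows "r \<in> polyideal V (B \<union> insert (pvar v * pvar w) ((*) (pvar v) ` N))"
proof -
  let ?G = "B \<union> insert (pvar v * pvar w) ((*) (pvar v) ` N)"
  let ?J = "polyideal V ?G"
  have G: "?G \<subseteq> polys V" using B N vw by auto
  note cl = polyideal_closed[OF G]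
  have BN: "B \<union> N \<subseteq> polys V" using B N by simp
  note cl1 = polyideal_closed[OF B] and cl2 = polyideal_closed[OF BN]
  \<comment> \<open>Reduction modulo \<open>pvar v\<close>, which removes every generator outside
    \<open>B\<close>.\<close>
  have a: "vzero v f \<in> polyideal V B" if "f \<in> ?J" for f
    using that G polyideal_ideal[OF B]
  proof (rule polyideal_transfer)
    fix a b :: "('v, 'k) mpoly" assume "a \<in> polys V" "b \<in> ?G"
    then show "vzero v (a * b) \<in> polyideal V B"
      using free cl1 by (auto simp: vzero_free)
  qed auto
  \<comment> \<open>Applied to \<open>pvar v * f\<close> this gives \<open>f\<close> without the
    monomials divisible by \<open>pvar w\<close>: membership in the colon ideal of
    \<open>pvar v\<close>, read modulo \<open>pvar w\<close>.\<close>
  have b: "vdiv v (vzero w f) \<in> polyideal V (B \<union> N)" if "f \<in> ?J" for f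
    using that G polyideal_ideal[OF BN]
  proof (rule polyideal_transfer)
    fix a b :: "('v, 'k) mpoly" assume ab: "a \<in> polys V" "b \<in> ?G"
    have A: "vdiv v (vzero w a) \<in> polys V" "vzero w a \<in> polys V" using ab by simp_all
    from ab(2) consider "b \<in> B" | "b = pvar v * pvar w" | n where "n \<in> N" "b = pvar v * n" by blast
    then show "vdiv v (vzero w (a * b)) \<in> polyideal V (B \<union> N)"
    proof cases
      case 1
      then have "vdiv v (vzero w (a * b)) = vdiv v (vzero w a) * b"
        using free vdiv_mult_free[of v b "vzero w a"] by (simp add: vzero_free mult.commute)
      then show ?thesis using 1 A cl2 by simp
    next
      case 2
      then show ?thesis using cl2 by simp
    next
      case 3
      then have "vzero w (a * b) = pvar v * (vzero w a * n)"
        using free vw by (simp add: vzero_free mult_ac)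
      then show ?thesis using 3 A cl2 by simp
    qed
  qed auto
  have qw: "vzero v q \<in> polys {w}" "vzero w q \<in> polys {v}"
    using polys_vzero_Diff[OF q(1), of v] polys_vzero_Diff[OF q(1), of w] vw
    by (auto elim: polys_mono)
  have BJ: "polyideal V B \<subseteq> ?J" by (rule polyideal_mono[OF _ G]) auto
  \<comment> \<open>With \<open>v\<close> set to zero, \<open>q\<close> is a nonzero polynomial in
    \<open>w\<close> alone, a variable that \<open>B\<close> avoids.\<close>
  have r0: "vzero v r \<in> polyideal V B"
  proof (rule univariate_regular[OF B _ qw(1) q(2)])
    show "vzero v q * vzero v r \<in> polyideal V B" using a[OF r(2)] by simp
  qed (use free r in auto)
  define r' where "r' = vdiv v r"
  have r'V: "r' \<in> polys V" using r by (simp add: r'_def)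
  have eq: "r = vzero v r + pvar v * r'" unfolding r'_def by (rule vdiv_decomp)
  have qV: "q \<in> polys V" by (rule polys_mono[OF q(1)]) (use vw in auto)
  have "q * r - q * vzero v r \<in> ?J" by (rule cl(5)[OF r(2) cl(6)[OF qV]]) (use r0 BJ in auto)
  moreover have "q * r - q * vzero v r = pvar v * (q * r')"
    using eq by (simp add: algebra_simps) (metis distrib_left mult.left_commute)
  ultimately have "vdiv v (vzero w (pvar v * (q * r'))) \<in> polyideal V (B \<union> N)" using b by metis
  moreover have "vzero w (pvar v * (q * r')) = pvar v * (vzero w q * vzero w r')"
    using vw by (simp add: vzero_free)
  ultimately have "vzero w q * vzero w r' \<in> polyideal V (B \<union> N)" by simp
  then have r1: "vzero w r' \<in> polyideal V (B \<union> N)"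
    by (rule univariate_regular[OF BN _ qw(2) q(3), rotated 2]) (use free r'V in auto)
  \<comment> \<open>Conversely \<open>pvar v\<close> carries \<open>B \<union> N\<close> into
    \<open>?J\<close>; the rest of \<open>r'\<close> is a multiple of \<open>pvar w\<close> and is
    absorbed by the whisker generator.\<close>
  have "pvar v * f \<in> ?J" if "f \<in> polyideal V (B \<union> N)" for f
    using that BN polyideal_ideal[OF G]
  proof (rule polyideal_transfer)
    fix a b :: "('v, 'k) mpoly" assume ab: "a \<in> polys V" "b \<in> B \<union> N"
    have "a * (pvar v * b) \<in> ?J"
    proof (cases "b \<in> B")
      case True
      then show ?thesis using ab vw cl by simp
    next
      case False
      then have "pvar v * b \<in> ?J" using ab by (intro cl(3)) auto
      then show ?thesis using ab cl(6) by simp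
    qed
    then show "pvar v * (a * b) \<in> ?J" by (simp add: mult.left_commute)
  qed (auto simp: distrib_left)
  then have "pvar v * vzero w r' \<in> ?J" using r1 by blast
  moreover have "vdiv w r' * (pvar v * pvar w) \<in> ?J" using r'V by (intro cl(6)[OF _ cl(3)]) auto
  moreover have "pvar v * r' = pvar v * vzero w r' + vdiv w r' * (pvar v * pvar w)"
    by (simp add: vzero_def algebra_simps)
  ultimately have "pvar v * r' \<in> ?J" using cl(4) by simp
  with subsetD[OF BJ r0] have "vzero v r + pvar v * r' \<in> ?J" by (rule cl(4))
  then show ?thesis using eq by (rule ssubst[rotated])
qed

text \<open>Each \<open>q u\<close> involves only the two ends of one whisker, so regularity is
  settled one whisker at a time, and the edges of \<open>H\<close> enter only through the sets
  \<open>B\<close> and \<open>N\<close> of \<open>whisker_regular\<close>.\<close>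

theorem whiskered_Cohen_Macaulay:
  fixes G :: "'v::linorder graph"
  assumes "whiskered_graph G"
  shows "Cohen_Macaulay_graph TYPE('k::field) G"
proof -
  obtain H w where H: "simple_graph H" "inj_on w (vset H)" "w ` vset H \<inter> vset H = {}"
    and VG: "vset G = vset H \<union> w ` vset H" and EG: "eset G = eset H \<union> (\<lambda>v. {v, w v}) ` vset H"
    using assms unfolding whiskered_graph_def by (elim exE conjE)
  define V where "V = vset G"
  have finH: "finite (vset H)" using H(1) by (simp add: simple_graph_def)
  have finV: "finite V" using finH by (simp add: V_def VG)
  have HV: "u \<in> V" "w u \<in> V" if "u \<in> vset H" for u using that by (auto simp: V_def VG)
  define E where "E = {pvar a * pvar b :: ('v, 'k) mpoly | a b. {a, b} \<in> eset H}"
  define Wh where "Wh = (\<lambda>u. pvar u * pvar (w u) :: ('v, 'k) mpoly) ` vset H"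
  have edgeH: "a \<in> vset H" "b \<in> vset H" "a \<noteq> b" if "{a, b} \<in> eset H" for a b
  proof -
    have "{a, b} \<subseteq> vset H" "card {a, b} = 2" using that H(1) unfolding simple_graph_def by blast+
    then show "a \<in> vset H" "b \<in> vset H" "a \<noteq> b" by auto
  qed
  have gens: "{pvar a * pvar b :: ('v, 'k) mpoly | a b. {a, b} \<in> eset G} = E \<union> Wh"
    unfolding E_def Wh_def EG by (auto simp: doubleton_eq_iff mult.commute)
  have EV: "E \<union> Wh \<subseteq> polys V"
    using HV edgeH by (auto simp: E_def Wh_def)
  define I :: "('v, 'k) mpoly set" where "I = edge_ideal G"
  have I: "I = polyideal V (E \<union> Wh)" unfolding I_def edge_ideal_def gens V_def ..
  have Iid: "ideal I (poly_ring V)" unfolding I by (rule polyideal_ideal[OF EV])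
  have EI: "E \<union> Wh \<subseteq> I" unfolding I using polyideal_mem[OF EV] by blast
  have "Cohen_Macaulay_ring (poly_ring V Quot I)"
  proof (rule poly_ring.Cohen_Macaulay_quotI[OF noetherian_poly_ring[OF finV] Iid, where n = "card (vset H)"])
    fix M :: "('v, 'k) mpoly set" assume M: "maximalideal M (poly_ring V)" and IM: "I \<subseteq> M"
    have prime: "primeideal M (poly_ring V)" by (rule poly_ring.maximalideal_prime[OF M])
    note Mid = ideal_polyD[OF primeideal_polyD(1)[OF prime]]
    have "\<forall>u \<in> vset H. \<exists>f h. f \<in> polys {u} \<and> f \<noteq> 0 \<and> f \<in> M \<and> h \<in> polys {w u} \<and> h \<noteq> 0 \<and> h \<in> M"
      using maximalideal_algebraic[OF finV M HV(1)] maximalideal_algebraic[OF finV M HV(2)] by blast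
    then obtain f h where "\<forall>u \<in> vset H. f u \<in> polys {u} \<and> f u \<noteq> 0 \<and> f u \<in> M \<and>
        h u \<in> polys {w u} \<and> h u \<noteq> 0 \<and> h u \<in> M"
      unfolding bchoice_iff by (elim exE)
    then have f: "f u \<in> polys {u}" "f u \<noteq> 0" "f u \<in> M" and h: "h u \<in> polys {w u}" "h u \<noteq> 0" "h u \<in> M"
      if "u \<in> vset H" for u using that by auto
    define q where "q u = f u + h u" for u
    have uw: "u \<noteq> w u'" if "u \<in> vset H" "u' \<in> vset H" for u u' using that H(3) by auto
    have q1: "q u \<in> polys {u, w u}" and qM: "q u \<in> M" if u: "u \<in> vset H" for u
      unfolding q_def using polys_mono[OF f(1)[OF u], of "{u, w u}"] polys_mono[OF h(1)[OF u], of "{u, w u}"]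
        Mid(3)[OF f(3)[OF u] h(3)[OF u]] by auto
    \<comment> \<open>Deleting the only variable of \<open>p\<close> leaves a constant; if it
      cancelled \<open>p'\<close>, a nonzero constant would lie in \<open>M\<close>.\<close>
    have nonconst: "vzero a p + p' \<noteq> 0" if "p \<in> polys {a}" "p' \<noteq> 0" "p' \<in> M" for a and p p' :: "('v, 'k) mpoly"
    proof
      assume s: "vzero a p + p' = 0"
      have "vzero a p \<in> polys {}" using polys_vzero_Diff[OF that(1), of a] by simp
      then have "vzero a p = monom 0 (coef (vzero a p) 0)" by (rule polys_empty)
      moreover have "p' = - vzero a p" using s by (simp add: eq_neg_iff_add_eq_0 add.commute)
      ultimately have "p' = monom 0 (- coef (vzero a p) 0)" by (metis single_uminus)
      then show False using primeideal_polyD(5)[OF prime, of "- coef (vzero a p) 0"] that by fastforce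
    qed
    have q2: "vzero u (q u) \<noteq> 0" and q3: "vzero (w u) (q u) \<noteq> 0" if u: "u \<in> vset H" for u
    proof -
      have "vzero u (h u) = h u" "vzero (w u) (f u) = f u"
        using uw[OF u u] h(1)[OF u] f(1)[OF u] by (auto intro!: vzero_free free_of_polys)
      then show "vzero u (q u) \<noteq> 0" "vzero (w u) (q u) \<noteq> 0"
        unfolding q_def using nonconst[OF f(1)[OF u] h(2,3)[OF u]] nonconst[OF h(1)[OF u] f(2,3)[OF u]]
        by (simp_all add: add.commute)
    qed
    define us where "us = sorted_list_of_set (vset H)"
    have us: "set us = vset H" "distinct us" "length us = card (vset H)"
      using finH by (simp_all add: us_def)
    show "\<exists>xs. set xs \<subseteq> M \<and> length xs = card (vset H) \<and> (\<forall>i<card (vset H). \<forall>r\<in>polys V.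
        xs ! i \<otimes>\<^bsub>poly_ring V\<^esub> r \<in> polyideal V (set (take i xs) \<union> I) \<longrightarrow> r \<in> polyideal V (set (take i xs) \<union> I))"
    proof (intro exI[of _ "map q us"] conjI allI impI ballI)
      show "set (map q us) \<subseteq> M" using qM us by auto
      show "length (map q us) = card (vset H)" using us by simp
      fix i r assume i: "i < card (vset H)" and r: "r \<in> polys V"
        and qr: "map q us ! i \<otimes>\<^bsub>poly_ring V\<^esub> r \<in> polyideal V (set (take i (map q us)) \<union> I)"
      define u where "u = us ! i"
      have u: "u \<in> vset H" using i us nth_mem[of i us] by (simp add: u_def)
      have S: "set (take i (map q us)) = q ` set (take i us)" by (simp add: take_map)
      have utake: "u \<notin> set (take i us)"
      proof
        assume "u \<in> set (take i us)"
        then obtain j where "j < i" "us ! j = us ! i" using i us(3) by (auto simp: in_set_conv_nth u_def)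
        then show False using nth_eq_iff_index_eq[OF us(2), of j i] i us(3) by simp
      qed
      have takeH: "set (take i us) \<subseteq> vset H" using set_take_subset[of i us] us by simp
      have qV: "q ` set (take i us) \<subseteq> polys V"
        using takeH q1 HV by (auto intro!: polys_mono[OF q1])
      \<comment> \<open>The generators without the ends of the whisker at \<open>u\<close>, among
        them the earlier values of \<open>q\<close>; the edges of \<open>H\<close> at
        \<open>u\<close> contribute \<open>pvar u\<close> times the neighbours in
        \<open>N\<close>.\<close>
      define B where "B = q ` set (take i us) \<union> (\<lambda>u. pvar u * pvar (w u)) ` (vset H - {u}) \<union>
        {pvar a * pvar b | a b. {a, b} \<in> eset H \<and> a \<noteq> u \<and> b \<noteq> u}"
      define N where "N = (pvar ` {a. {u, a} \<in> eset H} :: ('v, 'k) mpoly set)"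
      have gen: "q ` set (take i us) \<union> (E \<union> Wh) = B \<union> insert (pvar u * pvar (w u)) ((*) (pvar u) ` N)"
      proof -
        have "E = {pvar a * pvar b | a b. {a, b} \<in> eset H \<and> a \<noteq> u \<and> b \<noteq> u} \<union> (*) (pvar u) ` N"
          (is "_ = ?L \<union> _")
        proof
          show "E \<subseteq> ?L \<union> (*) (pvar u) ` N"
          proof
            fix x assume "x \<in> E"
            then obtain a b where ab: "x = pvar a * pvar b" "{a, b} \<in> eset H" unfolding E_def by blast
            consider "a \<noteq> u" "b \<noteq> u" | "a = u" | "b = u" by blast
            then show "x \<in> ?L \<union> (*) (pvar u) ` N"
            proof cases
              case 1
              then show ?thesis using ab by blast
            next
              case 2
              then show ?thesis using ab unfolding N_def by blast
            next
              case 3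
              then have "x = pvar u * pvar a" "{u, a} \<in> eset H"
                using ab by (simp_all add: mult.commute insert_commute)
              then show ?thesis unfolding N_def by blast
            qed
          qed
          show "?L \<union> (*) (pvar u) ` N \<subseteq> E" unfolding E_def N_def by blast
        qed
        moreover have "Wh = insert (pvar u * pvar (w u)) ((\<lambda>u. pvar u * pvar (w u)) ` (vset H - {u}))"
          unfolding Wh_def using u by auto
        ultimately show ?thesis unfolding B_def by blast
      qed
      have ideq: "polyideal V (set (take i (map q us)) \<union> I) = polyideal V (B \<union> insert (pvar u * pvar (w u)) ((*) (pvar u) ` N))"
        unfolding S I polyideal_Un[OF qV EV] gen ..
      have BN: "B \<union> N \<subseteq> polys V"
      proof -
        have "B \<subseteq> q ` set (take i us) \<union> (E \<union> Wh)" unfolding gen by (rule Un_upper1)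
        also have "\<dots> \<subseteq> polys V" using qV EV by (rule Un_least)
        finally have "B \<subseteq> polys V" .
        moreover have "N \<subseteq> polys V" using edgeH(2) HV(1) by (auto simp: N_def)
        ultimately show ?thesis by (rule Un_least)
      qed
      show "r \<in> polyideal V (set (take i (map q us)) \<union> I)"
        unfolding ideq
      proof (rule whisker_regular[OF HV[OF u] uw[OF u u] _ _ _ q1[OF u] q2[OF u] q3[OF u] r])
        show "B \<subseteq> polys V" "N \<subseteq> polys V" using BN by auto
        show "q u * r \<in> polyideal V (B \<union> insert (pvar u * pvar (w u)) ((*) (pvar u) ` N))"
          using qr i us(3) unfolding ideq by (simp add: u_def)
        fix b assume b: "b \<in> B \<union> N"
        have fq: "free_of u (q u') \<and> free_of (w u) (q u')" if "u' \<in> vset H" "u' \<noteq> u" for u'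
          using that u uw[of u u'] uw[of u' u] inj_onD[OF H(2), of u u'] by (auto intro!: free_of_polys[OF q1])
        from b consider (q) u' where "u' \<in> set (take i us)" "b = q u'"
          | (wh) u' where "u' \<in> vset H - {u}" "b = pvar u' * pvar (w u')"
          | (edge) a c where "{a, c} \<in> eset H" "a \<noteq> u" "c \<noteq> u" "b = pvar a * pvar c"
          | (nb) a where "{u, a} \<in> eset H" "b = pvar a"
          unfolding B_def N_def by blast
        then show "free_of u b \<and> free_of (w u) b"
        proof cases
          case q
          then have "u' \<in> vset H" "u' \<noteq> u" using utake takeH by auto
          then show ?thesis using fq q by blast
        next
          case wh
          have "w u \<noteq> w u'" "u \<noteq> w u'" "w u \<noteq> u'" "u \<noteq> u'"
            using wh(1) u uw[of u u'] uw[of u' u] inj_onD[OF H(2), of u u'] by auto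
          then show ?thesis using wh(2) by simp
        next
          case edge
          have "w u \<noteq> a" "w u \<noteq> c" using uw[OF edgeH(1)[OF edge(1)] u] uw[OF edgeH(2)[OF edge(1)] u] by auto
          then show ?thesis using edge by simp
        next
          case nb
          have "w u \<noteq> a" "u \<noteq> a" using uw[OF edgeH(2)[OF nb(1)] u] edgeH(3)[OF nb(1)] by auto
          then show ?thesis using nb by simp
        qed
      qed
    qed
  next
    fix m and p :: "nat \<Rightarrow> ('v, 'k) mpoly set"
    assume p: "\<forall>i\<le>m. primeideal (p i) (poly_ring V)" "\<forall>i<m. p i \<subset> p (Suc i)" "I \<subseteq> p 0"
    \<comment> \<open>The product over a whisker lies in \<open>p 0\<close>, hence so does one of
      its ends; \<open>z u\<close> is the other end, so that every variable not chosen lies in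
      \<open>p 0\<close>.\<close>
    define z where "z u = (if pvar u \<in> p 0 then w u else u)" for u
    have p0: "primeideal (p 0) (poly_ring V)" using p(1) by blast
    have "m \<le> card (z ` vset H)"
    proof (rule prime_chain_length[of m p V])
      show "finite (z ` vset H)" using finH by simp
      show "z ` vset H \<subseteq> V" using HV by (auto simp: z_def)
      fix v assume v: "v \<in> V - z ` vset H"
      then consider "v \<in> vset H" | u where "u \<in> vset H" "v = w u" by (auto simp: V_def VG)
      then show "pvar v \<in> p 0"
      proof cases
        case 1
        then have "z v \<noteq> v" using v by (metis DiffE imageI)
        then show ?thesis by (auto simp: z_def split: if_splits)
      next
        case 2
        then have "z u \<noteq> w u" using v by (metis DiffE imageI)
        then have n: "pvar u \<notin> p 0" by (auto simp: z_def)
        have "pvar u * pvar (w u) \<in> p 0" using 2 EI p(3) unfolding Wh_def by blast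
        then show ?thesis using primeideal_polyD(3)[OF p0, of "pvar u" "pvar (w u)"] n HV[OF 2(1)] 2(2)
          by auto
      qed
    qed (use p in auto)
    also have "\<dots> \<le> card (vset H)" by (rule card_image_le[OF finH])
    finally show "m \<le> card (vset H)" .
  qed
  then show ?thesis unfolding Cohen_Macaulay_graph_def V_def I_def .
qed


section \<open>Uniqueness of the shifts of a minimal free resolution\<close>

definition pmat :: "'v set \<Rightarrow> nat \<Rightarrow> nat \<Rightarrow> ('v, 'k::field) mpoly mat \<Rightarrow> bool" where
  "pmat V nr nc A \<longleftrightarrow> A \<in> carrier_mat nr nc \<and> (\<forall>i < nr. \<forall>j < nc. A $$ (i, j) \<in> polys V)"

definition homogeneous_mat ::
  "(('v \<Rightarrow>\<^sub>0 nat) \<Rightarrow> 'g::comm_monoid_add) \<Rightarrow> 'g list \<Rightarrow> 'g list \<Rightarrow> ('v, 'k::field) mpoly mat \<Rightarrow> bool" where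
  "homogeneous_mat gr T G A \<longleftrightarrow>
     (\<forall>i < length T. \<forall>j < length G. \<forall>m \<in> supp (A $$ (i, j)). gr m + T ! i = G ! j)"

lemma pmatD: "pmat V nr nc A \<Longrightarrow> A \<in> carrier_mat nr nc"
  "pmat V nr nc A \<Longrightarrow> i < nr \<Longrightarrow> j < nc \<Longrightarrow> A $$ (i, j) \<in> polys V"
  by (auto simp: pmat_def)

lemma pmat_iff_elements:
  "A \<in> carrier_mat nr nc \<Longrightarrow> pmat V nr nc A \<longleftrightarrow> elements_mat A \<subseteq> polys V"
  unfolding pmat_def by (auto dest!: elements_matD)

lemma index_mult_mat_sum:
  "A \<in> carrier_mat nr n \<Longrightarrow> B \<in> carrier_mat n nc \<Longrightarrow> i < nr \<Longrightarrow> j < nc \<Longrightarrow>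
    (A * B) $$ (i, j) = (\<Sum>l < n. A $$ (i, l) * B $$ (l, j))"
  by (auto simp: scalar_prod_def atLeast0LessThan intro!: sum.cong)

lemma index_mult_vec_sum:
  "A \<in> carrier_mat nr n \<Longrightarrow> u \<in> carrier_vec n \<Longrightarrow> i < nr \<Longrightarrow>
    (A *\<^sub>v u) $ i = (\<Sum>l < n. A $$ (i, l) * u $ l)"
  by (auto simp: scalar_prod_def atLeast0LessThan intro!: sum.cong)

lemma pmat_mult: "pmat V nr n A \<Longrightarrow> pmat V n nc B \<Longrightarrow> pmat V nr nc (A * B)"
  unfolding pmat_def
  by (auto simp: index_mult_mat_sum simp del: index_mult_mat(1) intro!: polys_sum)

lemma pmat_minus: "pmat V nr nc A \<Longrightarrow> pmat V nr nc B \<Longrightarrow> pmat V nr nc (A - B)"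
  unfolding pmat_def by (intro conjI minus_carrier_mat) auto

lemma pmat_one: "pmat V n n (1\<^sub>m n)"
  unfolding pmat_def by auto

lemma free_vecs_iff: "u \<in> free_vecs V n \<longleftrightarrow> u \<in> carrier_vec n \<and> (\<forall>i < n. u $ i \<in> polys V)"
  unfolding free_vecs_def vec_set_def by auto

lemma mult_unit_vec:
  fixes A :: "'a::semiring_1 mat"
  assumes A: "A \<in> carrier_mat nr nc" and j: "j < nc"
  shows "A *\<^sub>v unit_vec nc j = col A j"
  using A j by (intro eq_vecI) (auto simp: scalar_prod_right_unit)

lemma mat_lift:
  assumes D: "D \<in> carrier_mat nr n" and A: "A \<in> carrier_mat nr m"
    and u: "\<And>j. j < m \<Longrightarrow> \<exists>u \<in> free_vecs V n. D *\<^sub>v u = col A j"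
  shows "\<exists>Q. pmat V n m Q \<and> D * Q = A"
proof -
  have "\<forall>j. \<exists>u. j < m \<longrightarrow> u \<in> free_vecs V n \<and> D *\<^sub>v u = col A j" using u by blast
  then obtain u where u: "\<And>j. j < m \<Longrightarrow> u j \<in> free_vecs V n" "\<And>j. j < m \<Longrightarrow> D *\<^sub>v u j = col A j"
    by metis
  define Q where "Q = mat n m (\<lambda>(i, j). u j $ i)"
  have Q: "Q \<in> carrier_mat n m" by (simp add: Q_def)
  have "col Q j = u j" if "j < m" for j
    using u(1)[OF that] that by (intro eq_vecI) (auto simp: Q_def free_vecs_iff)
  note colQ = this
  have "D * Q = A"
  proof (rule mat_col_eqI)
    fix j assume "j < dim_col A"
    then have j: "j < m" using A by simp
    show "col (D * Q) j = col A j" unfolding col_mult2[OF D Q j] colQ[OF j] by (rule u(2)[OF j])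
  qed (use D A Q in auto)
  moreover have "pmat V n m Q" using u(1) unfolding pmat_def free_vecs_iff by (auto simp: Q_def)
  ultimately show ?thesis by blast
qed

text \<open>The homogeneous part of degree \<open>g\<close> in the coefficient of a basis element of
  degree \<open>f\<close>. The degrees form only a monoid, so the condition is
  \<open>gr m + f = g\<close> rather than a difference.\<close>

definition hpart :: "(('v \<Rightarrow>\<^sub>0 nat) \<Rightarrow> 'g::comm_monoid_add) \<Rightarrow> 'g \<Rightarrow> 'g \<Rightarrow> ('v, 'k::field) mpoly \<Rightarrow> ('v, 'k) mpoly" where
  "hpart gr f g p = (\<Sum>m \<in> {m \<in> supp p. gr m + f = g}. monom m (coef p m))"

lemma coef_hpart: "coef (hpart gr f g p) m = (if gr m + f = g then coef p m else 0)"
proof -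
  have "coef (hpart gr f g p) m = (\<Sum>l \<in> {l \<in> supp p. gr l + f = g}. if l = m then coef p l else 0)"
    by (simp add: hpart_def lookup_sum lookup_single when_def)
  also have "\<dots> = (if gr m + f = g then coef p m else 0)"
    by (auto simp: sum.delta in_keys_iff)
  finally show ?thesis .
qed

lemma hpart_polys: "p \<in> polys V \<Longrightarrow> hpart gr f g p \<in> polys V"
  unfolding polys_iff by (auto simp: in_keys_iff coef_hpart split: if_splits)

lemma hpart_sum: "hpart gr f g (sum p A) = (\<Sum>i \<in> A. hpart gr f g (p i))"
  by (rule poly_mapping_eqI) (simp add: coef_hpart lookup_sum)

lemma hpart_id: "(\<And>m. m \<in> supp p \<Longrightarrow> gr m + f = g) \<Longrightarrow> hpart gr f g p = p"
  by (rule poly_mapping_eqI) (auto simp: coef_hpart in_keys_iff)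

lemma hpart_0: "(\<And>m. m \<in> supp p \<Longrightarrow> gr m + f \<noteq> g) \<Longrightarrow> hpart gr f g p = 0"
  by (rule poly_mapping_eqI) (auto simp: coef_hpart in_keys_iff)

text \<open>Regrouping gives \<open>gr (m + m') + t = gr m' + f\<close> for \<open>m\<close> in the
  support of \<open>d\<close>, so a product term has the right degree exactly when its second factor
  has; nothing is cancelled in the monoid.\<close>

lemma hpart_mult:
  assumes gr: "\<And>m m'. gr (m + m') = gr m + gr m'" and d: "\<And>m. m \<in> supp d \<Longrightarrow> gr m + t = f"
  shows "hpart gr t g (d * u) = d * hpart gr f g u"
proof -
  have sh: "gr (m + m') + t = gr m' + f" if "m \<in> supp d" for m m'
  proof -
    have "gr (m + m') + t = gr m' + (gr m + t)" by (simp add: gr ac_simps)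
    then show ?thesis unfolding d[OF that] .
  qed
  have "d * u = d * hpart gr f g u + d * (u - hpart gr f g u)" by (simp add: algebra_simps)
  then have "hpart gr t g (d * u) = hpart gr t g (d * hpart gr f g u) + hpart gr t g (d * (u - hpart gr f g u))"
    using hpart_sum[of gr t g "\<lambda>b. if b then d * hpart gr f g u else d * (u - hpart gr f g u)" UNIV]
    by (simp add: UNIV_bool add.commute)
  also have "hpart gr t g (d * hpart gr f g u) = d * hpart gr f g u"
  proof (rule hpart_id)
    fix m assume "m \<in> supp (d * hpart gr f g u)"
    then obtain a b where "m = a + b" "a \<in> supp d" "b \<in> supp (hpart gr f g u)"
      using Poly_Mapping.keys_mult[of d "hpart gr f g u"] by blast
    then show "gr m + t = g" using sh by (auto simp: in_keys_iff coef_hpart split: if_splits)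
  qed
  also have "hpart gr t g (d * (u - hpart gr f g u)) = 0"
  proof (rule hpart_0)
    fix m assume "m \<in> supp (d * (u - hpart gr f g u))"
    then obtain a b where "m = a + b" "a \<in> supp d" "b \<in> supp (u - hpart gr f g u)"
      using Poly_Mapping.keys_mult[of d "u - hpart gr f g u"] by blast
    then show "gr m + t \<noteq> g" using sh by (auto simp: in_keys_iff lookup_minus coef_hpart split: if_splits)
  qed
  finally show ?thesis by simp
qed

text \<open>Any lift may be truncated to the components of the right degree: multiplication by the
  homogeneous \<open>D\<close> commutes with \<open>hpart\<close>, and the entries of
  \<open>A\<close> equal their own components.\<close>

lemma mat_lift_homogeneous:
  assumes gr: "\<And>m m'. gr (m + m') = gr m + gr m'"
    and D: "D \<in> carrier_mat (length T) (length F)" "homogeneous_mat gr T F D"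
    and A: "A \<in> carrier_mat (length T) (length G)" "homogeneous_mat gr T G A"
    and u: "\<And>j. j < length G \<Longrightarrow> \<exists>u \<in> free_vecs V (length F). D *\<^sub>v u = col A j"
  shows "\<exists>Q. pmat V (length F) (length G) Q \<and> homogeneous_mat gr F G Q \<and> D * Q = A"
proof -
  obtain Q where Q: "pmat V (length F) (length G) Q" "D * Q = A"
    using mat_lift[OF D(1) A(1) u] by blast
  define Q' where "Q' = mat (length F) (length G) (\<lambda>(i, j). hpart gr (F ! i) (G ! j) (Q $$ (i, j)))"
  have Q'c: "Q' \<in> carrier_mat (length F) (length G)" by (simp add: Q'_def)
  have "D * Q' = A"
  proof (rule eq_matI)
    fix l j assume "l < dim_row A" "j < dim_col A"
    then have lj: "l < length T" "j < length G" using A(1) by auto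
    have "(D * Q') $$ (l, j) = (\<Sum>i < length F. D $$ (l, i) * Q' $$ (i, j))"
      by (rule index_mult_mat_sum[OF D(1) Q'c lj])
    also have "\<dots> = (\<Sum>i < length F. hpart gr (T ! l) (G ! j) (D $$ (l, i) * Q $$ (i, j)))"
    proof (rule sum.cong[OF refl])
      fix i assume "i \<in> {..<length F}"
      then show "D $$ (l, i) * Q' $$ (i, j) = hpart gr (T ! l) (G ! j) (D $$ (l, i) * Q $$ (i, j))"
        using D(2) lj hpart_mult[OF gr, of "D $$ (l, i)" "T ! l" "F ! i" "G ! j"]
        by (simp add: Q'_def homogeneous_mat_def)
    qed
    also have "\<dots> = hpart gr (T ! l) (G ! j) (A $$ (l, j))"
      unfolding hpart_sum[symmetric] index_mult_mat_sum[OF D(1) pmatD(1)[OF Q(1)] lj, symmetric] Q(2) ..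
    also have "\<dots> = A $$ (l, j)"
      by (rule hpart_id) (use A(2) lj in \<open>auto simp: homogeneous_mat_def\<close>)
    finally show "(D * Q') $$ (l, j) = A $$ (l, j)" .
  qed (use D A Q'c in auto)
  moreover have "pmat V (length F) (length G) Q'"
    using Q(1) Q'c unfolding pmat_def by (auto simp: Q'_def intro!: hpart_polys)
  moreover have "homogeneous_mat gr F G Q'"
    unfolding homogeneous_mat_def by (auto simp: Q'_def in_keys_iff coef_hpart split: if_splits)
  ultimately show ?thesis by blast
qed

lemma homogeneous_mult:
  assumes gr: "\<And>m m'. gr (m + m') = gr m + gr m'"
    and A: "A \<in> carrier_mat (length T) (length F)" "homogeneous_mat gr T F A"
    and B: "B \<in> carrier_mat (length F) (length G)" "homogeneous_mat gr F G B"
  shows "homogeneous_mat gr T G (A * B)"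
  unfolding homogeneous_mat_def
proof (intro allI impI ballI)
  fix i j m assume ij: "i < length T" "j < length G" and m: "m \<in> supp ((A * B) $$ (i, j))"
  have "\<exists>l < length F. m \<in> supp (A $$ (i, l) * B $$ (l, j))"
  proof (rule ccontr)
    assume "\<not> ?thesis"
    then have "coef (\<Sum>l < length F. A $$ (i, l) * B $$ (l, j)) m = 0"
      by (auto simp: lookup_sum in_keys_iff)
    then show False using m unfolding index_mult_mat_sum[OF A(1) B(1) ij] by (simp add: in_keys_iff)
  qed
  then obtain l a b where l: "l < length F" and ab: "m = a + b" "a \<in> supp (A $$ (i, l))" "b \<in> supp (B $$ (l, j))"
    using Poly_Mapping.keys_mult by blast
  have "gr m + T ! i = gr b + (gr a + T ! i)" by (simp add: ab gr ac_simps)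
  also have "gr a + T ! i = F ! l" using A(2) l ab ij by (simp add: homogeneous_mat_def)
  also have "gr b + F ! l = G ! j" using B(2) l ab ij by (simp add: homogeneous_mat_def)
  finally show "gr m + T ! i = G ! j" .
qed

section \<open>Consequences of the clauses of a minimal resolution\<close>

context
  fixes gr :: "('v \<Rightarrow>\<^sub>0 nat) \<Rightarrow> 'g::comm_monoid_add" and V :: "'v set" and I :: "('v, 'k::field) mpoly set"
    and F :: "nat \<Rightarrow> 'g list" and d :: "nat \<Rightarrow> ('v, 'k) mpoly mat"
  assumes res: "minimal_free_resolution gr V I F d"
begin

lemma res_pmat: "pmat V (length (res_target F k)) (length (F k)) (d k)"
proof -
  have "d k \<in> carrier_mat (length (res_target F k)) (length (F k)) \<and> elements_mat (d k) \<subseteq> polys V"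
    by (rule res[unfolded minimal_free_resolution_def, THEN conjunct2, THEN conjunct1, THEN spec])
  then show ?thesis using pmat_iff_elements[of "d k" "length (res_target F k)" "length (F k)" V] by simp
qed

lemma res_pmat_0: "pmat V 1 (length (F 0)) (d 0)"
  using res_pmat[of 0] by (simp add: res_target_def)

lemma res_pmat_Suc: "pmat V (length (F k)) (length (F (Suc k))) (d (Suc k))"
  using res_pmat[of "Suc k"] by (simp add: res_target_def)

lemma res_homogeneous: "homogeneous_mat gr (res_target F k) (F k) (d k)"
proof -
  have "\<forall>i < length (res_target F k). \<forall>j < length (F k).
      \<forall>m \<in> supp (d k $$ (i, j)). gr m + res_target F k ! i = F k ! j"
    by (rule res[unfolded minimal_free_resolution_def, THEN conjunct2, THEN conjunct2, THEN conjunct1, THEN spec])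
  then show ?thesis unfolding homogeneous_mat_def .
qed

lemma res_minimal: "i < length (F k) \<Longrightarrow> j < length (F (Suc k)) \<Longrightarrow> coef (d (Suc k) $$ (i, j)) 0 = 0"
proof -
  assume "i < length (F k)" "j < length (F (Suc k))"
  then have "d (Suc k) $$ (i, j) \<in> elements_mat (d (Suc k))"
    using elements_matI[OF pmatD(1)[OF res_pmat_Suc]] by blast
  moreover have "\<forall>p \<in> elements_mat (d (Suc k)). coef p 0 = 0"
    by (rule res[unfolded minimal_free_resolution_def, THEN conjunct2, THEN conjunct2, THEN conjunct2,
          THEN conjunct1, THEN spec])
  ultimately show ?thesis by blast
qed

lemma res_image: "{(d 0 *\<^sub>v u) $ 0 | u. u \<in> free_vecs V (length (F 0))} = I"
  by (rule res[unfolded minimal_free_resolution_def, THEN conjunct2, THEN conjunct2, THEN conjunct2,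
        THEN conjunct2, THEN conjunct1])

lemma res_exact: "{d (Suc k) *\<^sub>v u | u. u \<in> free_vecs V (length (F (Suc k)))} =
    mat_kernel (d k) \<inter> free_vecs V (length (F k))"
  by (rule res[unfolded minimal_free_resolution_def, THEN conjunct2, THEN conjunct2, THEN conjunct2,
        THEN conjunct2, THEN conjunct2, THEN spec])

lemma res_entry_in_ideal:
  assumes j: "j < length (F 0)"
  shows "d 0 $$ (0, j) \<in> I"
proof -
  note D = pmatD(1)[OF res_pmat_0]
  have u: "unit_vec (length (F 0)) j \<in> free_vecs V (length (F 0))"
    unfolding free_vecs_iff using j by auto
  have eq: "(d 0 *\<^sub>v unit_vec (length (F 0)) j) $ 0 = d 0 $$ (0, j)"
    unfolding mult_unit_vec[OF D j] using D j by simp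
  have "d 0 $$ (0, j) \<in> {(d 0 *\<^sub>v u) $ 0 | u. u \<in> free_vecs V (length (F 0))}"
    by (intro CollectI exI[of _ "unit_vec (length (F 0)) j"] conjI eq[symmetric] u)
  then show ?thesis unfolding res_image .
qed

lemma res_lift_kernel:
  assumes A: "pmat V (length (F k)) m A" and z: "d k * A = 0\<^sub>m (length (res_target F k)) m" and j: "j < m"
  shows "\<exists>u \<in> free_vecs V (length (F (Suc k))). d (Suc k) *\<^sub>v u = col A j"
proof -
  note Ac = pmatD(1)[OF A] and D = pmatD(1)[OF res_pmat[of k]]
  have "col A j \<in> free_vecs V (length (F k))"
    unfolding free_vecs_iff using A j by (auto simp: pmat_def)
  moreover have "d k *\<^sub>v col A j = col (d k * A) j" by (rule col_mult2[OF D Ac j, symmetric])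
  then have "d k *\<^sub>v col A j = 0\<^sub>v (length (res_target F k))" unfolding z using j by simp
  then have "col A j \<in> mat_kernel (d k)" by (intro mat_kernelI[OF D]) (use Ac j in auto)
  ultimately have "col A j \<in> {d (Suc k) *\<^sub>v u | u. u \<in> free_vecs V (length (F (Suc k)))}"
    unfolding res_exact by (rule IntI[rotated])
  then show ?thesis by auto
qed

lemma res_lift_ideal:
  assumes A: "A \<in> carrier_mat 1 m" "\<And>j. j < m \<Longrightarrow> A $$ (0, j) \<in> I" and j: "j < m"
  shows "\<exists>u \<in> free_vecs V (length (F 0)). d 0 *\<^sub>v u = col A j"
proof -
  have "A $$ (0, j) \<in> {(d 0 *\<^sub>v u) $ 0 | u. u \<in> free_vecs V (length (F 0))}"
    using A(2)[OF j] unfolding res_image .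
  then obtain u where u: "u \<in> free_vecs V (length (F 0))" "(d 0 *\<^sub>v u) $ 0 = A $$ (0, j)" by auto
  have "d 0 *\<^sub>v u = col A j"
    using u(2) A(1) j pmatD(1)[OF res_pmat_0] by (intro eq_vecI) auto
  then show ?thesis using u(1) by blast
qed

lemma res_complex: "d k * d (Suc k) = 0\<^sub>m (length (res_target F k)) (length (F (Suc k)))"
proof (rule mat_col_eqI)
  note D = pmatD(1)[OF res_pmat[of k]] and D' = pmatD(1)[OF res_pmat_Suc[of k]]
  show "dim_row (d k * d (Suc k)) = dim_row (0\<^sub>m (length (res_target F k)) (length (F (Suc k))) :: ('v, 'k) mpoly mat)"
    "dim_col (d k * d (Suc k)) = dim_col (0\<^sub>m (length (res_target F k)) (length (F (Suc k))) :: ('v, 'k) mpoly mat)"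
    using D D' by auto
  fix j assume "j < dim_col (0\<^sub>m (length (res_target F k)) (length (F (Suc k))) :: ('v, 'k) mpoly mat)"
  then have j: "j < length (F (Suc k))" by simp
  have "unit_vec (length (F (Suc k))) j \<in> free_vecs V (length (F (Suc k)))"
    unfolding free_vecs_iff using j by auto
  then have "d (Suc k) *\<^sub>v unit_vec (length (F (Suc k))) j \<in>
      {d (Suc k) *\<^sub>v u | u. u \<in> free_vecs V (length (F (Suc k)))}"
    by (intro CollectI exI[of _ "unit_vec (length (F (Suc k))) j"] conjI refl)
  then have "d (Suc k) *\<^sub>v unit_vec (length (F (Suc k))) j \<in> mat_kernel (d k)"
    unfolding res_exact by (rule IntD1)
  then have "d k *\<^sub>v col (d (Suc k)) j = 0\<^sub>v (length (res_target F k))"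
    using mat_kernelD[OF D] mult_unit_vec[OF D' j] by simp
  then show "col (d k * d (Suc k)) j = col (0\<^sub>m (length (res_target F k)) (length (F (Suc k)))) j"
    using j by (simp add: col_mult2[OF D D'])
qed

end

lemma comparison_map:
  fixes gr :: "('v \<Rightarrow>\<^sub>0 nat) \<Rightarrow> 'g::comm_monoid_add"
  assumes gr: "\<And>m m'. gr (m + m') = gr m + gr m'"
    and res: "minimal_free_resolution gr V (I :: ('v, 'k::field) mpoly set) F d"
    and res': "minimal_free_resolution gr V I F' d'"
  shows "\<exists>\<phi>. (\<forall>k. pmat V (length (F' k)) (length (F k)) (\<phi> k) \<and> homogeneous_mat gr (F' k) (F k) (\<phi> k)) \<and>
    d' 0 * \<phi> 0 = d 0 \<and> (\<forall>k. d' (Suc k) * \<phi> (Suc k) = \<phi> k * d (Suc k))"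
proof -
  note p = res_pmat[OF res] and p0 = res_pmat_0[OF res] and pS = res_pmat_Suc[OF res]
  note p' = res_pmat[OF res'] and p0' = res_pmat_0[OF res'] and pS' = res_pmat_Suc[OF res']
  \<comment> \<open>The vanishing clause is what the next lift needs: it places the columns of
    \<open>A * d (Suc k)\<close> in the kernel of \<open>d' k\<close>. The last clause records
    compatibility with the augmentations.\<close>
  let ?P = "\<lambda>k A. pmat V (length (F' k)) (length (F k)) A \<and> homogeneous_mat gr (F' k) (F k) A \<and>
    d' k * (A * d (Suc k)) = 0\<^sub>m (length (res_target F' k)) (length (F (Suc k))) \<and>
    (k = 0 \<longrightarrow> d' 0 * A = d 0)"
  let ?Q = "\<lambda>k A B. d' (Suc k) * B = A * d (Suc k)"
  have "\<exists>\<phi>. \<forall>k. ?P k (\<phi> k) \<and> ?Q k (\<phi> k) (\<phi> (Suc k))"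
  proof (rule dependent_nat_choice)
    have "\<exists>Q. pmat V (length (F' 0)) (length (F 0)) Q \<and> homogeneous_mat gr (F' 0) (F 0) Q \<and> d' 0 * Q = d 0"
    proof (rule mat_lift_homogeneous[OF gr])
      show "d' 0 \<in> carrier_mat (length [0::'g]) (length (F' 0))" "d 0 \<in> carrier_mat (length [0::'g]) (length (F 0))"
        using pmatD(1)[OF p0] pmatD(1)[OF p0'] by simp_all
      show "homogeneous_mat gr [0] (F' 0) (d' 0)" "homogeneous_mat gr [0] (F 0) (d 0)"
        using res_homogeneous[OF res, of 0] res_homogeneous[OF res', of 0] by (simp_all add: res_target_def)
      show "\<exists>u\<in>free_vecs V (length (F' 0)). d' 0 *\<^sub>v u = col (d 0) j" if "j < length (F 0)" for j
        by (rule res_lift_ideal[OF res' pmatD(1)[OF p0] res_entry_in_ideal[OF res] that])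
    qed
    then obtain Q where Q: "pmat V (length (F' 0)) (length (F 0)) Q" "homogeneous_mat gr (F' 0) (F 0) Q" "d' 0 * Q = d 0"
      by blast
    have "d' 0 * (Q * d (Suc 0)) = (d' 0 * Q) * d (Suc 0)"
      by (rule assoc_mult_mat[symmetric, OF pmatD(1)[OF p0'] pmatD(1)[OF Q(1)] pmatD(1)[OF pS]])
    also have "\<dots> = 0\<^sub>m (length (res_target F' 0)) (length (F (Suc 0)))"
      unfolding Q(3) res_complex[OF res] by (simp add: res_target_def)
    finally show "\<exists>x. ?P 0 x" using Q by blast
  next
    fix A k assume A: "?P k A"
    note Ac = pmatD(1)[OF conjunct1[OF A]]
    have AdP: "pmat V (length (F' k)) (length (F (Suc k))) (A * d (Suc k))"
      using A pS by (blast intro: pmat_mult)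
    have "\<exists>Q. pmat V (length (F' (Suc k))) (length (F (Suc k))) Q \<and>
        homogeneous_mat gr (F' (Suc k)) (F (Suc k)) Q \<and> d' (Suc k) * Q = A * d (Suc k)"
    proof (rule mat_lift_homogeneous[OF gr])
      show "d' (Suc k) \<in> carrier_mat (length (F' k)) (length (F' (Suc k)))" by (rule pmatD(1)[OF pS'])
      show "homogeneous_mat gr (F' k) (F' (Suc k)) (d' (Suc k))"
        using res_homogeneous[OF res', of "Suc k"] by (simp add: res_target_def)
      show "A * d (Suc k) \<in> carrier_mat (length (F' k)) (length (F (Suc k)))" by (rule pmatD(1)[OF AdP])
      show "homogeneous_mat gr (F' k) (F (Suc k)) (A * d (Suc k))"
      proof (rule homogeneous_mult[OF gr Ac _ pmatD(1)[OF pS]])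
        show "homogeneous_mat gr (F' k) (F k) A" using A by blast
        show "homogeneous_mat gr (F k) (F (Suc k)) (d (Suc k))"
          using res_homogeneous[OF res, of "Suc k"] by (simp add: res_target_def)
      qed
      show "\<exists>u\<in>free_vecs V (length (F' (Suc k))). d' (Suc k) *\<^sub>v u = col (A * d (Suc k)) j"
        if "j < length (F (Suc k))" for j
        by (rule res_lift_kernel[OF res' AdP _ that]) (use A in blast)
    qed
    then obtain Q where Q: "pmat V (length (F' (Suc k))) (length (F (Suc k))) Q"
      "homogeneous_mat gr (F' (Suc k)) (F (Suc k)) Q" "d' (Suc k) * Q = A * d (Suc k)" by blast
    have "d' (Suc k) * (Q * d (Suc (Suc k))) = (d' (Suc k) * Q) * d (Suc (Suc k))"
      by (rule assoc_mult_mat[symmetric, OF pmatD(1)[OF pS'] pmatD(1)[OF Q(1)] pmatD(1)[OF pS]])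
    also have "\<dots> = A * (d (Suc k) * d (Suc (Suc k)))"
      unfolding Q(3) by (rule assoc_mult_mat[OF Ac pmatD(1)[OF pS] pmatD(1)[OF pS]])
    also have "\<dots> = 0\<^sub>m (length (res_target F' (Suc k))) (length (F (Suc (Suc k))))"
      unfolding res_complex[OF res] using Ac by (simp add: res_target_def)
    finally show "\<exists>y. ?P (Suc k) y \<and> ?Q k A y" using Q by blast
  qed
  then obtain \<phi> where "\<forall>k. ?P k (\<phi> k) \<and> ?Q k (\<phi> k) (\<phi> (Suc k))" by (rule exE)
  then show ?thesis by (intro exI[of _ \<phi>]) simp
qed

lemma coef_mult_0: "coef (p * q) 0 = coef p 0 * coef (q :: ('v, 'k::field) mpoly) 0"
proof -
  have "coef ((p - monom 0 (coef p 0)) * q) 0 = 0"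
  proof (rule ccontr)
    assume "\<not> ?thesis"
    then have "0 \<in> supp ((p - monom 0 (coef p 0)) * q)" by (simp add: in_keys_iff)
    then obtain a b where "0 = a + b" "a \<in> supp (p - monom 0 (coef p 0))"
      using Poly_Mapping.keys_mult[of "p - monom 0 (coef p 0)" q] by blast
    moreover then have "supp a = {}" using supp_add_nat[of a b] by simp
    ultimately show False by (simp add: in_keys_iff lookup_minus)
  qed
  moreover have "p * q = monom 0 (coef p 0) * q + (p - monom 0 (coef p 0)) * q" by (simp add: algebra_simps)
  ultimately show ?thesis using coef_monom_mult[of 0 "coef p 0" q 0] by (simp add: lookup_add)
qed

lemma coef_mult_mat_0:
  assumes "A \<in> carrier_mat nr n" "B \<in> carrier_mat n nc" "i < nr" "j < nc"
  shows "coef ((A * B) $$ (i, j)) 0 = (\<Sum>l < n. coef (A $$ (i, l)) 0 * coef (B $$ (l, j) :: ('v, 'k::field) mpoly) 0)"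
  unfolding index_mult_mat_sum[OF assms] by (simp add: lookup_sum coef_mult_0)

text \<open>The composite \<open>\<psi> k * \<phi> k\<close> is homotopic to the identity, and by
  minimality the homotopy terms have no constant coefficients. Its diagonal entries thus have
  constant coefficient 1, so each column of \<open>\<phi> k\<close> has an entry with nonzero
  constant coefficient, and homogeneity identifies the two shifts belonging to that entry.\<close>

theorem resolution_shifts_subset:
  fixes gr :: "('v \<Rightarrow>\<^sub>0 nat) \<Rightarrow> 'g::comm_monoid_add"
  assumes gr: "\<And>m m'. gr (m + m') = gr m + gr m'" "gr 0 = 0"
    and res: "minimal_free_resolution gr V (I :: ('v, 'k::field) mpoly set) F d"
    and res': "minimal_free_resolution gr V I F' d'"
  shows "set (F k) \<subseteq> set (F' k)"
proof -
  let ?n = "\<lambda>k. length (F k)"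
  note pS = res_pmat_Suc[OF res] and p0 = res_pmat_0[OF res]
  obtain \<phi> where \<phi>: "\<And>k. pmat V (length (F' k)) (?n k) (\<phi> k)" "\<And>k. homogeneous_mat gr (F' k) (F k) (\<phi> k)"
    "d' 0 * \<phi> 0 = d 0" "\<And>k. d' (Suc k) * \<phi> (Suc k) = \<phi> k * d (Suc k)"
    using comparison_map[OF gr(1) res res'] by blast
  obtain \<psi> where \<psi>: "\<And>k. pmat V (?n k) (length (F' k)) (\<psi> k)"
    "d 0 * \<psi> 0 = d' 0" "\<And>k. d (Suc k) * \<psi> (Suc k) = \<psi> k * d' (Suc k)"
    using comparison_map[OF gr(1) res' res] by blast
  note \<phi>c = pmatD(1)[OF \<phi>(1)] and \<psi>c = pmatD(1)[OF \<psi>(1)] and dc = pmatD(1)[OF pS]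
    and d'c = pmatD(1)[OF res_pmat_Suc[OF res']]
  define E where "E k = \<psi> k * \<phi> k - 1\<^sub>m (?n k)" for k
  have EP: "pmat V (?n k) (?n k) (E k)" for k
    unfolding E_def by (intro pmat_minus pmat_mult[OF \<psi>(1) \<phi>(1)] pmat_one)
  note Ec = pmatD(1)[OF EP]
  have \<psi>\<phi>c: "\<psi> k * \<phi> k \<in> carrier_mat (?n k) (?n k)" for k using \<psi>c \<phi>c by (rule mult_carrier_mat)
  have "d 0 * (\<psi> 0 * \<phi> 0) = (d 0 * \<psi> 0) * \<phi> 0"
    by (rule assoc_mult_mat[symmetric, OF pmatD(1)[OF p0] \<psi>c \<phi>c])
  also have "\<dots> = d 0" unfolding \<psi>(2) \<phi>(3) ..
  finally have dE0: "d 0 * E 0 = 0\<^sub>m 1 (?n 0)"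
    unfolding E_def mult_minus_distrib_mat[OF pmatD(1)[OF p0] \<psi>\<phi>c one_carrier_mat]
    using pmatD(1)[OF p0] by simp
  have dE: "d (Suc k) * E (Suc k) = E k * d (Suc k)" for k
  proof -
    have "d (Suc k) * (\<psi> (Suc k) * \<phi> (Suc k)) = (d (Suc k) * \<psi> (Suc k)) * \<phi> (Suc k)"
      by (rule assoc_mult_mat[symmetric, OF dc \<psi>c \<phi>c])
    also have "\<dots> = \<psi> k * (d' (Suc k) * \<phi> (Suc k))" unfolding \<psi>(3) by (rule assoc_mult_mat[OF \<psi>c d'c \<phi>c])
    also have "\<dots> = (\<psi> k * \<phi> k) * d (Suc k)" unfolding \<phi>(4) by (rule assoc_mult_mat[symmetric, OF \<psi>c \<phi>c dc])
    finally show ?thesis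
      unfolding E_def mult_minus_distrib_mat[OF dc \<psi>\<phi>c one_carrier_mat]
        minus_mult_distrib_mat[OF \<psi>\<phi>c one_carrier_mat dc]
      using dc[of k] by simp
  qed
  \<comment> \<open>The next stage needs the homotopy identity only after multiplication by
    \<open>d (Suc k)\<close>, where the earlier homotopy drops out. The full identity is kept in
    \<open>?Q\<close> and, at \<open>k = 0\<close>, where there is no earlier homotopy, in the last
    clause.\<close>
  let ?P = "\<lambda>k H. pmat V (?n (Suc k)) (?n k) H \<and> d (Suc k) * H * d (Suc k) = E k * d (Suc k) \<and>
    (k = 0 \<longrightarrow> d (Suc 0) * H = E 0)"
  let ?Q = "\<lambda>k H H'. d (Suc (Suc k)) * H' = E (Suc k) - H * d (Suc k)"
  have "\<exists>h. \<forall>k. ?P k (h k) \<and> ?Q k (h k) (h (Suc k))"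
  proof (rule dependent_nat_choice)
    have "\<exists>H. pmat V (?n (Suc 0)) (?n 0) H \<and> d (Suc 0) * H = E 0"
    proof (rule mat_lift[OF dc Ec])
      show "\<exists>u\<in>free_vecs V (?n (Suc 0)). d (Suc 0) *\<^sub>v u = col (E 0) j" if "j < ?n 0" for j
        by (rule res_lift_kernel[OF res EP _ that]) (simp add: dE0 res_target_def)
    qed
    then show "\<exists>H. ?P 0 H" by auto
  next
    fix H k assume H: "?P k H"
    have HP: "pmat V (?n (Suc k)) (?n k) H" and Hd: "d (Suc k) * H * d (Suc k) = E k * d (Suc k)"
      using H by blast+
    note Hc = pmatD(1)[OF HP]
    have HdP: "pmat V (?n (Suc k)) (?n (Suc k)) (H * d (Suc k))" by (rule pmat_mult[OF HP pS])
    have AP: "pmat V (?n (Suc k)) (?n (Suc k)) (E (Suc k) - H * d (Suc k))" by (rule pmat_minus[OF EP HdP])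
    have z: "d (Suc k) * (E (Suc k) - H * d (Suc k)) = 0\<^sub>m (length (res_target F (Suc k))) (?n (Suc k))"
    proof -
      have "d (Suc k) * (H * d (Suc k)) = E k * d (Suc k)"
        using Hd assoc_mult_mat[OF dc Hc dc] by simp
      then show ?thesis
        unfolding mult_minus_distrib_mat[OF dc Ec pmatD(1)[OF HdP]] dE
        using Ec[of k] dc[of k] by (simp add: res_target_def)
    qed
    have "\<exists>H'. pmat V (?n (Suc (Suc k))) (?n (Suc k)) H' \<and> d (Suc (Suc k)) * H' = E (Suc k) - H * d (Suc k)"
      by (rule mat_lift[OF dc pmatD(1)[OF AP] res_lift_kernel[OF res AP z]])
    then obtain H' where H': "pmat V (?n (Suc (Suc k))) (?n (Suc k)) H'"
      "d (Suc (Suc k)) * H' = E (Suc k) - H * d (Suc k)" by blast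
    have "d (Suc (Suc k)) * H' * d (Suc (Suc k)) = E (Suc k) * d (Suc (Suc k)) - H * d (Suc k) * d (Suc (Suc k))"
      unfolding H'(2) by (rule minus_mult_distrib_mat[OF Ec pmatD(1)[OF HdP] dc])
    also have "H * d (Suc k) * d (Suc (Suc k)) = 0\<^sub>m (?n (Suc k)) (?n (Suc (Suc k)))"
      unfolding assoc_mult_mat[OF Hc dc dc] res_complex[OF res] using Hc by (simp add: res_target_def)
    also have "E (Suc k) * d (Suc (Suc k)) - 0\<^sub>m (?n (Suc k)) (?n (Suc (Suc k))) = E (Suc k) * d (Suc (Suc k))"
      using Ec[of "Suc k"] dc[of "Suc k"] by (intro eq_matI) auto
    finally show "\<exists>y. ?P (Suc k) y \<and> ?Q k H y" using H' by blast
  qed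
  then obtain h where h: "\<And>k. pmat V (?n (Suc k)) (?n k) (h k)" "d (Suc 0) * h 0 = E 0"
    "\<And>k. d (Suc (Suc k)) * h (Suc k) = E (Suc k) - h k * d (Suc k)" by blast
  note hc = pmatD(1)[OF h(1)]
  have E0: "coef (E k $$ (i, j)) 0 = 0" if ij: "i < ?n k" "j < ?n k" for i j
  proof -
    have dh: "coef ((d (Suc k) * h k) $$ (i, j)) 0 = 0"
      unfolding coef_mult_mat_0[OF dc hc ij] using res_minimal[OF res ij(1)] by simp
    show ?thesis
    proof (cases k)
      case 0
      then show ?thesis using dh h(2) by simp
    next
      case (Suc k')
      have hd: "coef ((h k' * d (Suc k')) $$ (i, j)) 0 = 0"
        unfolding coef_mult_mat_0[OF hc dc ij[unfolded Suc]] using res_minimal[OF res _ ij(2)[unfolded Suc]] by simp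
      have "(d (Suc k) * h k) $$ (i, j) = E k $$ (i, j) - (h k' * d (Suc k')) $$ (i, j)"
        unfolding Suc h(3) using ij[unfolded Suc] mult_carrier_mat[OF hc[of k'] dc[of k']] by (intro index_minus_mat) auto
      then have "coef (E k $$ (i, j)) 0 = coef ((d (Suc k) * h k) $$ (i, j)) 0 + coef ((h k' * d (Suc k')) $$ (i, j)) 0"
        by (simp add: lookup_minus)
      then show ?thesis using dh hd by simp
    qed
  qed
  show ?thesis
  proof
    fix a assume "a \<in> set (F k)"
    then obtain j where j: "j < ?n k" "a = F k ! j" by (auto simp: in_set_conv_nth)
    have "E k $$ (j, j) = (\<psi> k * \<phi> k) $$ (j, j) - 1" unfolding E_def using j \<psi>\<phi>c[of k] by simp
    then have "coef ((\<psi> k * \<phi> k) $$ (j, j)) 0 = 1" using E0[OF j(1) j(1)] by (simp add: lookup_minus)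
    then have "(\<Sum>l < length (F' k). coef (\<psi> k $$ (j, l)) 0 * coef (\<phi> k $$ (l, j)) 0) \<noteq> 0"
      unfolding coef_mult_mat_0[OF \<psi>c \<phi>c j(1) j(1)] by simp
    then obtain l where l: "l < length (F' k)" "coef (\<phi> k $$ (l, j)) 0 \<noteq> 0"
      by (metis (no_types, lifting) lessThan_iff mult_zero_right sum.neutral)
    then have "gr 0 + F' k ! l = F k ! j"
      using \<phi>(2)[of k] j(1) unfolding homogeneous_mat_def by (simp add: in_keys_iff)
    then have "a = F' k ! l" using gr(2) j by simp
    then show "a \<in> set (F' k)" using l by simp
  qed
qed

corollary shifts_eq:
  fixes gr :: "('v \<Rightarrow>\<^sub>0 nat) \<Rightarrow> 'g::comm_monoid_add"
  assumes "\<And>m m'. gr (m + m') = gr m + gr m'" "gr 0 = 0" "minimal_free_resolution gr V I F d"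
  shows "shifts gr V I k = set (F k)"
  unfolding shifts_def using resolution_shifts_subset[OF assms(1,2) _ assms(3)] assms(3) by blast


section \<open>The cubical resolution of the cover ideal of a whiskered graph\<close>

text \<open>The cell \<open>(F, S)\<close> with \<open>S \<subseteq> F\<close> is the cube with the vertices \<open>F - S'\<close>, \<open>S' \<subseteq> S\<close>. A chain
  assigns to every cell its coefficient, so \<open>face i\<close> and \<open>bd\<close> are the transposes of the usual
  formulas for the boundary of a cell.\<close>

type_synonym cell = "nat set \<times> nat set"

definition csgn :: "nat \<Rightarrow> nat set \<Rightarrow> 'a::ring_1" where
  "csgn i T = (- 1) ^ card {j \<in> T. j < i}"

lemma csgn_square [simp]: "csgn i T * csgn i T = (1 :: 'a::ring_1)"
  by (simp add: csgn_def power_add[symmetric])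

lemma csgn_square' [simp]: "csgn i T * (csgn i T * a) = (a :: 'a::ring_1)"
  by (simp add: mult.assoc[symmetric])

lemma csgn_insert:
  assumes "j \<notin> T"
  shows "csgn i (insert j T) = (if j < i then - csgn i T else csgn i T :: 'a::ring_1)"
proof -
  have "{k \<in> insert j T. k < i} = (if j < i then insert j {k \<in> T. k < i} else {k \<in> T. k < i})" by auto
  then show ?thesis using assms by (simp add: csgn_def)
qed

definition face :: "nat \<Rightarrow> (cell \<Rightarrow> (xy_vertex, 'k::field) mpoly) \<Rightarrow> cell \<Rightarrow> (xy_vertex, 'k) mpoly" where
  "face i c = (\<lambda>(F, T). if i \<in> T then 0
     else if i \<in> F then - (csgn i T * (pvar (xv i) * c (F, insert i T)))
     else csgn i T * (pvar (yv i) * c (insert i F, insert i T)))"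

definition bd :: "nat set \<Rightarrow> (cell \<Rightarrow> (xy_vertex, 'k::field) mpoly) \<Rightarrow> cell \<Rightarrow> (xy_vertex, 'k) mpoly" where
  "bd N c C = (\<Sum>i \<in> N. face i c C)"

text \<open>Transposed like \<open>face\<close>: the coefficient at \<open>(F, T - {i})\<close>,
  divided by the variable, becomes the coefficient at the cell extended in direction
  \<open>i\<close>. Multiplying back is the \<open>xv i\<close> branch of
  \<open>face\<close>.\<close>

definition contr :: "nat \<Rightarrow> (cell \<Rightarrow> (xy_vertex, 'k::field) mpoly) \<Rightarrow> cell \<Rightarrow> (xy_vertex, 'k) mpoly" where
  "contr i c = (\<lambda>(F, T). if i \<in> T \<and> i \<in> F then csgn i (T - {i}) * vdiv (xv i) (c (F, T - {i})) else 0)"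

text \<open>Trades the multiples of \<open>pvar (xv i)\<close> at a cell with \<open>i\<close> in
  \<open>F\<close> for multiples of \<open>pvar (yv i)\<close> at the cell without \<open>i\<close>,
  as the edge in direction \<open>i\<close> permits.\<close>

definition proj :: "nat \<Rightarrow> (cell \<Rightarrow> (xy_vertex, 'k::field) mpoly) \<Rightarrow> cell \<Rightarrow> (xy_vertex, 'k) mpoly" where
  "proj i c = (\<lambda>(F, T). if i \<in> T then 0 else if i \<in> F then vzero (xv i) (c (F, T))
     else c (F, T) + pvar (yv i) * vdiv (xv i) (c (insert i F, T)))"

lemma face_sum: "face i (\<lambda>C. \<Sum>j \<in> A. f j C) C = (\<Sum>j \<in> A. face i (f j) C)"
  by (cases C) (simp add: face_def sum_distrib_left sum_negf)

lemma face_scale: "face i (\<lambda>C. a * f C) C = a * face i f C"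
  by (cases C) (simp add: face_def mult_ac)

lemma face_uminus: "face i (\<lambda>C. - f C) C = - face i f C"
  by (cases C) (simp add: face_def)

lemma face_add: "face i (\<lambda>C. f C + g C) C = face i f C + face i g C"
  by (cases C) (simp add: face_def algebra_simps)

text \<open>Adding \<open>i\<close> to the set changes the sign for \<open>j\<close> exactly if
  \<open>i < j\<close>, and conversely; so exactly one of the two signs changes.\<close>

lemma face_anticommute:
  assumes "i \<noteq> j"
  shows "face i (face j c) C = - face j (face i c) C"
proof -
  obtain F T where C: "C = (F, T)" by (cases C)
  consider "i \<in> T \<or> j \<in> T" | "i \<notin> T" "j \<notin> T" "i < j" | "i \<notin> T" "j \<notin> T" "j < i" using assms by fastforce
  then show ?thesis
  proof cases
    case 1
    then show ?thesis by (auto simp: C face_def)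
  qed (auto simp: C face_def csgn_insert insert_commute mult_ac)
qed

lemma face_face: "face i (face i c) C = 0"
  by (cases C) (simp add: face_def)

lemma bd_bd:
  assumes "finite N"
  shows "bd N (bd N c) C = 0"
proof -
  have "bd N (bd N c) C = (\<Sum>i \<in> N. \<Sum>j \<in> N. face i (face j c) C)"
    unfolding bd_def by (simp add: face_sum)
  also have "\<dots> = 0"
    using assms
  proof (induction N rule: finite_induct)
    case (insert x N)
    have "(\<Sum>i \<in> N. face i (face x c) C) = - (\<Sum>i \<in> N. face x (face i c) C)"
      unfolding sum_negf[symmetric] 
    proof (rule sum.cong[OF refl])
      fix i assume "i \<in> N"
      then have "i \<noteq> x" using insert.hyps by blast
      then show "face i (face x c) C = - face x (face i c) C" by (rule face_anticommute)
    qed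
    then show ?case using insert by (simp add: face_face sum.distrib)
  qed simp
  finally show ?thesis .
qed

lemma bd_scale: "bd N (\<lambda>C. a * f C) C = a * bd N f C"
  by (simp add: bd_def face_scale sum_distrib_left)

lemma bd_sum: "bd N (\<lambda>C. \<Sum>j \<in> A. f j C) C = (\<Sum>j \<in> A. bd N (f j) C)"
  unfolding bd_def face_sum by (rule sum.swap)

lemma bd_uminus: "bd N (\<lambda>C. - f C) C = - bd N f C"
  by (simp add: bd_def face_uminus sum_negf)

lemma bd_add: "bd N (\<lambda>C. f C + g C) C = bd N f C + bd N g C"
  by (simp add: bd_def face_add sum.distrib)

lemma free_of_csgn [simp]: "free_of v (csgn i T)"
  unfolding csgn_def by simp

lemma vdiv_csgn [simp]: "vdiv v (csgn i T * p) = csgn i T * vdiv v p"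
  by (rule vdiv_mult_free) simp

lemma vdiv_pvar_other: "v \<noteq> w \<Longrightarrow> vdiv v (pvar w * p) = pvar w * vdiv v p"
  by (rule vdiv_mult_free) simp

lemma vdiv_sum: "vdiv v (sum f A) = (\<Sum>i \<in> A. vdiv v (f i))"
  by (induction A rule: infinite_finite_induct) auto

lemma face_contr_same:
  assumes "\<And>F T. \<not> T \<subseteq> F \<Longrightarrow> c (F, T) = 0"
  shows "face i (contr i c) C + contr i (face i c) C = proj i c C - c C"
proof -
  obtain F T where C: "C = (F, T)" by (cases C)
  consider "i \<in> T" "i \<in> F" | "i \<in> T" "i \<notin> F" | "i \<notin> T" "i \<in> F" | "i \<notin> T" "i \<notin> F" by blast
  then show ?thesis
  proof cases
    case 1
    then have "insert i (T - {i}) = T" by auto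
    then show ?thesis using 1 by (simp add: C face_def contr_def proj_def)
  next
    case 2
    then have "c (F, T) = 0" using assms by blast
    then show ?thesis using 2 by (simp add: C face_def contr_def proj_def)
  next
    case 3
    then show ?thesis using vdiv_decomp[of "c (F, T)" "xv i"]
      by (simp add: C face_def contr_def proj_def vzero_def mult.left_commute[of "pvar (xv i)"])
  next
    case 4
    then show ?thesis
      by (simp add: C face_def contr_def proj_def mult.left_commute[of "pvar (yv i)"])
  qed
qed

lemma face_contr_other:
  assumes ij: "i \<noteq> j"
  shows "face j (contr i c) C + contr i (face j c) C = 0"
proof -
  obtain F T where C: "C = (F, T)" by (cases C)
  show ?thesis
  proof (cases "j \<in> T \<or> i \<notin> T \<or> i \<notin> F")
    case True
    then show ?thesis using ij by (auto simp: C face_def contr_def)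
  next
    case False
    define A where "A = T - {i}"
    have A: "T = insert i A" "i \<notin> A" "j \<notin> A" using False by (auto simp: A_def)
    have eq: "insert j (insert i A) - {i} = insert j A" "insert i A - {i} = A" using A ij by auto
    consider "i < j" | "j < i" using ij by linarith
    then show ?thesis
    proof cases
      case 1
      then show ?thesis using False ij A(2,3)
        by (auto simp: C face_def contr_def A(1) eq csgn_insert vdiv_pvar_other mult_ac)
    next
      case 2
      then show ?thesis using False ij A(2,3)
        by (auto simp: C face_def contr_def A(1) eq csgn_insert vdiv_pvar_other mult_ac)
    qed
  qed
qed

lemma contr_sum: "contr i (\<lambda>C. \<Sum>j \<in> A. f j C) C = (\<Sum>j \<in> A. contr i (f j) C)"
proof -
  obtain F T where "C = (F, T)" by (cases C)
  then show ?thesis by (cases "i \<in> T \<and> i \<in> F") (auto simp: contr_def vdiv_sum sum_distrib_left)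
qed

text \<open>Contraction in direction \<open>i\<close> anticommutes with the faces in all other
  directions, so only \<open>face_contr_same\<close> contributes.\<close>

lemma bd_contr:
  assumes N: "finite N" "i \<in> N" and c: "\<And>F T. \<not> T \<subseteq> F \<Longrightarrow> c (F, T) = 0"
  shows "bd N (contr i c) C + contr i (bd N c) C = proj i c C - c C"
proof -
  have "bd N (contr i c) C + contr i (bd N c) C = (\<Sum>j \<in> N. face j (contr i c) C + contr i (face j c) C)"
    unfolding bd_def sum.distrib using contr_sum[of i "\<lambda>j. face j c" N C] by simp
  also have "\<dots> = face i (contr i c) C + contr i (face i c) C"
    using N by (subst sum.remove[of N i]) (auto simp: face_contr_other intro!: sum.neutral)
  also have "\<dots> = proj i c C - c C" using c by (rule face_contr_same)
  finally show ?thesis .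
qed

section \<open>Cells, their multidegrees, and exactness of the cubical complex\<close>

definition xy_vars :: "nat set \<Rightarrow> xy_vertex set" where
  "xy_vars N = xv ` N \<union> yv ` N"

definition cells :: "nat set set \<Rightarrow> nat \<Rightarrow> cell set" where
  "cells \<Delta> p = {(F, S). F \<in> \<Delta> \<and> S \<subseteq> F \<and> card S = p}"

definition chains :: "nat set \<Rightarrow> nat set set \<Rightarrow> nat \<Rightarrow> (cell \<Rightarrow> (xy_vertex, 'k::field) mpoly) set" where
  "chains N \<Delta> p = {c. (\<forall>C. c C \<in> polys (xy_vars N)) \<and> (\<forall>C. C \<notin> cells \<Delta> p \<longrightarrow> c C = 0)}"

text \<open>The exponent of the least common multiple of the monomials at the vertices of the cube:
  \<open>xv i\<close> occurs unless \<open>i\<close> is in every vertex, \<open>yv i\<close> if it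
  is in some vertex.\<close>

definition cshift :: "nat set \<Rightarrow> cell \<Rightarrow> xy_vertex \<Rightarrow>\<^sub>0 nat" where
  "cshift N = (\<lambda>(F, S). (\<Sum>i \<in> (N - F) \<union> S. Poly_Mapping.single (xv i) 1) + (\<Sum>i \<in> F. Poly_Mapping.single (yv i) 1))"

definition augm :: "nat set \<Rightarrow> nat set set \<Rightarrow> (cell \<Rightarrow> (xy_vertex, 'k::field) mpoly) \<Rightarrow> (xy_vertex, 'k) mpoly" where
  "augm N \<Delta> c = (\<Sum>C \<in> cells \<Delta> 0. xpow (cshift N C) * c C)"

lemma coef_cshift:
  assumes "finite N" "F \<subseteq> N" "S \<subseteq> F"
  shows "coef (cshift N (F, S)) (xv i) = (if i \<in> (N - F) \<union> S then 1 else 0)"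
    and "coef (cshift N (F, S)) (yv i) = (if i \<in> F then 1 else 0)"
proof -
  have fin: "finite ((N - F) \<union> S)" "finite F"
    using finite_subset[OF assms(2,1)] finite_subset[OF assms(3)] assms(1) by auto
  show "coef (cshift N (F, S)) (xv i) = (if i \<in> (N - F) \<union> S then 1 else 0)"
    "coef (cshift N (F, S)) (yv i) = (if i \<in> F then 1 else 0)"
    using fin by (simp_all add: cshift_def lookup_add lookup_sum lookup_single when_def)
qed

lemma polys_csgn [simp]: "csgn i T \<in> polys V"
  unfolding csgn_def by auto

text \<open>A simplicial complex on \<open>N\<close>, later the independent sets of the base graph;
  \<open>down\<close> keeps the faces of a cube among the cells.\<close>

locale subset_complex =
  fixes N :: "nat set" and \<Delta> :: "nat set set"
  assumes finite_N: "finite N" and sub: "F \<in> \<Delta> \<Longrightarrow> F \<subseteq> N"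
    and down: "F \<in> \<Delta> \<Longrightarrow> F' \<subseteq> F \<Longrightarrow> F' \<in> \<Delta>"
begin

lemma finite_Delta: "F \<in> \<Delta> \<Longrightarrow> finite F" "finite \<Delta>"
  using sub finite_N finite_subset[of F N] finite_subset[of \<Delta> "Pow N"] by auto

lemma finite_cells: "finite (cells \<Delta> p)"
proof (rule finite_subset)
  show "cells \<Delta> p \<subseteq> \<Delta> \<times> Pow N" using sub by (auto simp: cells_def)
  show "finite (\<Delta> \<times> Pow N)" using finite_Delta finite_N by simp
qed

lemma cells_empty: "card N < p \<Longrightarrow> cells \<Delta> p = {}"
proof (rule ccontr)
  assume "card N < p" "cells \<Delta> p \<noteq> {}"
  then obtain F S where "F \<in> \<Delta>" "S \<subseteq> F" "card S = p" by (auto simp: cells_def)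
  then show False using \<open>card N < p\<close> sub[of F] card_mono[OF finite_N, of S] by auto
qed

lemma cells_insert1:
  assumes "(F, insert i T) \<in> cells \<Delta> (Suc p)" "i \<notin> T"
  shows "(F, T) \<in> cells \<Delta> p" "i \<in> N"
proof -
  have *: "F \<in> \<Delta>" "insert i T \<subseteq> F" "card (insert i T) = Suc p" using assms by (auto simp: cells_def)
  then have "finite T" using finite_subset[OF _ finite_Delta(1)[OF *(1)], of T] by simp
  then show "(F, T) \<in> cells \<Delta> p" "i \<in> N" using * assms(2) sub[of F] by (auto simp: cells_def)
qed

lemma cells_insert2:
  assumes "(insert i F, insert i T) \<in> cells \<Delta> (Suc p)" "i \<notin> T" "i \<notin> F"
  shows "(F, T) \<in> cells \<Delta> p" "i \<in> N"
proof -
  have *: "insert i F \<in> \<Delta>" "insert i T \<subseteq> insert i F" "card (insert i T) = Suc p"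
    using assms by (auto simp: cells_def)
  then have "finite T" using finite_subset[OF _ finite_Delta(1)[OF *(1)], of T] by simp
  moreover have "F \<in> \<Delta>" using *(1) subset_insertI by (rule down)
  ultimately show "(F, T) \<in> cells \<Delta> p" "i \<in> N" using * assms(2) sub[of "insert i F"] by (auto simp: cells_def)
qed

lemma chainsD:
  assumes "c \<in> chains N \<Delta> p"
  shows "c C \<in> polys (xy_vars N)" "C \<notin> cells \<Delta> p \<Longrightarrow> c C = 0" "\<not> T \<subseteq> F \<Longrightarrow> c (F, T) = 0"
proof -
  show "c C \<in> polys (xy_vars N)" and z: "C \<notin> cells \<Delta> p \<Longrightarrow> c C = 0" for C
    using assms unfolding chains_def by blast+
  show "\<not> T \<subseteq> F \<Longrightarrow> c (F, T) = 0" by (rule z) (simp add: cells_def)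
qed

lemma bd_chains:
  assumes c: "c \<in> chains N \<Delta> (Suc p)"
  shows "bd N c \<in> chains N \<Delta> p"
  unfolding chains_def
proof (intro CollectI conjI allI impI)
  fix C :: cell
  obtain F T where C: "C = (F, T)" by (cases C)
  show "bd N c C \<in> polys (xy_vars N)"
    unfolding bd_def C
    by (rule polys_sum) (auto simp: face_def xy_vars_def intro!: polys_mult polys_uminus chainsD(1)[OF c, unfolded xy_vars_def])
  assume n: "C \<notin> cells \<Delta> p"
  have "face i c C = 0" for i
  proof -
    have "c (F, insert i T) = 0" if "i \<notin> T"
      using cells_insert1[of F i T p] that n C chainsD(2)[OF c] by blast
    moreover have "c (insert i F, insert i T) = 0" if "i \<notin> T" "i \<notin> F"
      using cells_insert2[of i F T p] that n C chainsD(2)[OF c] by blast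
    ultimately show ?thesis by (simp add: C face_def)
  qed
  then show "bd N c C = 0" by (simp add: bd_def)
qed

lemma contr_chains:
  assumes c: "c \<in> chains N \<Delta> p"
  shows "contr i c \<in> chains N \<Delta> (Suc p)"
  unfolding chains_def
proof (intro CollectI conjI allI impI)
  fix C :: cell
  obtain F T where C: "C = (F, T)" by (cases C)
  show "contr i c C \<in> polys (xy_vars N)"
    by (auto simp: C contr_def intro!: polys_mult polys_vdiv chainsD(1)[OF c])
  assume n: "C \<notin> cells \<Delta> (Suc p)"
  show "contr i c C = 0"
  proof (cases "i \<in> T \<and> i \<in> F")
    case True
    have "(F, T - {i}) \<notin> cells \<Delta> p"
    proof
      assume *: "(F, T - {i}) \<in> cells \<Delta> p"
      then have "F \<in> \<Delta>" "T - {i} \<subseteq> F" by (auto simp: cells_def)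
      then have "finite (T - {i})" using finite_subset[OF _ finite_Delta(1)] by blast
      then have "card T = Suc (card (T - {i}))" using True by (intro card.remove) auto
      then show False using * True n by (auto simp: cells_def C)
    qed
    then show ?thesis using chainsD(2)[OF c] by (simp add: C contr_def)
  qed (auto simp: C contr_def)
qed

lemma chains_add: "c \<in> chains N \<Delta> p \<Longrightarrow> c' \<in> chains N \<Delta> p \<Longrightarrow> (\<lambda>C. c C + c' C) \<in> chains N \<Delta> p"
  by (auto simp: chains_def)

lemma chains_uminus: "c \<in> chains N \<Delta> p \<Longrightarrow> (\<lambda>C. - c C) \<in> chains N \<Delta> p"
  by (auto simp: chains_def)

text \<open>The normal form produced by \<open>proj i\<close>: nothing extends in direction
  \<open>i\<close>, and no multiple of \<open>pvar (xv i)\<close> is left to trade.\<close>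

definition reduced :: "nat \<Rightarrow> (cell \<Rightarrow> (xy_vertex, 'k::field) mpoly) \<Rightarrow> bool" where
  "reduced i c \<longleftrightarrow> (\<forall>F T. (i \<in> T \<longrightarrow> c (F, T) = 0) \<and> (i \<in> F \<longrightarrow> free_of (xv i) (c (F, T))))"

lemma free_of_vdiv: "free_of v p \<Longrightarrow> free_of v (vdiv w p)"
  unfolding free_of_iff by simp

lemma free_of_vzero_other: "free_of v p \<Longrightarrow> free_of v (vzero w p)"
  unfolding free_of_iff by simp

lemma reduced_proj: "reduced i (proj i c)"
  unfolding reduced_def proj_def by simp

lemma reduced_proj_other:
  assumes "reduced i c"
  shows "reduced i (proj j c)"
  using assms unfolding reduced_def proj_def
  by (auto intro!: free_of_vzero_other free_of_closed(3,5) free_of_vdiv)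

text \<open>The cubes are contracted one coordinate at a time: \<open>bd_contr\<close> turns a cycle \<open>z\<close> into the
  homologous cycle \<open>proj i z\<close>, without changing what has been achieved for the other coordinates.\<close>

lemma reduce_cycle:
  assumes z: "z \<in> chains N \<Delta> p" "\<And>D. p = Suc q \<Longrightarrow> bd N z D = 0" "p = 0 \<or> p = Suc q"
    and A: "finite A" "A \<subseteq> N"
  shows "\<exists>b \<in> chains N \<Delta> (Suc p). \<forall>i \<in> A. reduced i (\<lambda>C. z C + bd N b C)"
  using A
proof (induction A rule: finite_induct)
  case empty
  have "(\<lambda>_. 0) \<in> chains N \<Delta> (Suc p)" by (auto simp: chains_def)
  then show ?case by blast
next
  case (insert i A)
  then obtain b where b: "b \<in> chains N \<Delta> (Suc p)" "\<And>j. j \<in> A \<Longrightarrow> reduced j (\<lambda>C. z C + bd N b C)" by blast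
  define z' where "z' = (\<lambda>C. z C + bd N b C)"
  have z': "z' \<in> chains N \<Delta> p" unfolding z'_def by (rule chains_add[OF z(1) bd_chains[OF b(1)]])
  \<comment> \<open>There is no cycle condition for \<open>p = 0\<close>; there the boundary
    vanishes because no cell of dimension 0 has a nonempty second component.\<close>
  have bdz': "contr i (bd N z') C = 0" for C
  proof (cases "p = 0")
    case True
    obtain F T where C: "C = (F, T)" by (cases C)
    have "bd N z' (F, T - {i}) = 0"
      unfolding bd_def
    proof (rule sum.neutral, rule ballI)
      fix j
      have "z' (G, insert j U) = 0" for G U
      proof (rule chainsD(2)[OF z'])
        show "(G, insert j U) \<notin> cells \<Delta> p"
        proof
          assume "(G, insert j U) \<in> cells \<Delta> p"
          then have "G \<in> \<Delta>" "insert j U \<subseteq> G" "card (insert j U) = 0" using True by (auto simp: cells_def)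
          then show False using finite_subset[OF _ finite_Delta(1)[of G]] by (metis card_0_eq insert_not_empty)
        qed
      qed
      then show "face j z' (F, T - {i}) = 0" by (simp add: face_def)
    qed
    then show ?thesis by (simp add: C contr_def)
  next
    case False
    then have "p = Suc q" using z(3) by simp
    then have "bd N z' D = 0" for D unfolding z'_def bd_add using z(2) bd_bd[OF finite_N] by simp
    then show ?thesis by (cases C) (simp add: contr_def)
  qed
  have eq: "z' C + bd N (contr i z') C = proj i z' C" for C
  proof -
    have "bd N (contr i z') C + contr i (bd N z') C = proj i z' C - z' C"
      using finite_N _ chainsD(3)[OF z'] by (rule bd_contr) (use insert.prems in simp)
    then show ?thesis using bdz'[of C] by (simp add: algebra_simps)
  qed
  let ?b = "\<lambda>C. b C + contr i z' C"
  have "?b \<in> chains N \<Delta> (Suc p)" by (rule chains_add[OF b(1) contr_chains[OF z']])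
  moreover have "(\<lambda>C. z C + bd N ?b C) = proj i z'"
    unfolding bd_add using eq by (simp add: z'_def add.assoc fun_eq_iff)
  moreover have "reduced j (proj i z')" if "j \<in> insert i A" for j
    using that reduced_proj reduced_proj_other[of j z' i] b(2)[of j] unfolding z'_def by blast
  ultimately show ?case by (intro bexI[of _ ?b]) auto
qed

text \<open>Every cell of positive dimension extends in some direction, where being reduced forces
  its coefficient to be zero; so the cycle cancels against the boundary found by
  \<open>reduce_cycle\<close>.\<close>

lemma exact_Suc:
  assumes z: "z \<in> chains N \<Delta> (Suc p)" "\<And>D. bd N z D = 0"
  shows "\<exists>b \<in> chains N \<Delta> (Suc (Suc p)). z = bd N b"
proof -
  obtain b where b: "b \<in> chains N \<Delta> (Suc (Suc p))" "\<And>i. i \<in> N \<Longrightarrow> reduced i (\<lambda>C. z C + bd N b C)"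
    using reduce_cycle[OF z(1) _ _ finite_N order_refl, of p] z(2) by blast
  have "z C + bd N b C = 0" for C
  proof (cases "C \<in> cells \<Delta> (Suc p)")
    case True
    then obtain F T where C: "C = (F, T)" "F \<in> \<Delta>" "T \<subseteq> F" "card T = Suc p" by (auto simp: cells_def)
    then obtain i where i: "i \<in> T" by fastforce
    then have "i \<in> N" using C sub by blast
    then show ?thesis using b(2)[of i] i C unfolding reduced_def by simp
  next
    case False
    then show ?thesis using chainsD(2)[OF z(1)] chainsD(2)[OF bd_chains[OF b(1)]] by simp
  qed
  then have "z C = bd N (\<lambda>C. - b C) C" for C unfolding bd_uminus by (simp add: eq_neg_iff_add_eq_0)
  then have "z = bd N (\<lambda>C. - b C)" by (rule ext)
  then show ?thesis using chains_uminus[OF b(1)] by blast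
qed

lemma cshift_insert1:
  assumes "F \<in> \<Delta>" "T \<subseteq> F" "i \<in> F" "i \<notin> T"
  shows "Poly_Mapping.single (xv i) 1 + cshift N (F, T) = cshift N (F, insert i T)"
proof (rule poly_mapping_eqI)
  fix v
  have s: "F \<subseteq> N" "insert i T \<subseteq> F" using assms sub by auto
  show "coef (Poly_Mapping.single (xv i) 1 + cshift N (F, T)) v = coef (cshift N (F, insert i T)) v"
    using coef_cshift[OF finite_N s(1) assms(2)] coef_cshift[OF finite_N s] assms
    by (cases v) (auto simp: lookup_add lookup_single when_def)
qed

lemma cshift_insert2:
  assumes "insert i F \<in> \<Delta>" "T \<subseteq> F" "i \<notin> F"
  shows "Poly_Mapping.single (yv i) 1 + cshift N (F, T) = cshift N (insert i F, insert i T)"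
proof (rule poly_mapping_eqI)
  fix v
  have s: "insert i F \<subseteq> N" "insert i T \<subseteq> insert i F" "F \<subseteq> N" using assms sub by blast+
  show "coef (Poly_Mapping.single (yv i) 1 + cshift N (F, T)) v = coef (cshift N (insert i F, insert i T)) v"
    using coef_cshift[OF finite_N s(3) assms(2)] coef_cshift[OF finite_N s(1,2)] assms s
    by (cases v) (auto simp: lookup_add lookup_single when_def)
qed

lemma cells_0: "cells \<Delta> 0 = (\<lambda>F. (F, {})) ` \<Delta>"
proof
  show "cells \<Delta> 0 \<subseteq> (\<lambda>F. (F, {})) ` \<Delta>"
  proof
    fix C assume "C \<in> cells \<Delta> 0"
    then obtain F S where "C = (F, S)" "F \<in> \<Delta>" "S \<subseteq> F" "card S = 0" by (auto simp: cells_def)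
    moreover then have "S = {}" using finite_subset[OF _ finite_Delta(1)] by (metis card_0_eq)
    ultimately show "C \<in> (\<lambda>F. (F, {})) ` \<Delta>" by blast
  qed
qed (auto simp: cells_def)

lemma augm_eq: "augm N \<Delta> c = (\<Sum>F \<in> \<Delta>. xpow (cshift N (F, {})) * c (F, {}))"
  unfolding augm_def cells_0 by (subst sum.reindex) (auto simp: inj_on_def)

text \<open>In each direction \<open>i\<close> the faces at the vertices \<open>F\<close> and
  \<open>F - {i}\<close> cancel in pairs, because \<open>pvar (xv i)\<close> times the monomial of
  \<open>F\<close> equals \<open>pvar (yv i)\<close> times that of \<open>F - {i}\<close>.\<close>

lemma augm_bd:
  fixes b :: "cell \<Rightarrow> (xy_vertex, 'k::field) mpoly"
  assumes b: "b \<in> chains N \<Delta> (Suc 0)"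
  shows "augm N \<Delta> (bd N b) = 0"
proof -
  let ?u = "\<lambda>F. xpow (cshift N (F, {})) :: (xy_vertex, 'k) mpoly"
  have "(\<Sum>F \<in> \<Delta>. ?u F * face i b (F, {})) = 0" for i
  proof -
    have "(\<Sum>F \<in> \<Delta>. ?u F * face i b (F, {})) =
        (\<Sum>F \<in> {F \<in> \<Delta>. i \<in> F}. ?u F * face i b (F, {})) + (\<Sum>F \<in> {F \<in> \<Delta>. i \<notin> F}. ?u F * face i b (F, {}))"
      using finite_Delta(2) by (subst sum.union_disjoint[symmetric]) (auto intro!: sum.cong)
    also have "(\<Sum>F \<in> {F \<in> \<Delta>. i \<notin> F}. ?u F * face i b (F, {})) =
        (\<Sum>F \<in> {F \<in> \<Delta>. i \<notin> F \<and> insert i F \<in> \<Delta>}. ?u F * face i b (F, {}))"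
    proof (rule sum.mono_neutral_right)
      show "\<forall>F \<in> {F \<in> \<Delta>. i \<notin> F} - {F \<in> \<Delta>. i \<notin> F \<and> insert i F \<in> \<Delta>}. ?u F * face i b (F, {}) = 0"
      proof
        fix F assume F: "F \<in> {F \<in> \<Delta>. i \<notin> F} - {F \<in> \<Delta>. i \<notin> F \<and> insert i F \<in> \<Delta>}"
        then have "b (insert i F, insert i {}) = 0" by (intro chainsD(2)[OF b]) (auto simp: cells_def)
        then show "?u F * face i b (F, {}) = 0" using F by (simp add: face_def)
      qed
    qed (use finite_Delta in auto)
    also have "\<dots> = (\<Sum>F \<in> {F \<in> \<Delta>. i \<in> F}. ?u (F - {i}) * face i b (F - {i}, {}))"
      by (rule sum.reindex_bij_witness[of _ "\<lambda>F. F - {i}" "insert i"]) (auto simp: insert_absorb intro: down)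
    also have "\<dots> = (\<Sum>F \<in> {F \<in> \<Delta>. i \<in> F}. - (?u F * face i b (F, {})))"
    proof (rule sum.cong[OF refl])
      fix F assume "F \<in> {F \<in> \<Delta>. i \<in> F}"
      then have F: "F \<in> \<Delta>" "i \<in> F" "insert i (F - {i}) = F" by auto
      have "pvar (yv i) * ?u (F - {i}) = xpow (cshift N (F, {i}))"
        using cshift_insert2[of i "F - {i}" "{}"] F unfolding pvar_def xpow_add[symmetric] by simp
      moreover have "pvar (xv i) * ?u F = xpow (cshift N (F, {i}))"
        using cshift_insert1[of F "{}" i] F unfolding pvar_def xpow_add[symmetric] by simp
      ultimately have e: "pvar (yv i) * ?u (F - {i}) = pvar (xv i) * ?u F" by simp
      have "?u (F - {i}) * face i b (F - {i}, {}) = csgn i {} * (pvar (yv i) * ?u (F - {i})) * b (F, {i})"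
        using F by (simp add: face_def mult_ac)
      also have "\<dots> = - (?u F * face i b (F, {}))" unfolding e using F by (simp add: face_def mult_ac)
      finally show "?u (F - {i}) * face i b (F - {i}, {}) = - (?u F * face i b (F, {}))" .
    qed
    finally show ?thesis by (simp add: sum_negf)
  qed
  moreover have "augm N \<Delta> (bd N b) = (\<Sum>i \<in> N. \<Sum>F \<in> \<Delta>. ?u F * face i b (F, {}))"
    unfolding augm_eq bd_def sum_distrib_left by (rule sum.swap)
  ultimately show ?thesis by simp
qed

text \<open>After reduction the augmentation admits no cancellation: the coefficient at
  \<open>F\<close> is free of \<open>pvar (xv i)\<close> for \<open>i\<close> in \<open>F\<close>,
  so every monomial of the sum reveals \<open>F\<close> as the set of those \<open>i\<close> for
  which \<open>xv i\<close> is missing.\<close>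

lemma exact_0:
  fixes z :: "cell \<Rightarrow> (xy_vertex, 'k::field) mpoly"
  assumes z: "z \<in> chains N \<Delta> 0" "augm N \<Delta> z = 0"
  shows "\<exists>b \<in> chains N \<Delta> (Suc 0). z = bd N b"
proof -
  obtain b where b: "b \<in> chains N \<Delta> (Suc 0)" "\<And>i. i \<in> N \<Longrightarrow> reduced i (\<lambda>C. z C + bd N b C)"
    using reduce_cycle[OF z(1) _ _ finite_N order_refl] by blast
  define z' where "z' = (\<lambda>C. z C + bd N b C)"
  have z': "z' \<in> chains N \<Delta> 0" unfolding z'_def by (rule chains_add[OF z(1) bd_chains[OF b(1)]])
  have "augm N \<Delta> z' = augm N \<Delta> z + augm N \<Delta> (bd N b)"
    unfolding z'_def augm_def by (simp add: distrib_left sum.distrib)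
  then have aug: "augm N \<Delta> z' = 0" using z(2) augm_bd[OF b(1)] by simp
  have free: "coef m (xv i) = 0" if "F \<in> \<Delta>" "i \<in> F" "m \<in> supp (z' (F, {}))" for F i m
    using b(2)[of i] that sub[of F] unfolding reduced_def z'_def free_of_def by blast
  have rec: "F = {i \<in> N. coef (cshift N (F, {}) + m) (xv i) = 0}" if "F \<in> \<Delta>" "m \<in> supp (z' (F, {}))" for F m
    using free[OF that(1) _ that(2)] sub[OF that(1)] coef_cshift(1)[OF finite_N sub[OF that(1)] empty_subsetI]
    by (auto simp: lookup_add)
  have "z' (F, {}) = 0" if F: "F \<in> \<Delta>" for F
  proof (rule ccontr)
    assume "z' (F, {}) \<noteq> 0"
    then obtain m where m: "m \<in> supp (z' (F, {}))" by (metis ex_in_conv keys_eq_empty)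
    let ?M = "cshift N (F, {}) + m"
    have "coef (xpow (cshift N (G, {})) * z' (G, {})) ?M = 0" if G: "G \<in> \<Delta>" "G \<noteq> F" for G
    proof (rule ccontr)
      assume "\<not> ?thesis"
      then have "?M \<in> supp (xpow (cshift N (G, {})) * z' (G, {}))" by (simp add: in_keys_iff)
      then obtain m' where "?M = cshift N (G, {}) + m'" "m' \<in> supp (z' (G, {}))"
        unfolding supp_xpow_mult by auto
      then show False using rec[OF F m] rec[OF G(1), of m'] G(2) by simp
    qed
    then have "coef (augm N \<Delta> z') ?M = coef (xpow (cshift N (F, {})) * z' (F, {})) ?M"
      unfolding augm_eq lookup_sum using F finite_Delta(2)
      by (subst sum.remove[of \<Delta> F]) (auto intro!: sum.neutral)
    then show False using aug m by (simp add: coef_xpow_mult in_keys_iff)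
  qed
  then have "z' C = 0" for C
    using chainsD(2)[OF z', of C] by (cases "C \<in> cells \<Delta> 0") (auto simp: cells_0)
  then have "z C = bd N (\<lambda>C. - b C) C" for C unfolding bd_uminus z'_def by (simp add: eq_neg_iff_add_eq_0)
  then have "z = bd N (\<lambda>C. - b C)" by (rule ext)
  then show ?thesis using chains_uminus[OF b(1)] by blast
qed

end


section \<open>Chains as vectors and boundary maps as matrices\<close>

definition cell_list :: "nat set set \<Rightarrow> nat \<Rightarrow> cell list" where
  "cell_list \<Delta> p = (SOME l. set l = cells \<Delta> p \<and> distinct l)"

definition unit_chain :: "cell \<Rightarrow> cell \<Rightarrow> (xy_vertex, 'k::field) mpoly" where
  "unit_chain C = (\<lambda>D. if D = C then 1 else 0)"

definition cubical_shifts :: "nat set \<Rightarrow> nat set set \<Rightarrow> nat \<Rightarrow> (xy_vertex \<Rightarrow>\<^sub>0 nat) list" where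
  "cubical_shifts N \<Delta> k = map (cshift N) (cell_list \<Delta> k)"

definition cubical_mat :: "nat set \<Rightarrow> nat set set \<Rightarrow> nat \<Rightarrow> (xy_vertex, 'k::field) mpoly mat" where
  "cubical_mat N \<Delta> k = (case k of
     0 \<Rightarrow> mat 1 (length (cell_list \<Delta> 0)) (\<lambda>(i, j). xpow (cshift N (cell_list \<Delta> 0 ! j)))
   | Suc l \<Rightarrow> mat (length (cell_list \<Delta> l)) (length (cell_list \<Delta> (Suc l)))
       (\<lambda>(i, j). bd N (unit_chain (cell_list \<Delta> (Suc l) ! j)) (cell_list \<Delta> l ! i)))"

definition chain_of :: "nat set set \<Rightarrow> nat \<Rightarrow> (xy_vertex, 'k::field) mpoly vec \<Rightarrow> cell \<Rightarrow> (xy_vertex, 'k) mpoly" where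
  "chain_of \<Delta> p u = (\<lambda>C. \<Sum>j < length (cell_list \<Delta> p). u $ j * unit_chain (cell_list \<Delta> p ! j) C)"

definition vec_of :: "nat set set \<Rightarrow> nat \<Rightarrow> (cell \<Rightarrow> (xy_vertex, 'k::field) mpoly) \<Rightarrow> (xy_vertex, 'k) mpoly vec" where
  "vec_of \<Delta> p c = vec (length (cell_list \<Delta> p)) (\<lambda>j. c (cell_list \<Delta> p ! j))"

context subset_complex
begin

lemma cell_list: "set (cell_list \<Delta> p) = cells \<Delta> p" "distinct (cell_list \<Delta> p)"
proof -
  have "\<exists>l. set l = cells \<Delta> p \<and> distinct l" using finite_distinct_list[OF finite_cells] by blast
  then have "set (cell_list \<Delta> p) = cells \<Delta> p \<and> distinct (cell_list \<Delta> p)"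
    unfolding cell_list_def by (rule someI_ex)
  then show "set (cell_list \<Delta> p) = cells \<Delta> p" "distinct (cell_list \<Delta> p)" by blast+
qed

lemma sum_cell_list: "(\<Sum>j < length (cell_list \<Delta> p). f (cell_list \<Delta> p ! j)) = (\<Sum>C \<in> cells \<Delta> p. f C)"
  using sum.reindex_bij_betw[OF bij_betw_nth[OF cell_list(2) refl refl], of f p] by (simp add: cell_list(1))

lemma nth_cell_list: "j < length (cell_list \<Delta> p) \<Longrightarrow> cell_list \<Delta> p ! j \<in> cells \<Delta> p"
  using cell_list(1) nth_mem by blast

lemma chain_of_nth:
  assumes j: "j < length (cell_list \<Delta> p)"
  shows "chain_of \<Delta> p u (cell_list \<Delta> p ! j) = u $ j"
proof -
  have "chain_of \<Delta> p u (cell_list \<Delta> p ! j) = (\<Sum>i < length (cell_list \<Delta> p). if i = j then u $ i else 0)"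
    unfolding chain_of_def unit_chain_def
    using nth_eq_iff_index_eq[OF cell_list(2)] j by (intro sum.cong) auto
  then show ?thesis using j by simp
qed

lemma vec_of_chain_of: "u \<in> carrier_vec (length (cell_list \<Delta> p)) \<Longrightarrow> vec_of \<Delta> p (chain_of \<Delta> p u) = u"
  by (rule eq_vecI) (auto simp: vec_of_def chain_of_nth)

lemma chain_of_notin: "C \<notin> cells \<Delta> p \<Longrightarrow> chain_of \<Delta> p u C = 0"
  unfolding chain_of_def unit_chain_def using nth_cell_list by (intro sum.neutral) auto

lemma chain_of_vec_of:
  assumes c: "c \<in> chains N \<Delta> p"
  shows "chain_of \<Delta> p (vec_of \<Delta> p c) = c"
proof
  fix C
  show "chain_of \<Delta> p (vec_of \<Delta> p c) C = c C"
  proof (cases "C \<in> cells \<Delta> p")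
    case True
    then obtain j where j: "j < length (cell_list \<Delta> p)" "cell_list \<Delta> p ! j = C"
      using cell_list(1)[of p] by (metis in_set_conv_nth)
    then show ?thesis using chain_of_nth[OF j(1), of "vec_of \<Delta> p c"] by (simp add: vec_of_def)
  next
    case False
    then show ?thesis using chain_of_notin[OF False] chainsD(2)[OF c False] by simp
  qed
qed

lemma chain_of_chains:
  assumes "u \<in> free_vecs (xy_vars N) (length (cell_list \<Delta> p))"
  shows "chain_of \<Delta> p u \<in> chains N \<Delta> p"
  unfolding chains_def
proof (intro CollectI conjI allI impI)
  fix C
  show "chain_of \<Delta> p u C \<in> polys (xy_vars N)"
    unfolding chain_of_def unit_chain_def using assms by (intro polys_sum polys_mult) (auto simp: free_vecs_iff)
qed (rule chain_of_notin)

lemma vec_of_free: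
  assumes "c \<in> chains N \<Delta> p"
  shows "vec_of \<Delta> p c \<in> free_vecs (xy_vars N) (length (cell_list \<Delta> p))"
  unfolding free_vecs_iff vec_of_def using chainsD(1)[OF assms] by simp

lemma cubical_mat_carrier:
  "cubical_mat N \<Delta> 0 \<in> carrier_mat 1 (length (cell_list \<Delta> 0))"
  "cubical_mat N \<Delta> (Suc k) \<in> carrier_mat (length (cell_list \<Delta> k)) (length (cell_list \<Delta> (Suc k)))"
  by (simp_all add: cubical_mat_def)

lemma cubical_mat_Suc_mult:
  assumes u: "u \<in> carrier_vec (length (cell_list \<Delta> (Suc k)))"
  shows "cubical_mat N \<Delta> (Suc k) *\<^sub>v u = vec_of \<Delta> k (bd N (chain_of \<Delta> (Suc k) u))"
proof (rule eq_vecI)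
  show "dim_vec (cubical_mat N \<Delta> (Suc k) *\<^sub>v u) = dim_vec (vec_of \<Delta> k (bd N (chain_of \<Delta> (Suc k) u)))"
    by (simp add: cubical_mat_def vec_of_def)
  fix i assume "i < dim_vec (vec_of \<Delta> k (bd N (chain_of \<Delta> (Suc k) u)))"
  then have i: "i < length (cell_list \<Delta> k)" by (simp add: vec_of_def)
  have "(cubical_mat N \<Delta> (Suc k) *\<^sub>v u) $ i =
      (\<Sum>j < length (cell_list \<Delta> (Suc k)). cubical_mat N \<Delta> (Suc k) $$ (i, j) * u $ j)"
    by (rule index_mult_vec_sum[OF cubical_mat_carrier(2) u i])
  also have "\<dots> = (\<Sum>j < length (cell_list \<Delta> (Suc k)).
      u $ j * bd N (unit_chain (cell_list \<Delta> (Suc k) ! j)) (cell_list \<Delta> k ! i))"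
    using i by (intro sum.cong) (auto simp: cubical_mat_def mult.commute)
  also have "\<dots> = bd N (chain_of \<Delta> (Suc k) u) (cell_list \<Delta> k ! i)"
    unfolding chain_of_def bd_sum bd_scale ..
  finally show "(cubical_mat N \<Delta> (Suc k) *\<^sub>v u) $ i = vec_of \<Delta> k (bd N (chain_of \<Delta> (Suc k) u)) $ i"
    using i by (simp add: vec_of_def)
qed

lemma cubical_mat_0_mult:
  assumes u: "u \<in> carrier_vec (length (cell_list \<Delta> 0))"
  shows "(cubical_mat N \<Delta> 0 *\<^sub>v u) $ 0 = augm N \<Delta> (chain_of \<Delta> 0 u)"
proof -
  have "(cubical_mat N \<Delta> 0 *\<^sub>v u) $ 0 =
      (\<Sum>j < length (cell_list \<Delta> 0). cubical_mat N \<Delta> 0 $$ (0, j) * u $ j)"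
    by (rule index_mult_vec_sum[OF cubical_mat_carrier(1) u]) simp
  also have "\<dots> = (\<Sum>j < length (cell_list \<Delta> 0).
      xpow (cshift N (cell_list \<Delta> 0 ! j)) * chain_of \<Delta> 0 u (cell_list \<Delta> 0 ! j))"
    by (intro sum.cong) (auto simp: cubical_mat_def chain_of_nth)
  also have "\<dots> = augm N \<Delta> (chain_of \<Delta> 0 u)"
    unfolding augm_def by (rule sum_cell_list)
  finally show ?thesis .
qed

lemma unit_chain_chains:
  "C \<in> cells \<Delta> p \<Longrightarrow> unit_chain C \<in> chains N \<Delta> p"
  by (auto simp: chains_def unit_chain_def)

lemma cshift_vars: "C \<in> cells \<Delta> p \<Longrightarrow> supp (cshift N C) \<subseteq> xy_vars N"
proof
  fix v assume C: "C \<in> cells \<Delta> p" and v: "v \<in> supp (cshift N C)"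
  obtain F S where FS: "C = (F, S)" "F \<subseteq> N" "S \<subseteq> F" using C sub by (auto simp: cells_def)
  show "v \<in> xy_vars N"
    using v coef_cshift[OF finite_N FS(2,3)] FS
    by (cases v) (auto simp: in_keys_iff xy_vars_def split: if_splits)
qed

lemma augm_image:
  "{augm N \<Delta> c | c. c \<in> chains N \<Delta> 0} =
    (polyideal (xy_vars N) (xpow ` cshift N ` cells \<Delta> 0) :: (xy_vertex, 'k::field) mpoly set)"
  (is "?L = polyideal ?V ?G")
proof
  have GV: "?G \<subseteq> polys ?V" using cshift_vars by auto
  note id = ideal_polyD[OF polyideal_ideal[OF GV]]
  show "?L \<subseteq> polyideal ?V ?G"
  proof clarify
    fix c :: "cell \<Rightarrow> (xy_vertex, 'k) mpoly" assume c: "c \<in> chains N \<Delta> 0"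
    show "augm N \<Delta> c \<in> polyideal ?V ?G"
      unfolding augm_def
    proof (rule ideal_poly_sum[OF polyideal_ideal[OF GV]])
      fix C assume "C \<in> cells \<Delta> 0"
      then have "xpow (cshift N C) \<in> polyideal ?V ?G" by (intro polyideal_mem[OF GV]) blast
      then show "xpow (cshift N C) * c C \<in> polyideal ?V ?G" by (rule id(7)[OF chainsD(1)[OF c]])
    qed
  qed
  have "ideal ?L (poly_ring ?V)"
  proof (rule ideal_poly_ringI)
    show "?L \<subseteq> polys ?V"
      using \<open>?L \<subseteq> polyideal ?V ?G\<close> id(1) by (rule subset_trans)
    show "0 \<in> ?L" by (intro CollectI exI[of _ "\<lambda>_. 0"]) (auto simp: augm_def chains_def)
    fix p q :: "(xy_vertex, 'k) mpoly"
    assume q: "q \<in> ?L"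
    then obtain c' where c': "q = augm N \<Delta> c'" "c' \<in> chains N \<Delta> 0" by blast
    show "p + q \<in> ?L" if p: "p \<in> ?L"
    proof -
      obtain c where c: "p = augm N \<Delta> c" "c \<in> chains N \<Delta> 0" using p by blast
      have "p + q = augm N \<Delta> (\<lambda>C. c C + c' C)"
        unfolding c c' augm_def by (simp add: distrib_left sum.distrib)
      then show ?thesis using chains_add[OF c(2) c'(2)] by blast
    qed
    show "p * q \<in> ?L" if p: "p \<in> polys ?V"
    proof -
      have "p * q = augm N \<Delta> (\<lambda>C. p * c' C)"
        unfolding c' augm_def by (simp add: sum_distrib_left mult_ac)
      moreover have "(\<lambda>C. p * c' C) \<in> chains N \<Delta> 0" using c'(2) p by (auto simp: chains_def)
      ultimately show ?thesis by blast
    qed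
  qed
  moreover have "?G \<subseteq> ?L"
  proof clarify
    fix F S assume C: "(F, S) \<in> cells \<Delta> 0"
    have "augm N \<Delta> (unit_chain (F, S)) = (\<Sum>D \<in> cells \<Delta> 0. if D = (F, S) then xpow (cshift N D) else 0)"
      unfolding augm_def unit_chain_def by (intro sum.cong) auto
    also have "\<dots> = xpow (cshift N (F, S))" using C finite_cells by simp
    finally show "\<exists>c. xpow (cshift N (F, S)) = augm N \<Delta> c \<and> c \<in> chains N \<Delta> 0"
      using unit_chain_chains[OF C] by metis
  qed
  ultimately show "polyideal ?V ?G \<subseteq> ?L" by (rule polyideal_least)
qed

text \<open>The nonzero entries of the boundary matrices are single variables up to sign. This gives
  homogeneity and, as no variable is constant, minimality of the resolution.\<close>

lemma supp_bd_unit_chain: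
  assumes "C' \<in> cells \<Delta> (Suc p)" "m \<in> supp (bd N (unit_chain C') C :: (xy_vertex, 'k::field) mpoly)"
  shows "m + cshift N C = cshift N C'" "m \<noteq> 0"
proof -
  obtain F T where C: "C = (F, T)" by (cases C)
  obtain F' S where C': "C' = (F', S)" "F' \<in> \<Delta>" "S \<subseteq> F'" using assms(1) by (auto simp: cells_def)
  have "\<exists>i \<in> N. m \<in> supp (face i (unit_chain C') C :: (xy_vertex, 'k) mpoly)"
  proof (rule ccontr)
    assume "\<not> ?thesis"
    then have "coef (bd N (unit_chain C') C :: (xy_vertex, 'k) mpoly) m = 0"
      by (auto simp: bd_def lookup_sum in_keys_iff)
    then show False using assms(2) by (simp add: in_keys_iff)
  qed
  then obtain i where i: "m \<in> supp (face i (unit_chain C') C :: (xy_vertex, 'k) mpoly)" by blast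
  have supp_var: "n = Poly_Mapping.single v 1" if n: "n \<in> supp (csgn i T * (pvar v * 1) :: (xy_vertex, 'k) mpoly)" for n v
  proof -
    have "csgn i T * (pvar v * 1) = (pvar v :: (xy_vertex, 'k) mpoly) \<or> csgn i T * (pvar v * 1) = - (pvar v :: (xy_vertex, 'k) mpoly)"
      unfolding csgn_def by (cases "even (card {j \<in> T. j < i})") auto
    then have "n \<in> supp (pvar v :: (xy_vertex, 'k) mpoly)" using n by auto
    then show ?thesis by (simp add: pvar_def xpow_def)
  qed
  have nz: "Poly_Mapping.single v (1::nat) \<noteq> 0" for v :: xy_vertex
    by (metis lookup_single_eq lookup_zero zero_neq_one)
  have nT: "i \<notin> T" using i by (auto simp: C face_def)
  have "m + cshift N C = cshift N C' \<and> m \<noteq> 0"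
  proof (cases "i \<in> F")
    case True
    then have f: "face i (unit_chain C') C = - (csgn i T * (pvar (xv i) * unit_chain C' (F, insert i T)) :: (xy_vertex, 'k) mpoly)"
      using nT by (simp add: C face_def)
    have eq: "(F, insert i T) = C'"
      using i unfolding f by (auto simp: unit_chain_def split: if_splits)
    have "m = Poly_Mapping.single (xv i) 1"
      by (rule supp_var) (use i[unfolded f eq] in \<open>simp add: unit_chain_def\<close>)
    moreover have "Poly_Mapping.single (xv i) 1 + cshift N (F, T) = cshift N (F, insert i T)"
      using eq C' nT True by (intro cshift_insert1) auto
    ultimately show ?thesis using nz[of "xv i"] unfolding C eq[symmetric] by metis
  next
    case False
    then have f: "face i (unit_chain C') C = (csgn i T * (pvar (yv i) * unit_chain C' (insert i F, insert i T)) :: (xy_vertex, 'k) mpoly)"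
      using nT by (simp add: C face_def)
    have eq: "(insert i F, insert i T) = C'"
      using i unfolding f by (auto simp: unit_chain_def split: if_splits)
    have "m = Poly_Mapping.single (yv i) 1"
      by (rule supp_var) (use i[unfolded f eq] in \<open>simp add: unit_chain_def\<close>)
    moreover have "Poly_Mapping.single (yv i) 1 + cshift N (F, T) = cshift N (insert i F, insert i T)"
      using eq C' nT False by (intro cshift_insert2) auto
    ultimately show ?thesis using nz[of "yv i"] unfolding C eq[symmetric] by metis
  qed
  then show "m + cshift N C = cshift N C'" "m \<noteq> 0" by blast+
qed

theorem cubical_resolution:
  "minimal_free_resolution id (xy_vars N)
    (polyideal (xy_vars N) (xpow ` cshift N ` cells \<Delta> 0) :: (xy_vertex, 'k::field) mpoly set)
    (cubical_shifts N \<Delta>) (cubical_mat N \<Delta>)"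
proof -
  let ?V = "xy_vars N" and ?F = "cubical_shifts N \<Delta>"
  let ?d = "cubical_mat N \<Delta> :: nat \<Rightarrow> (xy_vertex, 'k) mpoly mat"
  let ?l = "\<lambda>k. length (cell_list \<Delta> k)"
  have len: "length (?F k) = ?l k" for k by (simp add: cubical_shifts_def)
  have nthF: "?F k ! j = cshift N (cell_list \<Delta> k ! j)" if "j < ?l k" for k j
    using that by (simp add: cubical_shifts_def)
  have polysV: "?d 0 $$ (0, j) \<in> polys ?V" if "j < ?l 0" for j
    using that cshift_vars[OF nth_cell_list] by (simp add: cubical_mat_def)
  have polysS: "?d (Suc k) $$ (i, j) \<in> polys ?V" if "i < ?l k" "j < ?l (Suc k)" for i j k
    using that chainsD(1)[OF bd_chains[OF unit_chain_chains[OF nth_cell_list]]] by (simp add: cubical_mat_def)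
  have c1: "\<exists>r. \<forall>k > r. ?F k = []"
  proof (intro exI[of _ "card N"] allI impI)
    fix k assume "card N < k"
    then have "set (cell_list \<Delta> k) = {}" using cell_list(1) cells_empty by simp
    then show "?F k = []" by (simp add: cubical_shifts_def)
  qed
  have c2: "?d k \<in> carrier_mat (length (res_target ?F k)) (length (?F k)) \<and> elements_mat (?d k) \<subseteq> polys ?V" for k
  proof (cases k)
    case 0
    have car: "?d 0 \<in> carrier_mat 1 (?l 0)" by (rule cubical_mat_carrier)
    have "pmat ?V 1 (?l 0) (?d 0)" unfolding pmat_def using car polysV by auto
    then show ?thesis using car pmat_iff_elements[OF car] by (simp add: 0 res_target_def len)
  next
    case (Suc l)
    have car: "?d (Suc l) \<in> carrier_mat (?l l) (?l (Suc l))" by (rule cubical_mat_carrier)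
    have "pmat ?V (?l l) (?l (Suc l)) (?d (Suc l))" unfolding pmat_def using car polysS by auto
    then show ?thesis using car pmat_iff_elements[OF car] by (simp add: Suc res_target_def len)
  qed
  have c3: "id m + res_target ?F k ! i = ?F k ! j"
    if ij: "i < length (res_target ?F k)" "j < length (?F k)" and m: "m \<in> supp (?d k $$ (i, j))" for k i j m
  proof (cases k)
    case 0
    then have "m = cshift N (cell_list \<Delta> 0 ! j)"
      using ij m by (simp add: res_target_def len cubical_mat_def xpow_def)
    then show ?thesis using 0 ij by (simp add: res_target_def len nthF)
  next
    case (Suc l)
    then have ij': "i < ?l l" "j < ?l (Suc l)" using ij by (simp_all add: res_target_def len)
    then have "m \<in> supp (bd N (unit_chain (cell_list \<Delta> (Suc l) ! j)) (cell_list \<Delta> l ! i) :: (xy_vertex, 'k) mpoly)"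
      using m by (simp add: Suc cubical_mat_def)
    from supp_bd_unit_chain(1)[OF nth_cell_list[OF ij'(2)] this]
    show ?thesis using ij' by (simp add: Suc res_target_def nthF)
  qed
  have c4: "coef p 0 = 0" if p: "p \<in> elements_mat (?d (Suc k))" for k p
  proof -
    obtain i j where ij: "i < ?l k" "j < ?l (Suc k)" "p = ?d (Suc k) $$ (i, j)"
      using elements_matD[OF p] cubical_mat_carrier(2)[of k] by (auto simp: cubical_mat_def)
    then have "p = bd N (unit_chain (cell_list \<Delta> (Suc k) ! j)) (cell_list \<Delta> k ! i)"
      by (simp add: cubical_mat_def)
    then have "0 \<notin> supp p" using supp_bd_unit_chain(2)[OF nth_cell_list[OF ij(2)]] by blast
    then show ?thesis by (simp add: in_keys_iff)
  qed
  have fc: "u \<in> carrier_vec n" if "u \<in> free_vecs ?V n" for u :: "(xy_vertex, 'k) mpoly vec" and n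
    using that by (simp add: free_vecs_iff)
  have "{(?d 0 *\<^sub>v u) $ 0 | u. u \<in> free_vecs ?V (?l 0)} = {augm N \<Delta> c | c. c \<in> chains N \<Delta> 0}"
  proof (intro equalityI subsetI)
    fix p assume "p \<in> {(?d 0 *\<^sub>v u) $ 0 | u. u \<in> free_vecs ?V (?l 0)}"
    then obtain u where u: "p = (?d 0 *\<^sub>v u) $ 0" "u \<in> free_vecs ?V (?l 0)" by blast
    then have "p = augm N \<Delta> (chain_of \<Delta> 0 u)" using cubical_mat_0_mult[OF fc] by simp
    then show "p \<in> {augm N \<Delta> c | c. c \<in> chains N \<Delta> 0}" using chain_of_chains[OF u(2)] by blast
  next
    fix p :: "(xy_vertex, 'k) mpoly" assume "p \<in> {augm N \<Delta> c | c. c \<in> chains N \<Delta> 0}"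
    then obtain c where c: "p = augm N \<Delta> c" "c \<in> chains N \<Delta> 0" by blast
    have "p = (?d 0 *\<^sub>v vec_of \<Delta> 0 c) $ 0"
      using cubical_mat_0_mult[OF fc[OF vec_of_free[OF c(2)]]] chain_of_vec_of[OF c(2)] c(1) by simp
    then show "p \<in> {(?d 0 *\<^sub>v u) $ 0 | u. u \<in> free_vecs ?V (?l 0)}" using vec_of_free[OF c(2)] by blast
  qed
  then have c5: "{(?d 0 *\<^sub>v u) $ 0 | u. u \<in> free_vecs ?V (length (?F 0))} =
      polyideal ?V (xpow ` cshift N ` cells \<Delta> 0)"
    unfolding len augm_image .
  have c6: "{?d (Suc k) *\<^sub>v u | u. u \<in> free_vecs ?V (length (?F (Suc k)))} =
      mat_kernel (?d k) \<inter> free_vecs ?V (length (?F k))" for k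
    unfolding len
  proof (intro equalityI subsetI)
    fix z assume "z \<in> {?d (Suc k) *\<^sub>v u | u. u \<in> free_vecs ?V (?l (Suc k))}"
    then obtain u where u: "z = ?d (Suc k) *\<^sub>v u" "u \<in> free_vecs ?V (?l (Suc k))" by blast
    define c where "c = chain_of \<Delta> (Suc k) u"
    have c: "c \<in> chains N \<Delta> (Suc k)" unfolding c_def by (rule chain_of_chains[OF u(2)])
    have z: "z = vec_of \<Delta> k (bd N c)" unfolding u(1) c_def by (rule cubical_mat_Suc_mult[OF fc[OF u(2)]])
    have zf: "z \<in> free_vecs ?V (?l k)" unfolding z by (rule vec_of_free[OF bd_chains[OF c]])
    have chz: "chain_of \<Delta> k z = bd N c" unfolding z by (rule chain_of_vec_of[OF bd_chains[OF c]])
    have "z \<in> mat_kernel (?d k)"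
    proof (cases k)
      case 0
      have z0: "z \<in> carrier_vec (?l 0)" using fc[OF zf] 0 by simp
      have "(?d 0 *\<^sub>v z) $ 0 = 0"
        unfolding cubical_mat_0_mult[OF z0] using chz augm_bd[of c] c 0 by simp
      then have "?d 0 *\<^sub>v z = 0\<^sub>v 1" using cubical_mat_carrier(1) by (intro eq_vecI) (auto simp: cubical_mat_def)
      then show ?thesis unfolding 0 by (rule mat_kernelI[OF cubical_mat_carrier(1) z0])
    next
      case (Suc l)
      have zl: "z \<in> carrier_vec (?l (Suc l))" using fc[OF zf] Suc by simp
      have "?d (Suc l) *\<^sub>v z = 0\<^sub>v (?l l)"
        unfolding cubical_mat_Suc_mult[OF zl] using chz bd_bd[OF finite_N, of c] Suc
        by (intro eq_vecI) (simp_all add: vec_of_def)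
      then show ?thesis unfolding Suc by (rule mat_kernelI[OF cubical_mat_carrier(2) zl])
    qed
    then show "z \<in> mat_kernel (?d k) \<inter> free_vecs ?V (?l k)" using zf by (rule IntI)
  next
    fix z assume "z \<in> mat_kernel (?d k) \<inter> free_vecs ?V (?l k)"
    then have zk: "z \<in> mat_kernel (?d k)" and zf: "z \<in> free_vecs ?V (?l k)" by simp_all
    define c where "c = chain_of \<Delta> k z"
    have c: "c \<in> chains N \<Delta> k" unfolding c_def by (rule chain_of_chains[OF zf])
    have "\<exists>b \<in> chains N \<Delta> (Suc k). c = bd N b"
    proof (cases k)
      case 0
      have z0: "z \<in> carrier_vec (?l 0)" using fc[OF zf] 0 by simp
      have "?d 0 *\<^sub>v z = 0\<^sub>v 1" using zk mat_kernelD[OF cubical_mat_carrier(1)] 0 by simp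
      then have "augm N \<Delta> c = 0" using cubical_mat_0_mult[OF z0] 0 by (simp add: c_def)
      then show ?thesis using exact_0[of c] c 0 by simp
    next
      case (Suc l)
      have zl: "z \<in> carrier_vec (?l (Suc l))" using fc[OF zf] Suc by simp
      have "?d (Suc l) *\<^sub>v z = 0\<^sub>v (?l l)" using zk mat_kernelD[OF cubical_mat_carrier(2)] Suc by simp
      then have v0: "vec_of \<Delta> l (bd N c) = 0\<^sub>v (?l l)" using cubical_mat_Suc_mult[OF zl] Suc by (simp add: c_def)
      have cl: "c \<in> chains N \<Delta> (Suc l)" using c Suc by simp
      have "bd N c = chain_of \<Delta> l (vec_of \<Delta> l (bd N c))" by (rule chain_of_vec_of[OF bd_chains[OF cl], symmetric])
      also have "\<dots> = (\<lambda>_. 0)" unfolding v0 by (simp add: chain_of_def)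
      finally have "bd N c D = 0" for D by simp
      then show ?thesis using exact_Suc[OF cl] Suc by simp
    qed
    then obtain b where b: "b \<in> chains N \<Delta> (Suc k)" "c = bd N b" by blast
    have "?d (Suc k) *\<^sub>v vec_of \<Delta> (Suc k) b = vec_of \<Delta> k (bd N b)"
      using cubical_mat_Suc_mult[OF fc[OF vec_of_free[OF b(1)]]] chain_of_vec_of[OF b(1)] by simp
    also have "\<dots> = z" unfolding b(2)[symmetric] c_def by (rule vec_of_chain_of[OF fc[OF zf]])
    finally have "z = ?d (Suc k) *\<^sub>v vec_of \<Delta> (Suc k) b" by (rule sym)
    then show "z \<in> {?d (Suc k) *\<^sub>v u | u. u \<in> free_vecs ?V (?l (Suc k))}"
      using vec_of_free[OF b(1)] by blast
  qed
  show ?thesis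
    unfolding minimal_free_resolution_def
    using c1 c2 c3 c4 c5 c6 by (intro conjI allI impI ballI) blast+
qed

corollary shifts_cover_ideal:
  "shifts id (xy_vars N) (polyideal (xy_vars N) (xpow ` cshift N ` cells \<Delta> 0) :: (xy_vertex, 'k::field) mpoly set) k
    = cshift N ` cells \<Delta> k"
proof -
  have "shifts id (xy_vars N) (polyideal (xy_vars N) (xpow ` cshift N ` cells \<Delta> 0) :: (xy_vertex, 'k) mpoly set) k
      = set (cubical_shifts N \<Delta> k)"
    by (rule shifts_eq[OF _ _ cubical_resolution]) simp_all
  then show ?thesis by (simp add: cubical_shifts_def cell_list(1))
qed

end


section \<open>Ideals with two generators\<close>

lemma supp_xpow [simp]: "supp (xpow a :: ('v, 'k::field) mpoly) = {a}"
  by (simp add: xpow_def)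

lemma total_deg_superset: "finite A \<Longrightarrow> supp a \<subseteq> A \<Longrightarrow> total_deg a = (\<Sum>v \<in> A. coef a v)"
  unfolding total_deg_def by (rule sum.mono_neutral_left) (auto simp: in_keys_iff)

lemma total_deg_add: "total_deg (a + b) = total_deg a + total_deg b"
proof -
  let ?A = "supp a \<union> supp b"
  have "total_deg (a + b) = (\<Sum>v \<in> ?A. coef (a + b) v)"
    by (rule total_deg_superset) (auto simp: supp_add_nat)
  also have "\<dots> = (\<Sum>v \<in> ?A. coef a v) + (\<Sum>v \<in> ?A. coef b v)" by (simp add: lookup_add sum.distrib)
  also have "\<dots> = total_deg a + total_deg b" using total_deg_superset[of ?A] by simp
  finally show ?thesis .
qed

lemma total_deg_0 [simp]: "total_deg 0 = 0"
  by (simp add: total_deg_def)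

lemma total_deg_single [simp]: "total_deg (Poly_Mapping.single v n) = n"
  by (simp add: total_deg_def)

lemma mdvd_total_deg: "mdvd a b \<Longrightarrow> total_deg a \<le> total_deg b"
  using mdvd_diff[of a b] total_deg_add[of a "b - a"] by simp

lemma total_deg_eq_0: "total_deg a = 0 \<longleftrightarrow> a = 0"
  by (auto simp: total_deg_def in_keys_iff intro!: poly_mapping_eqI)

lemma mdvd_eq: "mdvd a b \<Longrightarrow> total_deg b \<le> total_deg a \<Longrightarrow> a = b"
  using mdvd_diff[of a b] total_deg_add[of a "b - a"] total_deg_eq_0[of "b - a"] by simp

lemma mdvd_disjoint:
  assumes "mdvd a (b + m)" "supp a \<inter> supp b = {}"
  shows "mdvd a m"
  unfolding mdvd_def
proof
  fix v
  show "coef a v \<le> coef m v"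
  proof (cases "v \<in> supp a")
    case True
    then have "coef b v = 0" using assms(2) by (auto simp: in_keys_iff)
    then show ?thesis using assms(1) by (simp add: mdvd_def lookup_add) (metis add_0)
  qed (simp add: in_keys_iff)
qed

lemma polyideal_degree_ge:
  assumes "p \<in> polyideal V B" "B \<subseteq> polys V" "\<And>b m. b \<in> B \<Longrightarrow> m \<in> supp b \<Longrightarrow> total_deg m = d"
  shows "\<forall>m \<in> supp p. d \<le> total_deg m"
  using assms(1,2)
proof (induction rule: polyideal_induct)
  case (step a b q)
  show ?case
  proof
    fix m assume "m \<in> supp (a * b + q)"
    then consider "m \<in> supp (a * b)" | "m \<in> supp q" using Poly_Mapping.keys_add[of "a * b" q] by blast
    then show "d \<le> total_deg m"
    proof cases
      case 1
      then obtain a' b' where "m = a' + b'" "b' \<in> supp b" using Poly_Mapping.keys_mult[of a b] by blast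
      then show ?thesis using assms(3)[OF step.hyps(2)] by (simp add: total_deg_add)
    next
      case 2
      then show ?thesis using step.IH by blast
    qed
  qed
qed simp

text \<open>\<open>a\<close> and \<open>b\<close> are the coprime cofactors of the greatest common
  divisor \<open>g\<close>, and their degree is that of the coefficients in the syzygy of the two
  generators.\<close>

locale two_generators =
  fixes V :: "'v set" and g a b :: "'v \<Rightarrow>\<^sub>0 nat"
  assumes vars: "supp (g + a) \<subseteq> V" "supp (g + b) \<subseteq> V" and disjoint: "supp a \<inter> supp b = {}"
    and deg: "total_deg a = total_deg b" "2 \<le> total_deg a"
begin

abbreviation ideal_of :: "('v, 'k::field) mpoly set" where
  "ideal_of \<equiv> polyideal V (xpow ` {g + a, g + b})"

lemma mem_iff: "p \<in> ideal_of \<longleftrightarrow> p \<in> polys V \<and> (\<forall>m \<in> supp p. mdvd (g + a) m \<or> mdvd (g + b) m)"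
  using vars by (subst mem_monomial_ideal_iff) auto

lemma swap: "two_generators V g b a"
  using vars disjoint deg by unfold_locales auto

lemma not_mdvd: "\<not> mdvd a b" "\<not> mdvd (g + b) (g + a)"
proof -
  have n: "\<not> mdvd a' b'" if "supp a' \<inter> supp b' = {}" "2 \<le> total_deg a'" for a' b' :: "'v \<Rightarrow>\<^sub>0 nat"
  proof
    assume "mdvd a' b'"
    then have "supp a' = {}" using mdvd_supp[of a' b'] that by blast
    then show False using that by (simp add: total_deg_def)
  qed
  show "\<not> mdvd a b" using n disjoint deg by blast
  have "mdvd (g + b) (g + a) \<Longrightarrow> mdvd b a" by (simp add: mdvd_def lookup_add)
  then show "\<not> mdvd (g + b) (g + a)" using n[of b a] disjoint deg by auto
qed

lemma generators_neq: "g + a \<noteq> g + b"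
  using not_mdvd(2) by (metis mdvd_refl)

text \<open>In a linear resolution the generators would be combinations of \<open>x\<^sup>g\<^sup>+\<^sup>a\<close> and \<open>x\<^sup>g\<^sup>+\<^sup>b\<close> over the field
  and the first syzygies would be linear, so the coefficient of \<open>x\<^sup>g\<^sup>+\<^sup>a\<close> vanishes on all syzygies. But
  it does not vanish on the syzygy \<open>x\<^sup>b x\<^sup>g\<^sup>+\<^sup>a = x\<^sup>a x\<^sup>g\<^sup>+\<^sup>b\<close>.\<close>

theorem not_linear_resolution: "\<not> has_linear_resolution V (ideal_of :: ('v, 'k::field) mpoly set)"
proof
  let ?I = "ideal_of :: ('v, 'k) mpoly set"
  let ?u = "g + a" and ?v = "g + b"
  assume "has_linear_resolution V ?I"
  then obtain d where gen: "generated_in_degree V d ?I" and reg: "regularity V ?I = ereal (real d)"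
    unfolding has_linear_resolution_def by blast
  let ?S = "{(k, s). s \<in> shifts total_deg V ?I k}"
  \<comment> \<open>Without any shift the regularity would be the supremum of the empty set,
    -\<infinity>, and not a degree; hence some resolution \<open>F\<close>, \<open>D\<close> is
    available.\<close>
  have "?S \<noteq> {}"
  proof
    assume "?S = {}"
    then have "regularity V ?I = - \<infinity>" unfolding regularity_def by (simp add: bot_ereal_def)
    then show False using reg by simp
  qed
  then obtain F D where res: "minimal_free_resolution total_deg V ?I F D"
    unfolding shifts_def by blast
  have shift_le: "s \<le> d + k" if "s \<in> set (F k)" for s k
  proof -
    have "(k, s) \<in> ?S" using that res unfolding shifts_def by blast
    then have "(\<lambda>(k, s). ereal (real s - real k)) (k, s) \<le> regularity V ?I"
      unfolding regularity_def by (rule SUP_upper)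
    then show ?thesis using reg by simp
  qed
  have uI: "xpow ?u \<in> ?I" and vI: "xpow ?v \<in> ?I"
    unfolding mem_iff using vars by simp_all
  define e where "e = total_deg ?u"
  have ev: "e = total_deg ?v" by (simp add: e_def total_deg_add deg)
  \<comment> \<open>Elements of an ideal generated in degree \<open>d\<close> have no monomials of
    lower degree. With \<open>shift_le\<close> this confines the shifts in \<open>F 0\<close> to at
    most \<open>e\<close>.\<close>
  have de: "d \<le> e"
  proof -
    obtain B where B: "B \<subseteq> polys V" "\<forall>p \<in> B. \<forall>m \<in> supp p. total_deg m = d" "?I = polyideal V B"
      using gen unfolding generated_in_degree_def by blast
    have "xpow ?u \<in> polyideal V B" using uI B(3) by simp
    then have "\<forall>m \<in> supp (xpow ?u :: ('v, 'k) mpoly). d \<le> total_deg m"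
      by (rule polyideal_degree_ge[OF _ B(1)]) (use B(2) in blast)
    then show ?thesis by (simp add: e_def)
  qed
  let ?n = "length (F 0)"
  define f where "f i = D 0 $$ (0, i)" for i
  define c where "c i = coef (f i) ?u" for i
  define c' where "c' i = coef (f i) ?v" for i
  note D0 = pmatD(1)[OF res_pmat_0[OF res]] and D1 = pmatD(1)[OF res_pmat_Suc[OF res, of 0]]
  have z1: "0 < (1 :: nat)" by simp
  have suppf: "m = ?u \<or> m = ?v" "F 0 ! i = e" if i: "i < ?n" and m: "m \<in> supp (f i)" for i m
  proof -
    have "f i \<in> ?I" unfolding f_def by (rule res_entry_in_ideal[OF res i])
    then have dv: "mdvd ?u m \<or> mdvd ?v m" using m unfolding mem_iff by blast
    have "total_deg m = F 0 ! i"
      using res_homogeneous[OF res, of 0] i m unfolding homogeneous_mat_def f_def by (simp add: res_target_def)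
    moreover have "F 0 ! i \<le> e" using shift_le[of "F 0 ! i" 0] i de by simp
    ultimately have me: "total_deg m \<le> e" by simp
    then show "m = ?u \<or> m = ?v" using dv mdvd_eq[of ?u m] mdvd_eq[of ?v m] e_def ev by auto
    then show "F 0 ! i = e" using \<open>total_deg m = F 0 ! i\<close> e_def ev by auto
  qed
  have f_eq: "f i = monom ?u (c i) + monom ?v (c' i)" if i: "i < ?n" for i
  proof (rule poly_mapping_eqI)
    fix m
    show "coef (f i) m = coef (monom ?u (c i) + monom ?v (c' i)) m"
      using suppf(1)[OF i, of m] generators_neq
      by (cases "m \<in> supp (f i)") (auto simp: c_def c'_def lookup_add lookup_single when_def in_keys_iff)
  qed
  have comb: "(\<Sum>i < ?n. f i * h i) = xpow ?u * (\<Sum>i < ?n. monom 0 (c i) * h i) +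
      xpow ?v * (\<Sum>i < ?n. monom 0 (c' i) * h i)" for h
  proof -
    have "(\<Sum>i < ?n. f i * h i) = (\<Sum>i < ?n. xpow ?u * (monom 0 (c i) * h i) + xpow ?v * (monom 0 (c' i) * h i))"
    proof (rule sum.cong[OF refl])
      fix i assume "i \<in> {..<?n}"
      then have "f i = xpow ?u * monom 0 (c i) + xpow ?v * monom 0 (c' i)"
        using f_eq[of i] by (simp add: xpow_def mult_single)
      then show "f i * h i = xpow ?u * (monom 0 (c i) * h i) + xpow ?v * (monom 0 (c' i) * h i)"
        by (simp add: algebra_simps)
    qed
    then show ?thesis by (simp add: sum.distrib sum_distrib_left)
  qed
  \<comment> \<open>Coprimality makes \<open>xpow b\<close> divide the sum, whose monomials would
    then have degree at least 2; but the entries of \<open>D (Suc 0)\<close> in the rows with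
    \<open>c i \<noteq> 0\<close> have degree at most d + 1 - e \<le> 1.\<close>
  have syz: "(\<Sum>i < ?n. monom 0 (c i) * D (Suc 0) $$ (i, j)) = 0" if j: "j < length (F (Suc 0))" for j
  proof (rule ccontr)
    let ?p = "\<Sum>i < ?n. monom 0 (c i) * D (Suc 0) $$ (i, j)"
    let ?q = "\<Sum>i < ?n. monom 0 (c' i) * D (Suc 0) $$ (i, j)"
    assume "?p \<noteq> 0"
    then have "supp ?p \<noteq> {}" by simp
    then obtain m where m: "m \<in> supp ?p" by (elim exE[OF ex_in_conv[THEN iffD2]])
    have "(D 0 * D (Suc 0)) $$ (0, j) = 0"
      unfolding res_complex[OF res] using j by (simp add: res_target_def)
    then have "(\<Sum>i < ?n. f i * D (Suc 0) $$ (i, j)) = 0"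
      unfolding index_mult_mat_sum[OF D0 D1 z1 j] f_def .
    then have "xpow g * (xpow a * ?p + xpow b * ?q) = xpow g * 0"
      unfolding comb by (simp add: xpow_add distrib_left mult.assoc)
    then have "xpow a * ?p = - (xpow b * ?q)" unfolding xpow_mult_cancel by (simp add: eq_neg_iff_add_eq_0)
    moreover have "a + m \<in> supp (xpow a * ?p)" using m unfolding supp_xpow_mult by (rule imageI)
    ultimately have "a + m \<in> supp (xpow b * ?q)" by simp
    then obtain m' where "a + m = b + m'" unfolding supp_xpow_mult by (rule imageE)
    then have "mdvd b (a + m)" by simp
    then have "mdvd b m" by (rule mdvd_disjoint) (use disjoint in blast)
    then have "2 \<le> total_deg m" using mdvd_total_deg deg by fastforce
    moreover have "\<exists>i < ?n. c i \<noteq> 0 \<and> m \<in> supp (D (Suc 0) $$ (i, j))"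
    proof (rule ccontr)
      assume n: "\<not> ?thesis"
      have "coef (monom 0 (c i) * D (Suc 0) $$ (i, j)) m = 0" if "i < ?n" for i
        using n that coef_monom_mult[of 0 "c i" "D (Suc 0) $$ (i, j)" m] by (auto simp: in_keys_iff)
      then show False using m by (simp add: in_keys_iff lookup_sum)
    qed
    then obtain i where i: "i < ?n" "c i \<noteq> 0" "m \<in> supp (D (Suc 0) $$ (i, j))" by blast
    have "total_deg m + F 0 ! i = F (Suc 0) ! j"
      using res_homogeneous[OF res, of "Suc 0"] i j unfolding homogeneous_mat_def by (simp add: res_target_def)
    moreover have "F 0 ! i = e" using suppf(2)[OF i(1), of ?u] i(2) by (simp add: c_def in_keys_iff)
    moreover have "F (Suc 0) ! j \<le> d + 1" using shift_le[of "F (Suc 0) ! j" "Suc 0"] j by simp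
    ultimately show False using de by simp
  qed
  obtain h where h: "h \<in> free_vecs V ?n" "(D 0 *\<^sub>v h) $ 0 = xpow ?u"
    using uI res_image[OF res] by (smt (verit) mem_Collect_eq)
  obtain h' where h': "h' \<in> free_vecs V ?n" "(D 0 *\<^sub>v h') $ 0 = xpow ?v"
    using vI res_image[OF res] by (smt (verit) mem_Collect_eq)
  have hc: "h \<in> carrier_vec ?n" "h' \<in> carrier_vec ?n" using h(1) h'(1) by (simp_all add: free_vecs_iff)
  let ?P = "\<Sum>i < ?n. monom 0 (c i) * h $ i" and ?P' = "\<Sum>i < ?n. monom 0 (c i) * h' $ i"
  have fh: "(\<Sum>i < ?n. f i * h $ i) = xpow ?u" "(\<Sum>i < ?n. f i * h' $ i) = xpow ?v"
    using h(2) h'(2) unfolding index_mult_vec_sum[OF D0 hc(1) z1] index_mult_vec_sum[OF D0 hc(2) z1] f_def .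
  \<comment> \<open>The syzygy of the two generators, lifted through their preimages
    \<open>h\<close> and \<open>h'\<close>.\<close>
  define z where "z = vec ?n (\<lambda>i. xpow b * h $ i - xpow a * h' $ i)"
  have zc: "z \<in> carrier_vec ?n" by (simp add: z_def)
  have ab: "xpow a \<in> polys V" "xpow b \<in> polys V" using vars by (simp_all add: supp_add_nat)
  have zf: "z \<in> free_vecs V ?n"
    using h(1) h'(1) ab unfolding free_vecs_iff z_def by auto
  have "(D 0 *\<^sub>v z) $ 0 = (\<Sum>i < ?n. f i * z $ i)"
    unfolding index_mult_vec_sum[OF D0 zc z1] f_def ..
  also have "\<dots> = xpow b * (\<Sum>i < ?n. f i * h $ i) - xpow a * (\<Sum>i < ?n. f i * h' $ i)"
    by (simp add: z_def algebra_simps sum_subtractf sum_distrib_left)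
  also have "\<dots> = 0" unfolding fh by (simp add: xpow_add mult_ac)
  finally have "D 0 *\<^sub>v z = 0\<^sub>v 1" using D0 by (intro eq_vecI) auto
  then have "z \<in> mat_kernel (D 0)" by (rule mat_kernelI[OF D0 zc])
  then have "z \<in> {D (Suc 0) *\<^sub>v t | t. t \<in> free_vecs V (length (F (Suc 0)))}"
    using zf unfolding res_exact[OF res] by (rule IntI)
  then obtain t where t: "z = D (Suc 0) *\<^sub>v t" "t \<in> free_vecs V (length (F (Suc 0)))" by blast
  have tc: "t \<in> carrier_vec (length (F (Suc 0)))" using t(2) by (simp add: free_vecs_iff)
  have "(\<Sum>i < ?n. monom 0 (c i) * z $ i) =
      (\<Sum>i < ?n. \<Sum>j < length (F (Suc 0)). t $ j * (monom 0 (c i) * D (Suc 0) $$ (i, j)))"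
  proof (rule sum.cong[OF refl])
    fix i assume "i \<in> {..<?n}"
    then have "z $ i = (\<Sum>j < length (F (Suc 0)). D (Suc 0) $$ (i, j) * t $ j)"
      unfolding t(1) by (intro index_mult_vec_sum[OF D1 tc]) simp
    then show "monom 0 (c i) * z $ i = (\<Sum>j < length (F (Suc 0)). t $ j * (monom 0 (c i) * D (Suc 0) $$ (i, j)))"
      by (simp add: sum_distrib_left mult_ac)
  qed
  also have "\<dots> = (\<Sum>j < length (F (Suc 0)). t $ j * (\<Sum>i < ?n. monom 0 (c i) * D (Suc 0) $$ (i, j)))"
    unfolding sum_distrib_left by (rule sum.swap)
  also have "\<dots> = 0" using syz by simp
  \<comment> \<open>\<open>syz\<close> kills this combination of the entries of \<open>z\<close>.
    Comparing coefficients at \<open>b\<close>, which \<open>a\<close> does not divide, shows that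
    \<open>?P\<close> has constant coefficient 0, whereas \<open>comb\<close> for \<open>h\<close>
    demands 1.\<close>
  finally have "xpow b * ?P = xpow a * ?P'"
    by (simp add: z_def algebra_simps sum_subtractf sum_distrib_left)
  moreover have "coef (xpow a * ?P') b = 0" unfolding xpow_def by (rule coef_monom_mult_0[OF not_mdvd(1)])
  moreover have "coef (xpow b * ?P) b = coef ?P 0" using coef_xpow_mult[of b ?P 0] by simp
  ultimately have P0: "coef ?P 0 = 0" by simp
  have "coef (xpow ?v * (\<Sum>i < ?n. monom 0 (c' i) * h $ i)) ?u = 0"
    unfolding xpow_def by (rule coef_monom_mult_0[OF not_mdvd(2)])
  then have "coef (\<Sum>i < ?n. f i * h $ i) ?u = coef ?P 0"
    unfolding comb using coef_xpow_mult[of ?u ?P 0] by (simp add: lookup_add)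
  then show False unfolding fh using P0 by (simp add: coef_xpow)
qed

text \<open>The colon ideal is generated by \<open>xpow a\<close>: it is nonzero, so
  \<open>W\<close> would be nonempty, but it contains no variable since \<open>a\<close> has degree
  at least 2.\<close>

lemma colon_not_linear:
  assumes W: "W \<subseteq> V"
  shows "colon_ideal (poly_ring V) (polyideal V {xpow (g + a)}) (xpow (g + b)) \<noteq>
    (polyideal V (pvar ` W) :: ('v, 'k::field) mpoly set)"
proof
  assume eq: "colon_ideal (poly_ring V) (polyideal V {xpow (g + a)}) (xpow (g + b)) =
    (polyideal V (pvar ` W) :: ('v, 'k) mpoly set)"
  have iff: "r \<in> polyideal V (pvar ` W) \<longleftrightarrow> r \<in> polys V \<and>
      (\<forall>m \<in> supp (r * xpow (g + b)). mdvd (g + a) m)" for r :: "('v, 'k) mpoly"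
    unfolding eq[symmetric] colon_ideal_def using mem_monomial_ideal_iff[of "{g + a}" V "r * xpow (g + b)"] vars
    by auto
  have "supp a \<subseteq> V" using vars by (simp add: supp_add_nat)
  moreover have "xpow a * xpow (g + b) = (xpow (g + a + b) :: ('v, 'k) mpoly)"
    by (simp add: xpow_add mult_ac)
  ultimately have "xpow a \<in> (polyideal V (pvar ` W) :: ('v, 'k) mpoly set)"
    unfolding iff by simp
  moreover have "(pvar ` W :: ('v, 'k) mpoly set) = xpow ` ((\<lambda>w. Poly_Mapping.single w 1) ` W)"
    unfolding pvar_def image_image ..
  ultimately have aW: "(xpow a :: ('v, 'k) mpoly) \<in> polyideal V (xpow ` ((\<lambda>w. Poly_Mapping.single w 1) ` W))"
    by metis
  have "supp m \<subseteq> V" if "m \<in> (\<lambda>w. Poly_Mapping.single w (1::nat)) ` W" for m using that W by auto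
  then have "\<forall>m \<in> supp (xpow a :: ('v, 'k) mpoly). \<exists>m' \<in> (\<lambda>w. Poly_Mapping.single w 1) ` W. mdvd m' m"
    using aW mem_monomial_ideal_iff by blast
  then obtain w where w: "w \<in> W" by auto
  have "pvar ` W \<subseteq> (polys V :: ('v, 'k) mpoly set)" using W by auto
  then have "pvar w \<in> (polyideal V (pvar ` W) :: ('v, 'k) mpoly set)" using w by (intro polyideal_mem) auto
  then have "mdvd (g + a) (Poly_Mapping.single w 1 + (g + b))"
    unfolding iff pvar_def xpow_add[symmetric] by simp
  then have "mdvd a (b + Poly_Mapping.single w 1)" by (auto simp: mdvd_def lookup_add algebra_simps)
  then have "mdvd a (Poly_Mapping.single w 1)" by (rule mdvd_disjoint[OF _ disjoint])
  then show False using mdvd_total_deg deg by fastforce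
qed

theorem not_linear_quotients: "\<not> has_linear_quotients V (ideal_of :: ('v, 'k::field) mpoly set)"
proof
  interpret swap: two_generators V g b a by (rule swap)
  let ?I = "ideal_of :: ('v, 'k) mpoly set"
  let ?u = "xpow (g + a) :: ('v, 'k) mpoly" and ?v = "xpow (g + b) :: ('v, 'k) mpoly"
  assume "has_linear_quotients V ?I"
  then obtain ms where ms: "distinct ms" "minimal_monomial_generators V ?I (set ms)"
    and lin: "\<And>j. 1 \<le> j \<Longrightarrow> j < length ms \<Longrightarrow>
      \<exists>W\<subseteq>V. colon_ideal (poly_ring V) (polyideal V (set (take j ms))) (ms ! j) = polyideal V (pvar ` W)"
    unfolding has_linear_quotients_def by blast
  have gens: "set ms \<subseteq> monomials V" "polyideal V (set ms) = ?I" "\<And>B'. B' \<subset> set ms \<Longrightarrow> polyideal V B' \<noteq> ?I"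
    using ms(2) unfolding minimal_monomial_generators_def by blast+
  obtain A where A: "A \<subseteq> {m. supp m \<subseteq> V}" "set ms = xpow ` A"
    using gens(1) unfolding monomials_def by (rule subset_imageE)
  have AI: "mdvd (g + a) m \<or> mdvd (g + b) m" if "m \<in> A" for m
  proof -
    have "set ms \<subseteq> polys V" using A by auto
    then have "(xpow m :: ('v, 'k) mpoly) \<in> ?I" unfolding gens(2)[symmetric] using that A by (intro polyideal_mem) auto
    then show ?thesis unfolding mem_iff by simp
  qed
  have div: "\<exists>m \<in> A. mdvd m m0" if "m0 = g + a \<or> m0 = g + b" for m0
  proof -
    have "(xpow m0 :: ('v, 'k) mpoly) \<in> ?I" unfolding mem_iff using that vars by auto
    then have "(xpow m0 :: ('v, 'k) mpoly) \<in> polyideal V (xpow ` A)" using gens(2) A(2) by simp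
    then show ?thesis using mem_monomial_ideal_iff[of A V "xpow m0 :: ('v, 'k) mpoly"] A(1) by auto
  qed
  \<comment> \<open>A generator dividing \<open>g + a\<close> is itself divisible by one of the two
    exponents, which can only be \<open>g + a\<close>. So every monomial generating set contains
    both generators, and a minimal one nothing else.\<close>
  have inA: "g + a \<in> A" "g + b \<in> A"
  proof -
    obtain m where m: "m \<in> A" "mdvd m (g + a)" using div by blast
    then have "mdvd (g + a) m" using AI[OF m(1)] not_mdvd(2) mdvd_trans by blast
    then show "g + a \<in> A" using m mdvd_antisym by blast
    obtain m where m: "m \<in> A" "mdvd m (g + b)" using div by blast
    then have "mdvd (g + b) m" using AI[OF m(1)] swap.not_mdvd(2) mdvd_trans by blast
    then show "g + b \<in> A" using m mdvd_antisym by blast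
  qed
  have set_ms: "set ms = {?u, ?v}"
  proof (rule ccontr)
    assume "set ms \<noteq> {?u, ?v}"
    then have "{?u, ?v} \<subset> set ms" using inA A(2) by blast
    then show False using gens(3)[of "{?u, ?v}"] by simp
  qed
  have ne: "?u \<noteq> ?v" using generators_neq by (simp add: xpow_inj)
  have "length ms = 2" using distinct_card[OF ms(1)] set_ms ne by simp
  then obtain p q where pq: "ms = [p, q]" by (metis (no_types) length_0_conv length_Suc_conv numeral_2_eq_2)
  then have or: "(p = ?u \<and> q = ?v) \<or> (p = ?v \<and> q = ?u)" using set_ms ms(1) by (auto simp: doubleton_eq_iff)
  obtain W where "W \<subseteq> V" "colon_ideal (poly_ring V) (polyideal V {p}) q = polyideal V (pvar ` W)"
    using lin[of 1] pq by auto
  then show False using or colon_not_linear swap.colon_not_linear by blast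
qed

end


section \<open>The whiskered even cycles\<close>

text \<open>The monomial order behind the Noetherian property and Zariski's lemma requires a linear
  order on the variables; doubling the index separates \<open>xv\<close> from
  \<open>yv\<close>.\<close>

instantiation xy_vertex :: linorder
begin

primrec vertex_code :: "xy_vertex \<Rightarrow> nat" where
  "vertex_code (xv i) = 2 * i"
| "vertex_code (yv i) = 2 * i + 1"

definition "v \<le> w \<longleftrightarrow> vertex_code v \<le> vertex_code w"
definition "v < w \<longleftrightarrow> vertex_code v < vertex_code w"

instance
proof
  fix v w u :: xy_vertex
  show "v = w" if "v \<le> w" "w \<le> v"
  proof -
    have "vertex_code v = vertex_code w" using that by (simp add: less_eq_xy_vertex_def)
    then show ?thesis by (cases v; cases w) (simp_all, presburger+)
  qed
qed (auto simp: less_eq_xy_vertex_def less_xy_vertex_def)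

end

section \<open>Graph-theoretic properties of the whiskered cycle\<close>

definition cyc_next :: "nat \<Rightarrow> nat \<Rightarrow> nat" where
  "cyc_next k i = (if i = 2 * k then 1 else i + 1)"

definition cyc_indep :: "nat \<Rightarrow> nat set set" where
  "cyc_indep k = {F. F \<subseteq> {1..2 * k} \<and> (\<forall>i \<in> F. cyc_next k i \<notin> F)}"

lemma vset_whiskered_cycle: "vset (whiskered_cycle k) = xy_vars {1..2 * k}"
  by (simp add: whiskered_cycle_def xy_vars_def)

lemma eset_whiskered_cycle: "eset (whiskered_cycle k) =
    (\<lambda>i. {xv i, yv i}) ` {1..2 * k} \<union> (\<lambda>i. {xv i, xv (cyc_next k i)}) ` {1..2 * k}"
  unfolding whiskered_cycle_def cyc_next_def snd_conv setcompr_eq_image Collect_mem_eq ..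

lemma cyc_next_in: "i \<in> {1..2 * k} \<Longrightarrow> cyc_next k i \<in> {1..2 * k}"
  by (auto simp: cyc_next_def)

lemma cyc_next_parity: "i \<in> {1..2 * k} \<Longrightarrow> even (cyc_next k i) \<longleftrightarrow> odd i"
  by (auto simp: cyc_next_def)

lemma cyc_next_neq: "i \<in> {1..2 * k} \<Longrightarrow> cyc_next k i \<noteq> i"
  using cyc_next_parity by metis

lemma inj_cyc_next: "inj_on (cyc_next k) {1..2 * k}"
  by (auto simp: inj_on_def cyc_next_def split: if_splits)

lemma simple_whiskered_cycle: "simple_graph (whiskered_cycle k)"
  unfolding simple_graph_def
proof (intro conjI ballI)
  show "finite (vset (whiskered_cycle k))" unfolding vset_whiskered_cycle xy_vars_def by simp
  fix e assume "e \<in> eset (whiskered_cycle k)"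
  then consider i where "i \<in> {1..2 * k}" "e = {xv i, yv i}"
    | i where "i \<in> {1..2 * k}" "e = {xv i, xv (cyc_next k i)}"
    unfolding eset_whiskered_cycle by blast
  then have "e \<subseteq> xy_vars {1..2 * k} \<and> card e = 2"
  proof cases
    case 1
    then show ?thesis by (auto simp: xy_vars_def)
  next
    case 2
    then show ?thesis using cyc_next_in[OF 2(1)] cyc_next_neq[OF 2(1)] by (auto simp: xy_vars_def)
  qed
  then show "e \<subseteq> vset (whiskered_cycle k)" "card e = 2" unfolding vset_whiskered_cycle by blast+
qed

text \<open>The colour of \<open>xv i\<close> is the parity of \<open>i\<close>, that of
  \<open>yv i\<close> the opposite one; the length 2k is even, so the closing edge of the cycle also
  changes parity.\<close>

lemma bipartite_whiskered_cycle: "bipartite_graph (whiskered_cycle k)"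
  unfolding bipartite_graph_def
proof (intro exI conjI ballI)
  let ?N = "{1..2 * k}"
  let ?A = "xv ` {i \<in> ?N. odd i} \<union> yv ` {i \<in> ?N. even i}"
  let ?B = "xv ` {i \<in> ?N. even i} \<union> yv ` {i \<in> ?N. odd i}"
  show "?A \<union> ?B = vset (whiskered_cycle k)" unfolding vset_whiskered_cycle xy_vars_def by blast
  show "?A \<inter> ?B = {}" by auto
  fix e assume "e \<in> eset (whiskered_cycle k)"
  then consider i where "i \<in> ?N" "e = {xv i, yv i}" | i where "i \<in> ?N" "e = {xv i, xv (cyc_next k i)}"
    unfolding eset_whiskered_cycle by blast
  then show "\<exists>a \<in> ?A. \<exists>b \<in> ?B. e = {a, b}"
  proof cases
    case 1
    show ?thesis
    proof (cases "even i")
      case True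
      then have "yv i \<in> ?A" "xv i \<in> ?B" "e = {yv i, xv i}" using 1 by auto
      then show ?thesis by blast
    next
      case False
      then have "xv i \<in> ?A" "yv i \<in> ?B" using 1 by auto
      then show ?thesis using 1 by blast
    qed
  next
    case 2
    note n = cyc_next_in[OF 2(1)] cyc_next_parity[OF 2(1)]
    show ?thesis
    proof (cases "even i")
      case True
      then have "xv (cyc_next k i) \<in> ?A" "xv i \<in> ?B" "e = {xv (cyc_next k i), xv i}" using 2 n by auto
      then show ?thesis by blast
    next
      case False
      then have "xv i \<in> ?A" "xv (cyc_next k i) \<in> ?B" using 2 n by auto
      then show ?thesis using 2 by blast
    qed
  qed
qed

lemma whiskered_whiskered_cycle: "whiskered_graph (whiskered_cycle k)"
proof -
  let ?N = "{1..2 * k}"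
  let ?H = "(xv ` ?N, (\<lambda>i. {xv i, xv (cyc_next k i)}) ` ?N)"
  let ?w = "\<lambda>v. case v of xv i \<Rightarrow> yv i | yv i \<Rightarrow> yv i"
  have "simple_graph ?H"
    unfolding simple_graph_def
  proof (intro conjI ballI)
    fix e assume "e \<in> eset ?H"
    then obtain i where i: "i \<in> ?N" "e = {xv i, xv (cyc_next k i)}" by auto
    then show "e \<subseteq> vset ?H" "card e = 2" using cyc_next_in[OF i(1)] cyc_next_neq[OF i(1)] by auto
  qed simp
  moreover have "inj_on ?w (vset ?H)" "?w ` vset ?H \<inter> vset ?H = {}"
    by (auto simp: inj_on_def)
  moreover have "vset (whiskered_cycle k) = vset ?H \<union> ?w ` vset ?H"
    unfolding vset_whiskered_cycle xy_vars_def by (simp add: image_image)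
  moreover have "eset (whiskered_cycle k) = eset ?H \<union> (\<lambda>v. {v, ?w v}) ` vset ?H"
  proof -
    have "(\<lambda>v. {v, ?w v}) ` vset ?H = (\<lambda>i. {xv i, yv i}) ` ?N"
      by (simp add: image_image)
    then show ?thesis unfolding eset_whiskered_cycle by (simp add: Un_commute)
  qed
  ultimately show ?thesis unfolding whiskered_graph_def by blast
qed

section \<open>The cover ideal and its cells of dimension k\<close>

lemma cyc_complex: "subset_complex {1..2 * k} (cyc_indep k)"
  by unfold_locales (auto simp: cyc_indep_def)

lemma prod_pvar: "(\<Prod>v \<in> A. pvar v) = xpow (\<Sum>v \<in> A. Poly_Mapping.single v 1)"
  by (induction A rule: infinite_finite_induct) (auto simp: xpow_add pvar_def)

lemma prod_cover:
  assumes "finite N" "F \<subseteq> N"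
  shows "(\<Prod>v \<in> xv ` (N - F) \<union> yv ` F. pvar v) = xpow (cshift N (F, {}))"
proof -
  have fin: "finite F" using assms finite_subset by blast
  have "(\<Sum>v \<in> xv ` (N - F) \<union> yv ` F. Poly_Mapping.single v (1::nat)) =
      (\<Sum>v \<in> xv ` (N - F). Poly_Mapping.single v 1) + (\<Sum>v \<in> yv ` F. Poly_Mapping.single v 1)"
    using assms fin by (intro sum.union_disjoint) auto
  also have "\<dots> = cshift N (F, {})"
    by (simp add: cshift_def sum.reindex inj_on_def)
  finally show ?thesis unfolding prod_pvar by (rule arg_cong)
qed

text \<open>The x-vertices missed by a cover form an independent set \<open>F\<close>, and the
  whisker ends over \<open>F\<close> must then belong to it, so it contains the cover given by
  \<open>F\<close>. That cover is minimal because it meets every whisker in exactly one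
  vertex.\<close>

lemma minimal_vertex_cover_whiskered_cycle:
  "minimal_vertex_cover (whiskered_cycle k) C \<longleftrightarrow>
    (\<exists>F \<in> cyc_indep k. C = xv ` ({1..2 * k} - F) \<union> yv ` F)"
proof -
  let ?N = "{1..2 * k}" and ?G = "whiskered_cycle k"
  define cov where "cov F = xv ` (?N - F) \<union> yv ` F" for F
  have cover_iff: "vertex_cover ?G C \<longleftrightarrow> C \<subseteq> xy_vars ?N \<and> (\<forall>i \<in> ?N. xv i \<in> C \<or> yv i \<in> C) \<and>
      (\<forall>i \<in> ?N. xv i \<in> C \<or> xv (cyc_next k i) \<in> C)" for C
  proof -
    have int: "{a, b} \<inter> C \<noteq> {} \<longleftrightarrow> a \<in> C \<or> b \<in> C" for a b by auto
    show ?thesis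
      unfolding vertex_cover_def vset_whiskered_cycle eset_whiskered_cycle ball_Un ball_simps(9) int ..
  qed
  have cov: "vertex_cover ?G (cov F)" if F: "F \<in> cyc_indep k" for F
    using F cyc_next_in[of _ k] unfolding cover_iff cov_def cyc_indep_def xy_vars_def by auto
  have indep: "{i \<in> ?N. xv i \<notin> C} \<in> cyc_indep k" "cov {i \<in> ?N. xv i \<notin> C} \<subseteq> C"
    if "vertex_cover ?G C" for C
    using that cyc_next_in[of _ k] unfolding cover_iff cov_def cyc_indep_def by auto
  have "minimal_vertex_cover ?G C \<longleftrightarrow> (\<exists>F \<in> cyc_indep k. C = cov F)"
  proof
    assume C: "minimal_vertex_cover ?G C"
    then have v: "vertex_cover ?G C" by (simp add: minimal_vertex_cover_def)
    have "cov {i \<in> ?N. xv i \<notin> C} = C"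
    proof (rule ccontr)
      assume "cov {i \<in> ?N. xv i \<notin> C} \<noteq> C"
      then have "cov {i \<in> ?N. xv i \<notin> C} \<subset> C" using indep(2)[OF v] by blast
      then show False using C cov[OF indep(1)[OF v]] unfolding minimal_vertex_cover_def by blast
    qed
    then show "\<exists>F \<in> cyc_indep k. C = cov F" using indep(1)[OF v] by metis
  next
    assume "\<exists>F \<in> cyc_indep k. C = cov F"
    then obtain F where F: "F \<in> cyc_indep k" "C = cov F" by blast
    have FN: "F \<subseteq> ?N" using F by (simp add: cyc_indep_def)
    have "\<not> vertex_cover ?G D" if "D \<subset> C" for D
    proof
      assume D: "vertex_cover ?G D"
      have "cov F \<subseteq> D"
      proof
        fix v assume "v \<in> cov F"
        then consider i where "i \<in> ?N - F" "v = xv i" | i where "i \<in> F" "v = yv i" by (auto simp: cov_def)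
        then show "v \<in> D"
        proof cases
          case 1
          then have "yv i \<notin> D" using \<open>D \<subset> C\<close> F by (auto simp: cov_def)
          then show ?thesis using D 1 unfolding cover_iff by blast
        next
          case 2
          then have "xv i \<notin> D" using \<open>D \<subset> C\<close> F by (auto simp: cov_def)
          then show ?thesis using D 2 FN unfolding cover_iff by blast
        qed
      qed
      then show False using that F by blast
    qed
    then show "minimal_vertex_cover ?G C" unfolding minimal_vertex_cover_def using cov F by blast
  qed
  then show ?thesis unfolding cov_def .
qed

lemma vertex_cover_ideal_whiskered_cycle:
  "vertex_cover_ideal (whiskered_cycle k) =
    (polyideal (xy_vars {1..2 * k}) (xpow ` cshift {1..2 * k} ` cells (cyc_indep k) 0) ::
      (xy_vertex, 'k::field) mpoly set)"
proof -
  let ?N = "{1..2 * k}"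
  interpret subset_complex ?N "cyc_indep k" by (rule cyc_complex)
  have "{\<Prod>v \<in> C. pvar v :: (xy_vertex, 'k) mpoly | C. minimal_vertex_cover (whiskered_cycle k) C} =
      (\<lambda>F. \<Prod>v \<in> xv ` (?N - F) \<union> yv ` F. pvar v) ` cyc_indep k"
    unfolding minimal_vertex_cover_whiskered_cycle by blast
  also have "\<dots> = (\<lambda>F. xpow (cshift ?N (F, {}))) ` cyc_indep k"
    by (rule image_cong[OF refl prod_cover[OF finite_N sub]])
  also have "\<dots> = xpow ` cshift ?N ` cells (cyc_indep k) 0" unfolding cells_0 image_image ..
  finally show ?thesis unfolding vertex_cover_ideal_def vset_whiskered_cycle by simp
qed

definition odds :: "nat \<Rightarrow> nat set" where "odds k = (\<lambda>m. 2 * m + 1) ` {..<k}"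
definition evens :: "nat \<Rightarrow> nat set" where "evens k = (\<lambda>m. 2 * m + 2) ` {..<k}"

lemma card_odds: "card (odds k) = k" and card_evens: "card (evens k) = k"
  by (simp_all add: odds_def evens_def card_image inj_on_def)

lemma odds_indep: "odds k \<in> cyc_indep k" and evens_indep: "evens k \<in> cyc_indep k"
proof -
  have o: "odds k \<subseteq> {1..2 * k}" "\<And>i. i \<in> odds k \<Longrightarrow> odd i" by (auto simp: odds_def)
  have e: "evens k \<subseteq> {1..2 * k}" "\<And>i. i \<in> evens k \<Longrightarrow> even i" by (auto simp: evens_def)
  show "odds k \<in> cyc_indep k" unfolding cyc_indep_def using o cyc_next_parity[of _ k] by blast
  show "evens k \<in> cyc_indep k" unfolding cyc_indep_def using e cyc_next_parity[of _ k] by blast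
qed

text \<open>\<open>F\<close> and its shift by one are disjoint in a set of 2k elements, so
  \<open>card F \<le> k\<close>. In case of equality they fill the whole cycle, and \<open>F\<close>
  is closed under the shift by two, hence a parity class.\<close>

lemma cells_cyc_indep:
  assumes k: "k \<ge> 1"
  shows "cells (cyc_indep k) k = {(odds k, odds k), (evens k, evens k)}"
proof
  show "{(odds k, odds k), (evens k, evens k)} \<subseteq> cells (cyc_indep k) k"
    using odds_indep evens_indep card_odds card_evens by (auto simp: cells_def)
  show "cells (cyc_indep k) k \<subseteq> {(odds k, odds k), (evens k, evens k)}"
  proof
    let ?N = "{1..2 * k}"
    fix C assume "C \<in> cells (cyc_indep k) k"
    then obtain F S where C: "C = (F, S)" "F \<in> cyc_indep k" "S \<subseteq> F" "card S = k" by (auto simp: cells_def)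
    have FN: "F \<subseteq> ?N" and ind: "\<And>i. i \<in> F \<Longrightarrow> cyc_next k i \<notin> F" using C by (auto simp: cyc_indep_def)
    have finF: "finite F" using FN finite_subset by blast
    have nN: "cyc_next k ` F \<subseteq> ?N" using FN cyc_next_in by blast
    have "card (cyc_next k ` F) = card F" by (rule card_image[OF inj_on_subset[OF inj_cyc_next FN]])
    moreover have "F \<inter> cyc_next k ` F = {}" using ind by blast
    ultimately have cU: "card (F \<union> cyc_next k ` F) = 2 * card F"
      using finF by (simp add: card_Un_disjoint)
    moreover have "card (F \<union> cyc_next k ` F) \<le> card ?N" using FN nN by (intro card_mono) auto
    ultimately have "card F \<le> k" by simp
    then have SF: "S = F" using C finF card_seteq by metis
    then have cF: "card F = k" using C by simp
    have all: "F \<union> cyc_next k ` F = ?N"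
      by (rule card_subset_eq) (use FN nN cU cF in auto)
    \<comment> \<open>A missing second successor would be the successor of some \<open>l\<close> in
      \<open>F\<close>; injectivity makes \<open>l\<close> the successor of \<open>i\<close>,
      against independence.\<close>
    have step: "cyc_next k (cyc_next k i) \<in> F" if i: "i \<in> F" for i
    proof (rule ccontr)
      assume n: "cyc_next k (cyc_next k i) \<notin> F"
      have iN: "i \<in> ?N" using i FN by blast
      have "cyc_next k (cyc_next k i) \<in> ?N" by (intro cyc_next_in iN)
      then obtain l where l: "l \<in> F" "cyc_next k (cyc_next k i) = cyc_next k l" using all n by blast
      then have "cyc_next k i = l"
        using inj_onD[OF inj_cyc_next l(2) cyc_next_in[OF iN]] FN by blast
      then show False using ind[OF i] l by simp
    qed
    have "F = odds k \<or> F = evens k"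
    proof (cases "1 \<in> F")
      case True
      have "2 * m + 1 \<in> F" if "m < k" for m
        using that
      proof (induction m)
        case (Suc m)
        then show ?case using step[of "2 * m + 1"] by (simp add: cyc_next_def)
      qed (use True in simp)
      then have "odds k \<subseteq> F" by (auto simp: odds_def)
      then show ?thesis using card_subset_eq[OF finF] card_odds cF by metis
    next
      case False
      have "1 \<in> F \<union> cyc_next k ` F" unfolding all using k by simp
      then have "1 \<in> cyc_next k ` F" using False by (meson UnE)
      then obtain l where l: "1 = cyc_next k l" "l \<in> F" by (rule imageE)
      \<comment> \<open>Only the index 2k is followed by 1; its second successor 2 then starts the
        even indices.\<close>
      have "l = 2 * k"
      proof (rule ccontr)
        assume "l \<noteq> 2 * k"
        then have "cyc_next k l = l + 1" by (simp add: cyc_next_def)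
        moreover have "1 \<le> l" using subsetD[OF FN l(2)] by simp
        ultimately show False using l(1) by linarith
      qed
      then have "2 * k \<in> F" using l(2) by (rule subst)
      have "2 * m + 2 \<in> F" if "m < k" for m
        using that
      proof (induction m)
        case 0
        then show ?case using step[OF \<open>2 * k \<in> F\<close>] k by (simp add: cyc_next_def)
      next
        case (Suc m)
        then show ?case using step[of "2 * m + 2"] by (simp add: cyc_next_def)
      qed
      then have "evens k \<subseteq> F" by (auto simp: evens_def)
      then show ?thesis using card_subset_eq[OF finF] card_evens cF by metis
    qed
    then show "C \<in> {(odds k, odds k), (evens k, evens k)}" using C SF by auto
  qed
qed

lemma supp_sum_single: "supp (\<Sum>i \<in> A. Poly_Mapping.single (f i) (1::nat)) \<subseteq> f ` A"
  by (induction A rule: infinite_finite_induct) (auto simp: supp_add_nat)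

lemma total_deg_sum_single: "total_deg (\<Sum>i \<in> A. Poly_Mapping.single (f i) 1) = card A"
  by (induction A rule: infinite_finite_induct) (auto simp: total_deg_add)

theorem theorem2p7:
  fixes k :: nat
  assumes "k \<ge> 2"
  shows "simple_graph (whiskered_cycle k) \<and>
    Cohen_Macaulay_graph TYPE('k::field) (whiskered_cycle k) \<and>
    bipartite_graph (whiskered_cycle k) \<and>
    whiskered_graph (whiskered_cycle k) \<and>
    \<not> has_linear_resolution (vset (whiskered_cycle k))
        (HS (vset (whiskered_cycle k)) k
          (vertex_cover_ideal (whiskered_cycle k) :: (xy_vertex, 'k) mpoly set)) \<and>
    \<not> has_linear_quotients (vset (whiskered_cycle k))
        (HS (vset (whiskered_cycle k)) k
          (vertex_cover_ideal (whiskered_cycle k) :: (xy_vertex, 'k) mpoly set))"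
proof -
  let ?N = "{1..2 * k}"
  interpret subset_complex ?N "cyc_indep k" by (rule cyc_complex)
  define g where "g = (\<Sum>i \<in> ?N. Poly_Mapping.single (xv i) (1::nat))"
  define y where "y A = (\<Sum>i \<in> A. Poly_Mapping.single (yv i) (1::nat))" for A
  have suppg: "supp g \<subseteq> xv ` ?N" unfolding g_def by (rule supp_sum_single)
  have suppy: "supp (y A) \<subseteq> yv ` A" for A unfolding y_def by (rule supp_sum_single)
  have sub': "odds k \<subseteq> ?N" "evens k \<subseteq> ?N" using sub odds_indep evens_indep by blast+
  \<comment> \<open>For \<open>S = F\<close> the x-part is the product of all \<open>xv i\<close>,
    whatever \<open>F\<close> is; it becomes the common divisor \<open>g\<close>.\<close>
  have sh: "cshift ?N (F, F) = g + y F" if "F \<subseteq> ?N" for F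
  proof -
    have "(?N - F) \<union> F = ?N" using that by blast
    then show ?thesis by (simp add: cshift_def g_def y_def)
  qed
  interpret two_generators "xy_vars ?N" g "y (odds k)" "y (evens k)"
  proof
    show "supp (g + y (odds k)) \<subseteq> xy_vars ?N" "supp (g + y (evens k)) \<subseteq> xy_vars ?N"
      using suppg suppy sub' unfolding supp_add_nat xy_vars_def by blast+
    have "odds k \<inter> evens k = {}" by (auto simp: odds_def evens_def) presburger
    then show "supp (y (odds k)) \<inter> supp (y (evens k)) = {}"
      using suppy[of "odds k"] suppy[of "evens k"] by auto
    show "total_deg (y (odds k)) = total_deg (y (evens k))" "2 \<le> total_deg (y (odds k))"
      unfolding y_def total_deg_sum_single card_odds card_evens using assms by simp_all
  qed
  have "1 \<le> k" using assms by simp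
  then have cells: "cshift ?N ` cells (cyc_indep k) k = {g + y (odds k), g + y (evens k)}"
    unfolding cells_cyc_indep[OF \<open>1 \<le> k\<close>] image_insert image_empty sh[OF sub'(1)] sh[OF sub'(2)] by simp
  have "HS (xy_vars ?N) k (vertex_cover_ideal (whiskered_cycle k) :: (xy_vertex, 'k) mpoly set) = ideal_of"
    unfolding HS_def vertex_cover_ideal_whiskered_cycle shifts_cover_ideal cells ..
  then show ?thesis
    using simple_whiskered_cycle bipartite_whiskered_cycle whiskered_whiskered_cycle
      whiskered_Cohen_Macaulay[OF whiskered_whiskered_cycle] not_linear_resolution not_linear_quotients
    unfolding vset_whiskered_cycle by metis
qed

end
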